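(* Let $F:\mathbb{R}^2\to[0,+\infty)$ be a $1$-homogeneous function, smooth and positive away from the origin, let $W=\{F(r_1^2,r_2^2)\leq1\}\subset\mathbb{R}^4$ be the corresponding Reinhardt domain, and let $\lambda$ be the contact form on $\partial W\simeq S^3$ obtained by restricting $\lambda_0=\frac12\sum_{j=1}^2r_j^2\,d\theta_j$. Then $\rho_-(\lambda)\leq1\leq\rho_+(\lambda)$. Moreover, the systolic norm satisfies $\|\lambda\|_{\rm sys}=0$ if and only if $W$ is an ellipsoid.
   Context: $\mathbb{R}^4$ has coordinates $(x_1,y_1,x_2,y_2)$, polar coordinates $x_j=r_j\cos\theta_j$, $y_j=r_j\sin\theta_j$, and standard symplectic form $\omega_0=\sum_jr_j\,dr_j\wedge d\theta_j=d\lambda_0$. $1$-homogeneous means $F(sv)=sF(v)$ for $s\geq0$. Ellipsoid means a set of the form $\{\alpha r_1^2+\beta r_2^2\leq1\}$ with $\alpha,\beta>0$, i.e. $F$ agrees with a linear function on the closed first quadrant. For a contact form $\lambda$ on $S^3$ (a $1$-form with $\lambda\wedge d\lambda$ a volume form, which is used to orient $S^3$), the Reeb vector field $X$ is determined by $i_Xd\lambda=0$, $i_X\lambda=1$, and $\mathrm{vol}(\lambda)=\int_{S^3}\lambda\wedge d\lambda$. A periodic Reeb orbit $\gamma$ is a periodic trajectory of $X$ together with a choice of positive period $T(\gamma)$, not necessarily primitive, viewed as a possibly multiply covered knot oriented by the flow. For geometrically distinct (i.e. with disjoint images) periodic Reeb orbits $\gamma_1,\gamma_2$ set $$\rho(\gamma_1,\gamma_2)=\frac{\mathrm{link}(\gamma_1,\gamma_2)\,\mathrm{vol}(\lambda)}{T(\gamma_1)T(\gamma_2)},$$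 where $\mathrm{link}$ is the linking number. Let $\rho_-(\lambda)=\inf\rho(\gamma_1,\gamma_2)$ and $\rho_+(\lambda)=\sup\rho(\gamma_1,\gamma_2)$ over all pairs of geometrically distinct periodic Reeb orbits; the systolic norm is $\|\lambda\|_{\rm sys}=\rho_+(\lambda)-\rho_-(\lambda)$. *)

theory Defs
  imports "HOL-Analysis.Analysis"
begin

text \<open>
  Points of \<open>real ^ 4\<close> are \<open>(x1, y1, x2, y2)\<close>.  A differential form is a function of a base point
  followed by tangent vectors.
\<close>

type_synonym form1 = "real ^ 4 \<Rightarrow> real ^ 4 \<Rightarrow> real"
type_synonym form2 = "real ^ 4 \<Rightarrow> real ^ 4 \<Rightarrow> real ^ 4 \<Rightarrow> real"
type_synonym form3 = "real ^ 4 \<Rightarrow> real ^ 4 \<Rightarrow> real ^ 4 \<Rightarrow> real ^ 4 \<Rightarrow> real"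

text \<open>\<open>C\<^sup>k\<close> and \<open>C\<^sup>\<infinity>\<close> regularity; meant for open \<open>S\<close>.\<close>

primrec Ck_on :: "nat \<Rightarrow> 'a::euclidean_space set \<Rightarrow> ('a \<Rightarrow> real) \<Rightarrow> bool" where
  "Ck_on 0 S f \<longleftrightarrow> continuous_on S f"
| "Ck_on (Suc k) S f \<longleftrightarrow>
     (\<forall>x\<in>S. f differentiable (at x)) \<and> (\<forall>v. Ck_on k S (\<lambda>x. frechet_derivative f (at x) v))"

definition smooth_on :: "'a::euclidean_space set \<Rightarrow> ('a \<Rightarrow> real) \<Rightarrow> bool" where
  "smooth_on S f \<longleftrightarrow> (\<forall>k. Ck_on k S f)"


definition reinhardt :: "(real \<times> real \<Rightarrow> real) \<Rightarrow> (real ^ 4) set" where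
  "reinhardt F = {p. F ((p$1)\<^sup>2 + (p$2)\<^sup>2, (p$3)\<^sup>2 + (p$4)\<^sup>2) \<le> 1}"

definition is_ellipsoid :: "(real ^ 4) set \<Rightarrow> bool" where
  "is_ellipsoid W \<longleftrightarrow> (\<exists>\<alpha> \<beta> :: real. \<alpha> > 0 \<and> \<beta> > 0 \<and>
     W = {p. \<alpha> * ((p$1)\<^sup>2 + (p$2)\<^sup>2) + \<beta> * ((p$3)\<^sup>2 + (p$4)\<^sup>2) \<le> 1})"

text \<open>
  \<open>\<lambda>\<^sub>0 = 1/2 \<Sum> r\<^sub>j\<^sup>2 d\<theta>\<^sub>j\<close>, written as \<open>1/2 \<Sum> (x\<^sub>j dy\<^sub>j - y\<^sub>j dx\<^sub>j)\<close> so that it makes sense on the axes too.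
\<close>

definition lambda0 :: form1 where
  "lambda0 p v = (p$1 * v$2 - p$2 * v$1 + p$3 * v$4 - p$4 * v$3) / 2"

definition ext_deriv :: "form1 \<Rightarrow> form2" where
  "ext_deriv \<alpha> p u v =
     frechet_derivative (\<lambda>q. \<alpha> q v) (at p) u - frechet_derivative (\<lambda>q. \<alpha> q u) (at p) v"

definition wedge12 :: "form1 \<Rightarrow> form2 \<Rightarrow> form3" where
  "wedge12 \<alpha> \<beta> p u v w = \<alpha> p u * \<beta> p v w + \<alpha> p v * \<beta> p w u + \<alpha> p w * \<beta> p u v"


text \<open>
  In the rest of the theory \<open>M\<close> is a hypersurface that is star-shaped about the origin (each open ray
  from \<open>0\<close> meets it exactly once, transversally), hence identified with the 3-sphere by radial
  projection, and the contact form on \<open>M\<close> is the restriction of a 1-form \<open>\<alpha>\<close> on the ambient space to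
  the tangent spaces of \<open>M\<close>.  Its exterior derivative is the restriction of \<open>ext_deriv \<alpha>\<close>.
\<close>

definition tangent_vectors :: "(real ^ 4) set \<Rightarrow> real ^ 4 \<Rightarrow> (real ^ 4) set" where
  "tangent_vectors M p = {v. \<exists>c \<epsilon>. \<epsilon> > 0 \<and> (\<forall>t. \<bar>t\<bar> < \<epsilon> \<longrightarrow> c t \<in> M) \<and> c 0 = p \<and>
     (c has_vector_derivative v) (at (0::real))}"

definition is_reeb_vector :: "(real ^ 4) set \<Rightarrow> form1 \<Rightarrow> real ^ 4 \<Rightarrow> real ^ 4 \<Rightarrow> bool" where
  "is_reeb_vector M \<alpha> p X \<longleftrightarrow> X \<in> tangent_vectors M p \<and>
     (\<forall>v \<in> tangent_vectors M p. ext_deriv \<alpha> p X v = 0) \<and> \<alpha> p X = 1"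

text \<open>A periodic orbit is a trajectory together with a positive, possibly non-primitive, period.\<close>

type_synonym orbit = "(real \<Rightarrow> real ^ 4) \<times> real"

definition periodic_reeb_orbit :: "(real ^ 4) set \<Rightarrow> form1 \<Rightarrow> orbit \<Rightarrow> bool" where
  "periodic_reeb_orbit M \<alpha> = (\<lambda>(\<gamma>, T). T > 0 \<and> (\<forall>t. \<gamma> (t + T) = \<gamma> t) \<and>
     (\<forall>t. \<gamma> t \<in> M \<and>
       (\<exists>X. is_reeb_vector M \<alpha> (\<gamma> t) X \<and> (\<gamma> has_vector_derivative X) (at t))))"

definition geom_distinct :: "orbit \<Rightarrow> orbit \<Rightarrow> bool" where
  "geom_distinct = (\<lambda>(\<gamma>1, T1) (\<gamma>2, T2). range \<gamma>1 \<inter> range \<gamma>2 = {})"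


text \<open>
  The volume is computed in the parametrization of \<open>M\<close> that is the radial projection of polar
  coordinates on the unit sphere; it is injective up to a null set.  Because \<open>M\<close> is oriented by
  \<open>\<alpha> \<and> d\<alpha>\<close> itself, the integral of this 3-form is the integral of its absolute value.
\<close>

definition sphere_param :: "real \<times> real \<times> real \<Rightarrow> real ^ 4" where
  "sphere_param = (\<lambda>(\<eta>, \<theta>1, \<theta>2).
     vector [cos \<eta> * cos \<theta>1, cos \<eta> * sin \<theta>1, sin \<eta> * cos \<theta>2, sin \<eta> * sin \<theta>2])"

definition radial_point :: "(real ^ 4) set \<Rightarrow> real ^ 4 \<Rightarrow> real ^ 4" where
  "radial_point M u = (THE s::real. s > 0 \<and> s *\<^sub>R u \<in> M) *\<^sub>R u"

definition contact_volume :: "(real ^ 4) set \<Rightarrow> form1 \<Rightarrow> real" where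
  "contact_volume M \<alpha> =
     (let \<Phi> = radial_point M \<circ> sphere_param in
      set_lebesgue_integral lborel ({0..pi/2} \<times> {0..2*pi} \<times> {0..2*pi})
        (\<lambda>q. let D = frechet_derivative \<Phi> (at q) in
           \<bar>wedge12 \<alpha> (ext_deriv \<alpha>) (\<Phi> q) (D (1, 0, 0)) (D (0, 1, 0)) (D (0, 0, 1))\<bar>))"


text \<open>
  Linking numbers of closed curves in \<open>M\<close> are given by the Gauss linking integral on the 3-sphere.
  Two disjoint closed curves \<open>\<gamma>1\<close>, \<open>\<gamma>2\<close> in \<open>M\<close> never lie on a common ray from the origin, so
  \<open>G(s, u, t) = \<gamma>1(s) - u \<gamma>2(t)\<close>, for \<open>u > 0\<close>, avoids the origin.  The linking number is the degree of
  \<open>G / |G|\<close>, a map from the join of two circles (a 3-sphere) to the unit sphere: the integral of the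
  pull-back by \<open>G\<close> of the solid angle form, divided by the area \<open>2 \<pi>\<^sup>2\<close> of the unit sphere.  The
  arguments of the solid angle form below are \<open>G\<close> and its partial derivatives in \<open>s\<close>, \<open>u\<close>, \<open>t\<close>.

  The value only depends on the radial projections of the curves to the unit sphere.  For curves
  \<open>x\<close>, \<open>y\<close> in the unit sphere, carrying out the integration over \<open>u\<close> gives the formula of DeTurck and
  Gluck (Electrodynamics and the Gauss linking integral on the 3-sphere and in hyperbolic 3-space),
  the double integral of
  \<open>(1 / (4 \<pi>\<^sup>2)) (((\<pi> - a) cos a + sin a) / sin\<^sup>3 a) det (x, x', y, y')\<close>,
  where \<open>a\<close> is the angle between \<open>x(s)\<close> and \<open>y(t)\<close>.

  Orientation: the 3-sphere is the boundary of the ball in \<open>real ^ 4\<close> oriented by \<open>d\<lambda>\<^sub>0 \<and> d\<lambda>\<^sub>0\<close>, which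
  is the orientation given by \<open>\<lambda>\<^sub>0 \<and> d\<lambda>\<^sub>0\<close>; the fibres of the Hopf fibration then have linking number
  \<open>1\<close>.  Since \<open>s\<close> and \<open>t\<close> range over full periods, multiply covered curves count with multiplicity.
\<close>

definition solid_angle_form :: form3 where
  "solid_angle_form p a b c = det (vector [p, a, b, c] :: real ^ 4 ^ 4) / norm p ^ 4"

definition linking_number :: "orbit \<Rightarrow> orbit \<Rightarrow> real" where
  "linking_number = (\<lambda>(\<gamma>1, T1) (\<gamma>2, T2).
     set_lebesgue_integral lborel ({0..T1} \<times> {0<..} \<times> {0..T2})
       (\<lambda>(s, u, t). solid_angle_form (\<gamma>1 s - u *\<^sub>R \<gamma>2 t)
          (vector_derivative \<gamma>1 (at s)) (- \<gamma>2 t) (- (u *\<^sub>R vector_derivative \<gamma>2 (at t))))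
     / (2 * pi\<^sup>2))"


definition rho :: "(real ^ 4) set \<Rightarrow> form1 \<Rightarrow> orbit \<Rightarrow> orbit \<Rightarrow> real" where
  "rho M \<alpha> g1 g2 = linking_number g1 g2 * contact_volume M \<alpha> / (snd g1 * snd g2)"

definition distinct_orbit_pairs :: "(real ^ 4) set \<Rightarrow> form1 \<Rightarrow> (orbit \<times> orbit) set" where
  "distinct_orbit_pairs M \<alpha> = {(g1, g2).
     periodic_reeb_orbit M \<alpha> g1 \<and> periodic_reeb_orbit M \<alpha> g2 \<and> geom_distinct g1 g2}"

text \<open>The infimum and supremum are taken in \<open>ereal\<close>, so that boundedness need not be presupposed.\<close>

definition rho_minus :: "(real ^ 4) set \<Rightarrow> form1 \<Rightarrow> ereal" where
  "rho_minus M \<alpha> = (INF (g1, g2) \<in> distinct_orbit_pairs M \<alpha>. ereal (rho M \<alpha> g1 g2))"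

definition rho_plus :: "(real ^ 4) set \<Rightarrow> form1 \<Rightarrow> ereal" where
  "rho_plus M \<alpha> = (SUP (g1, g2) \<in> distinct_orbit_pairs M \<alpha>. ereal (rho M \<alpha> g1 g2))"

definition sys_norm :: "(real ^ 4) set \<Rightarrow> form1 \<Rightarrow> ereal" where
  "sys_norm M \<alpha> = rho_plus M \<alpha> - rho_minus M \<alpha>"

end

theory Submission
  imports Defs
begin

text \<open>
  The Reeb flow on \<open>\<partial>W\<close> rotates \<open>\<theta>\<^sub>j\<close> with speed \<open>2 F\<^sub>j\<close>, where \<open>F\<^sub>j\<close> is the \<open>j\<close>-th partial derivative of \<open>F\<close> at
  \<open>(r\<^sub>1\<^sup>2, r\<^sub>2\<^sup>2)\<close>, so its closed orbits are the two coordinate circles and the orbits on tori with rational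
  slope \<open>F\<^sub>1 : F\<^sub>2\<close>.  Put \<open>f t = F (1 - t, t)\<close> and \<open>L = \<integral> dt / f\<^sup>2\<close> over \<open>[0, 1]\<close>.  The volume is \<open>\<pi>\<^sup>2 L\<close>, and the circle
  \<open>r\<^sub>2 = 0\<close> together with an orbit over \<open>t\<close> has \<open>\<rho> = L F(1, 0) F\<^sub>2(1 - t, t)\<close>.  Since
  \<open>((1 - t) / f)' = - F\<^sub>2 / f\<^sup>2\<close>, the mean of this value with respect to \<open>dt / f\<^sup>2\<close> is \<open>1\<close>.  Hence either \<open>F\<^sub>2\<close> is
  constant on the quadrant and \<open>W\<close> is an ellipsoid, or the value lies strictly below \<open>1\<close> at some points and
  strictly above \<open>1\<close> at others, and then also at such points with rational slope: on an interval without
  rational slopes the slope, and with it \<open>F\<^sub>2\<close>, is constant.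

  On an ellipsoid \<open>\<alpha> r\<^sub>1\<^sup>2 + \<beta> r\<^sub>2\<^sup>2 \<le> 1\<close> all orbits have the frequencies \<open>2\<alpha>\<close>, \<open>2\<beta>\<close>; shrinking one component
  of an orbit to \<open>0\<close> does not change the Gauss integral, so every pair has linking number
  \<open>\<alpha> \<beta> T\<^sub>1 T\<^sub>2 / \<pi>\<^sup>2\<close>, that is \<open>\<rho> = 1\<close>.
\<close>

section \<open>Determinants and the Poisson kernel\<close>

lemma vector_4 [simp]:
  "(vector [x, y, z, w] :: 'a::zero ^ 4) $ 1 = x"
  "(vector [x, y, z, w] :: 'a::zero ^ 4) $ 2 = y"
  "(vector [x, y, z, w] :: 'a::zero ^ 4) $ 3 = z"
  "(vector [x, y, z, w] :: 'a::zero ^ 4) $ 4 = w"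
  by (simp_all add: vector_def)

text \<open>Laplace expansion along the first two rows: each term pairs a minor of these rows with
  the complementary minor of the last two. In the linking integrand the two pairs of rows belong to
  the two curves.\<close>

lemma det_4:
  fixes A :: "'a::comm_ring_1 ^ 4 ^ 4"
  shows "det A =
    (A$1$1 * A$2$2 - A$1$2 * A$2$1) * (A$3$3 * A$4$4 - A$3$4 * A$4$3)
  - (A$1$1 * A$2$3 - A$1$3 * A$2$1) * (A$3$2 * A$4$4 - A$3$4 * A$4$2)
  + (A$1$1 * A$2$4 - A$1$4 * A$2$1) * (A$3$2 * A$4$3 - A$3$3 * A$4$2)
  + (A$1$2 * A$2$3 - A$1$3 * A$2$2) * (A$3$1 * A$4$4 - A$3$4 * A$4$1)
  - (A$1$2 * A$2$4 - A$1$4 * A$2$2) * (A$3$1 * A$4$3 - A$3$3 * A$4$1)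
  + (A$1$3 * A$2$4 - A$1$4 * A$2$3) * (A$3$1 * A$4$2 - A$3$2 * A$4$1)"
proof -
  have f234: "finite {2::4, 3, 4}" "1 \<notin> {2::4, 3, 4}" by auto
  have f34: "finite {3::4, 4}" "2 \<notin> {3::4, 4}" by auto
  have f4: "finite {4::4}" "3 \<notin> {4::4}" by auto
  show ?thesis
    unfolding det_def UNIV_4
    unfolding sum_over_permutations_insert[OF f234]
    unfolding sum_over_permutations_insert[OF f34]
    unfolding sum_over_permutations_insert[OF f4]
    unfolding permutes_sing
    by (simp add: sign_swap_id permutation_swap_id permutation_compose sign_compose sign_id
        transpose_apply_other transpose_def algebra_simps)
qed

text \<open>Over \<open>k\<close> full turns only the mean value of the integrand survives: in the
  antiderivative \<open>E\<close> all terms are periodic except the linear part of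
  \<open>P\<close>.\<close>

lemma poisson_kernel_integral:
  fixes A B T \<omega> \<phi> :: real
  assumes "\<bar>B\<bar> < A" and "\<omega> \<noteq> 0" and T: "0 \<le> T" "\<omega> * T = 2 * pi * of_int k"
  shows "((\<lambda>s. 1 / (A - B * cos (\<omega> * s + \<phi>))\<^sup>2) has_integral
           T * A / sqrt (A\<^sup>2 - B\<^sup>2) ^ 3) {0..T}"
proof -
  define S where "S = sqrt (A\<^sup>2 - B\<^sup>2)"
  have "B\<^sup>2 < A\<^sup>2" using assms(1) by (metis abs_le_square_iff abs_of_pos linorder_not_le abs_ge_zero le_less_trans)
  then have S: "S > 0" "S\<^sup>2 = A\<^sup>2 - B\<^sup>2" by (auto simp: S_def)
  have A: "A > 0" using assms(1) by linarith
  \<comment> \<open>This choice turns \<open>A - B cos \<theta>\<close> into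
    \<open>(A + S) / 2\<close> times \<open>1 - 2 r cos \<theta> + r^2\<close>, the denominator of
    the Poisson kernel.\<close>
  define r where "r = B / (A + S)"
  have r1: "\<bar>r\<bar> < 1" unfolding r_def using assms(1) S A by (auto simp: abs_if field_simps)
  have S_r: "S = (A + S) * (1 - r\<^sup>2) / 2" and A_r: "A = (A + S) * (1 + r\<^sup>2) / 2" and B_r: "B = (A + S) * r"
  proof -
    have n: "A + S \<noteq> 0" using S A by linarith
    show B: "B = (A + S) * r" unfolding r_def using n by simp
    have "(A + S) * (A + S) * r\<^sup>2 = B\<^sup>2" by (subst B) (simp add: power2_eq_square)
    also have "\<dots> = (A + S) * (A - S)" using S(2) by (simp add: algebra_simps power2_eq_square)
    finally have "(A + S) * r\<^sup>2 = A - S" using n by (simp add: mult.assoc)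
    then show "S = (A + S) * (1 - r\<^sup>2) / 2" "A = (A + S) * (1 + r\<^sup>2) / 2"
      by (simp_all add: algebra_simps)
  qed
  text \<open>
    \<open>P\<close> is a globally smooth antiderivative of the Poisson kernel \<open>(1 - r\<^sup>2) / (1 - 2 r cos \<theta> + r\<^sup>2)\<close>, unlike
    the one in terms of \<open>tan (\<theta> / 2)\<close>; it grows by \<open>2 \<pi>\<close> in each period.
  \<close>
  define P where "P \<theta> = \<theta> + 2 * arctan (r * sin \<theta> / (1 - r * cos \<theta>))" for \<theta>
  \<comment> \<open>The second term is periodic and corrects the derivative of the first, through
    \<open>A (A - B cos \<theta>) + B (A cos \<theta> - B) = S^2\<close>.\<close>
  define E where "E \<theta> = A / S ^ 3 * P \<theta> + B / S\<^sup>2 * (sin \<theta> / (A - B * cos \<theta>))" for \<theta>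
  have den: "A - B * cos \<theta> > 0" for \<theta>
  proof -
    have "\<bar>B * cos \<theta>\<bar> \<le> \<bar>B\<bar>" by (simp add: abs_mult mult_left_le)
    then show ?thesis using assms(1) by linarith
  qed
  have den': "1 - r * cos \<theta> > 0" for \<theta>
  proof -
    have "\<bar>r * cos \<theta>\<bar> \<le> \<bar>r\<bar>" by (simp add: abs_mult mult_left_le)
    then show ?thesis using r1 by linarith
  qed
  have dP: "(P has_real_derivative S / (A - B * cos \<theta>)) (at \<theta>)" for \<theta>
  proof -
    let ?c = "cos \<theta>" and ?s = "sin \<theta>"
    have n: "1 - r * ?c \<noteq> 0" using den'[of \<theta>] by simp
    have sq: "(1 - r * ?c)\<^sup>2 + (r * ?s)\<^sup>2 = 1 + r\<^sup>2 - 2 * r * ?c"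
      using sin_cos_squared_add[of \<theta>] by algebra
    have "1 + (r * ?s / (1 - r * ?c))\<^sup>2 = (1 + r\<^sup>2 - 2 * r * ?c) / (1 - r * ?c)\<^sup>2"
      unfolding sq[symmetric] using n by (simp add: field_simps)
    moreover have num: "r * ?c * (1 - r * ?c) - r * ?s * (r * ?s) = r * ?c - r\<^sup>2"
      using sin_cos_squared_add[of \<theta>] by algebra
    moreover have "((1 - r * ?c)\<^sup>2 + (r * ?s)\<^sup>2) > 0" using n by (metis sum_power2_gt_zero_iff)
    then have pos: "1 + r\<^sup>2 - 2 * r * ?c > 0" using sq by simp
    ultimately have step: "inverse (1 + (r * ?s / (1 - r * ?c))\<^sup>2) *
        ((r * ?c * (1 - r * ?c) - r * ?s * (r * ?s)) / ((1 - r * ?c) * (1 - r * ?c)))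
      = (r * ?c - r\<^sup>2) / (1 + r\<^sup>2 - 2 * r * ?c)"
      using n by (simp add: power2_eq_square)
    have val: "1 + 2 * ((r * ?c - r\<^sup>2) / (1 + r\<^sup>2 - 2 * r * ?c)) = (1 - r\<^sup>2) / (1 + r\<^sup>2 - 2 * r * ?c)"
      using pos by (simp add: field_simps)
    have "((\<lambda>\<theta>. r * sin \<theta> / (1 - r * cos \<theta>)) has_real_derivative
       (r * ?c * (1 - r * ?c) - r * ?s * (r * ?s)) / ((1 - r * ?c) * (1 - r * ?c))) (at \<theta>)"
      by (rule derivative_eq_intros refl n | simp)+
    from DERIV_chain2[OF DERIV_arctan this]
    have dA: "((\<lambda>\<theta>. arctan (r * sin \<theta> / (1 - r * cos \<theta>))) has_real_derivative
       (r * ?c - r\<^sup>2) / (1 + r\<^sup>2 - 2 * r * ?c)) (at \<theta>)"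
      unfolding step .
    have dP: "(P has_real_derivative 1 + 2 * ((r * ?c - r\<^sup>2) / (1 + r\<^sup>2 - 2 * r * ?c))) (at \<theta>)"
      unfolding P_def by (intro DERIV_add DERIV_ident DERIV_cmult dA)
    have "S / (A - B * ?c) = ((A + S) * (1 - r\<^sup>2) / 2) / ((A + S) * (1 + r\<^sup>2) / 2 - (A + S) * r * ?c)"
      using S_r A_r B_r by metis
    also have "\<dots> = ((A + S) / 2 * (1 - r\<^sup>2)) / ((A + S) / 2 * (1 + r\<^sup>2 - 2 * r * ?c))"
      by (intro arg_cong2[where f = "(/)"]) (simp_all add: field_simps)
    also have "\<dots> = (1 - r\<^sup>2) / (1 + r\<^sup>2 - 2 * r * ?c)"
      using S(1) A by (subst mult_divide_mult_cancel_left) auto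
    finally have e: "S / (A - B * ?c) = (1 - r\<^sup>2) / (1 + r\<^sup>2 - 2 * r * ?c)" .
    show ?thesis using dP unfolding val e .
  qed
  have dE: "(E has_real_derivative 1 / (A - B * cos \<theta>)\<^sup>2) (at \<theta>)" for \<theta>
  proof -
    let ?c = "cos \<theta>" and ?s = "sin \<theta>"
    have n: "A - B * ?c \<noteq> 0" using den[of \<theta>] by simp
    have "((\<lambda>\<theta>. sin \<theta> / (A - B * cos \<theta>)) has_real_derivative
       (?c * (A - B * ?c) - ?s * (B * ?s)) / ((A - B * ?c) * (A - B * ?c))) (at \<theta>)"
      by (rule derivative_eq_intros refl n | simp)+
    then have "(E has_real_derivative A / S ^ 3 * (S / (A - B * ?c)) + B / S\<^sup>2 *
       ((?c * (A - B * ?c) - ?s * (B * ?s)) / ((A - B * ?c) * (A - B * ?c)))) (at \<theta>)"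
      unfolding E_def by (intro DERIV_add DERIV_cmult dP)
    moreover have "?c * (A - B * ?c) - ?s * (B * ?s) = A * ?c - B"
      using sin_cos_squared_add[of \<theta>] by algebra
    moreover have "A / S ^ 3 * (S / (A - B * ?c)) + B / S\<^sup>2 * ((A * ?c - B) / ((A - B * ?c) * (A - B * ?c)))
      = 1 / (A - B * ?c)\<^sup>2"
    proof -
      have "A / S ^ 3 * (S / (A - B * ?c)) + B / S\<^sup>2 * ((A * ?c - B) / ((A - B * ?c) * (A - B * ?c)))
        = (A * (A - B * ?c) + B * (A * ?c - B)) / (S\<^sup>2 * (A - B * ?c)\<^sup>2)"
        unfolding add_divide_distrib using n S(1)
        by (intro arg_cong2[where f = "(+)"]) (simp_all add: power2_eq_square power3_eq_cube)
      also have "A * (A - B * ?c) + B * (A * ?c - B) = S\<^sup>2"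
        unfolding S(2) by (simp add: algebra_simps power2_eq_square)
      finally show ?thesis using S(1) by simp
    qed
    ultimately show ?thesis by simp
  qed
  have "((\<lambda>s. 1 / (A - B * cos (\<omega> * s + \<phi>))\<^sup>2) has_integral
      E (\<omega> * T + \<phi>) / \<omega> - E (\<omega> * 0 + \<phi>) / \<omega>) {0..T}"
  proof (rule fundamental_theorem_of_calculus[OF T(1)])
    fix s
    have "((\<lambda>s. E (\<omega> * s + \<phi>) / \<omega>) has_real_derivative 1 / (A - B * cos (\<omega> * s + \<phi>))\<^sup>2) (at s)"
      using \<open>\<omega> \<noteq> 0\<close> by (auto intro!: derivative_eq_intros DERIV_chain2[OF dE])
    then show "((\<lambda>s. E (\<omega> * s + \<phi>) / \<omega>) has_vector_derivative 1 / (A - B * cos (\<omega> * s + \<phi>))\<^sup>2) (at s within {0..T})"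
      by (simp add: has_real_derivative_iff_has_vector_derivative has_vector_derivative_at_within)
  qed
  moreover have "E (\<omega> * T + \<phi>) / \<omega> - E (\<omega> * 0 + \<phi>) / \<omega> = T * A / S ^ 3"
  proof -
    have "sin (\<omega> * T + \<phi>) = sin \<phi>" "cos (\<omega> * T + \<phi>) = cos \<phi>"
      using sin_int_2pin[of k] cos_int_2pin[of k] by (simp_all add: T(2) sin_add cos_add)
    then have "E (\<omega> * T + \<phi>) - E \<phi> = A / S ^ 3 * (\<omega> * T)"
      by (simp add: E_def P_def algebra_simps)
    then show ?thesis using \<open>\<omega> \<noteq> 0\<close>
      by (simp add: field_simps)
  qed
  ultimately show ?thesis by (simp add: S_def)
qed

section \<open>Homotopy invariance of the Gauss integral\<close>

text \<open>The expansion of \<open>det_4\<close>, on tuples instead of matrices, so that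
  derivatives and identities become statements about polynomials in the components.\<close>

definition det4 :: "real \<times> real \<times> real \<times> real \<Rightarrow> real \<times> real \<times> real \<times> real \<Rightarrow> real \<times> real \<times> real \<times> real \<Rightarrow> real \<times> real \<times> real \<times> real \<Rightarrow> real" where
 "det4 = (\<lambda>(a1,a2,a3,a4) (b1,b2,b3,b4) (c1,c2,c3,c4) (d1,d2,d3,d4). 
   (a1*b2-a2*b1)*(c3*d4-c4*d3) - (a1*b3-a3*b1)*(c2*d4-c4*d2) + (a1*b4-a4*b1)*(c2*d3-c3*d2)
   + (a2*b3-a3*b2)*(c1*d4-c4*d1) - (a2*b4-a4*b2)*(c1*d3-c3*d1) + (a3*b4-a4*b3)*(c1*d2-c2*d1))"

text \<open>Differentiation under the integral sign leaves the integral of a divergence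
  \<open>gs + hx\<close>. The first summand integrates to zero along \<open>s\<close> by
  periodicity, the second along \<open>x\<close> because \<open>h\<close> agrees at both
  ends.\<close>

lemma integral_constant_along_homotopy:
  fixes f fb g gs h hx :: "real \<Rightarrow> real \<Rightarrow> real \<Rightarrow> real"
  assumes "0 \<le> B" "0 \<le> T"
    and df: "\<And>b x s. b \<in> {0..B} \<Longrightarrow> x \<in> {0..1} \<Longrightarrow> s \<in> {0..T} \<Longrightarrow>
      ((\<lambda>b. f b x s) has_real_derivative fb b x s) (at b)"
    and dg: "\<And>b x s. b \<in> {0..B} \<Longrightarrow> x \<in> {0..1} \<Longrightarrow> s \<in> {0..T} \<Longrightarrow>
      ((\<lambda>s. g b x s) has_real_derivative gs b x s) (at s)"
    and dh: "\<And>b x s. b \<in> {0..B} \<Longrightarrow> x \<in> {0..1} \<Longrightarrow> s \<in> {0..T} \<Longrightarrow>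
      ((\<lambda>x. h b x s) has_real_derivative hx b x s) (at x)"
    and eq: "\<And>b x s. b \<in> {0..B} \<Longrightarrow> x \<in> {0..1} \<Longrightarrow> s \<in> {0..T} \<Longrightarrow> fb b x s = gs b x s + hx b x s"
    and periodic: "\<And>b x. b \<in> {0..B} \<Longrightarrow> x \<in> {0..1} \<Longrightarrow> g b x T = g b x 0"
    and boundary: "\<And>b s. b \<in> {0..B} \<Longrightarrow> s \<in> {0..T} \<Longrightarrow> h b 1 s = h b 0 s"
    and cf: "\<And>b. b \<in> {0..B} \<Longrightarrow> continuous_on (cbox (0, 0) (1, T)) (\<lambda>(x, s). f b x s)"
    and cfb: "continuous_on ({0..B} \<times> cbox (0, 0) (1, T)) (\<lambda>(b, x, s). fb b x s)"
    and cgs: "\<And>b. b \<in> {0..B} \<Longrightarrow> continuous_on (cbox (0, 0) (1, T)) (\<lambda>(x, s). gs b x s)"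
    and chx: "\<And>b. b \<in> {0..B} \<Longrightarrow> continuous_on (cbox (0, 0) (1, T)) (\<lambda>(x, s). hx b x s)"
  shows "integral (cbox (0, 0) (1, T)) (\<lambda>(x, s). f B x s) = integral (cbox (0, 0) (1, T)) (\<lambda>(x, s). f 0 x s)"
proof -
  let ?K = "cbox (0::real, 0::real) (1, T)"
  have "((\<lambda>b. integral ?K (\<lambda>(x, s). f b x s)) has_real_derivative 0) (at b within {0..B})"
    if b: "b \<in> {0..B}" for b
  proof -
    have "integral ?K (\<lambda>(x, s). gs b x s) = integral {0..1} (\<lambda>x. integral {0..T} (gs b x))"
      using integral_prod_continuous[OF cgs[OF b]] by simp
    also have "\<dots> = integral {0..1::real} (\<lambda>x. 0::real)"
    proof (rule Henstock_Kurzweil_Integration.integral_cong)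
      fix x :: real assume x: "x \<in> {0..1}"
      have "(gs b x has_integral g b x T - g b x 0) {0..T}"
        using dg[OF b x] assms(2)
        by (intro fundamental_theorem_of_calculus)
           (auto simp: has_real_derivative_iff_has_vector_derivative[symmetric] intro: has_field_derivative_at_within)
      then show "integral {0..T} (gs b x) = 0" using periodic[OF b x] by (simp add: integral_unique)
    qed
    finally have g0: "integral ?K (\<lambda>(x, s). gs b x s) = 0" by simp
    \<comment> \<open>Here \<open>x\<close> has to be the inner variable, so the order of
      integration is exchanged.\<close>
    have "integral ?K (\<lambda>(x, s). hx b x s) = integral {0..1} (\<lambda>x. integral {0..T} (hx b x))"
      using integral_prod_continuous[OF chx[OF b]] by simp
    also have "\<dots> = integral {0..T} (\<lambda>s. integral {0..1} (\<lambda>x. hx b x s))"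
      using integral_swap_continuous[OF chx[OF b]] by simp
    also have "\<dots> = integral {0..T} (\<lambda>s::real. 0::real)"
    proof (rule Henstock_Kurzweil_Integration.integral_cong)
      fix s :: real assume s: "s \<in> {0..T}"
      have "((\<lambda>x. hx b x s) has_integral h b 1 s - h b 0 s) {0..1}"
        using dh[OF b _ s]
        by (intro fundamental_theorem_of_calculus)
           (auto simp: has_real_derivative_iff_has_vector_derivative[symmetric] intro: has_field_derivative_at_within)
      then show "integral {0..1} (\<lambda>x. hx b x s) = 0" using boundary[OF b s] by (simp add: integral_unique)
    qed
    finally have h0: "integral ?K (\<lambda>(x, s). hx b x s) = 0" by simp
    have "integral ?K (\<lambda>(x, s). fb b x s) = integral ?K (\<lambda>p. (case p of (x, s) \<Rightarrow> gs b x s) + (case p of (x, s) \<Rightarrow> hx b x s))"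
      by (rule Henstock_Kurzweil_Integration.integral_cong) (use eq[OF b] in auto)
    also have "\<dots> = 0"
      using g0 h0 integrable_continuous[OF cgs[OF b]] integrable_continuous[OF chx[OF b]]
      by (subst integral_add) auto
    finally have fb0: "integral ?K (\<lambda>(x, s). fb b x s) = 0" .
    have "((\<lambda>b. integral ?K (\<lambda>p. case p of (x, s) \<Rightarrow> f b x s)) has_real_derivative
        integral ?K (\<lambda>p. case p of (x, s) \<Rightarrow> fb b x s)) (at b within {0..B})"
    proof (rule leibniz_rule_field_derivative[where U = "{0..B}"])
      fix b and p :: "real \<times> real" assume "b \<in> {0..B}" "p \<in> ?K"
      then show "((\<lambda>b. case p of (x, s) \<Rightarrow> f b x s) has_real_derivative (case p of (x, s) \<Rightarrow> fb b x s)) (at b within {0..B})"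
        using df by (cases p) (auto intro: has_field_derivative_at_within)
    qed (use b cfb in \<open>auto intro!: integrable_continuous cf[unfolded split_beta'] simp: split_beta'\<close>)
    then show ?thesis unfolding fb0 .
  qed
  then obtain c where "\<And>b. b \<in> {0..B} \<Longrightarrow> integral ?K (\<lambda>(x, s). f b x s) = c"
    using has_field_derivative_zero_constant[of "{0..B}" "\<lambda>b. integral ?K (\<lambda>(x, s). f b x s)"] by auto
  then show ?thesis using assms(1) by simp
qed

text \<open>The quotient rule with one factor \<open>n x\<close> cancelled: all derivatives in the
  homotopy argument then share the denominator \<open>n ^ 3\<close>, and comparing them is a matter
  of numerators.\<close>

lemma DERIV_div_power2:
  fixes P n :: "real \<Rightarrow> real"
  assumes "(P has_real_derivative P') (at x)" "(n has_real_derivative n') (at x)" "n x \<noteq> 0"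
  shows "((\<lambda>x. P x / (n x)\<^sup>2) has_real_derivative (P' * n x - 2 * P x * n') / n x ^ 3) (at x)"
  by (rule derivative_eq_intros assms refl | simp add: assms)+
     (use assms(3) in \<open>simp add: field_simps power2_eq_square power3_eq_cube power4_eq_xxxx\<close>)

text \<open>
  The solid angle form is closed, so its pull-back under \<open>(b, s, x, t) \<mapsto> (1 - x) v\<^sub>b(s) - x q(t)\<close> is closed.
  As everything depends on \<open>s - t\<close> only, \<open>\<partial>\<^sub>t = - \<partial>\<^sub>s\<close>, and closedness writes the \<open>b\<close>-derivative of the
  integrand as \<open>\<partial>\<^sub>s (Q / n\<^sup>2) + \<partial>\<^sub>x (R / n\<^sup>2)\<close>, where \<open>Q / n\<^sup>2\<close> is periodic in \<open>s\<close> and \<open>R\<close> vanishes for \<open>x \<in> {0, 1}\<close>.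
\<close>

lemma torus_homotopy:
  fixes a b T w1 w2 p1 p2 q1 q2 q3 q4 :: real
  defines "X \<equiv> \<lambda>s. a * cos (w1 * s + p1)" and "Y \<equiv> \<lambda>s. a * sin (w1 * s + p1)"
    and "C \<equiv> \<lambda>s. cos (w2 * s + p2)" and "S \<equiv> \<lambda>s. sin (w2 * s + p2)"
  defines "n \<equiv> \<lambda>b x s. ((1-x) * X s - x*q1)\<^sup>2 + ((1-x) * Y s - x*q2)\<^sup>2
      + ((1-x) * (b * C s) - x*q3)\<^sup>2 + ((1-x) * (b * S s) - x*q4)\<^sup>2"
    and "P \<equiv> \<lambda>b s. det4 (X s, Y s, b * C s, b * S s) (-(w1 * Y s), w1 * X s, -(w2 * b * S s), w2 * b * C s)
      (q1, q2, q3, q4) (-(w1 * q2), w1 * q1, -(w2 * q4), w2 * q3)"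
  assumes "0 \<le> b" "0 \<le> T" "w1 * T = 2 * pi * of_int k" "w2 * T = 2 * pi * of_int l"
    and pos: "\<And>b' x s. 0 \<le> b' \<Longrightarrow> b' \<le> b \<Longrightarrow> 0 \<le> x \<Longrightarrow> x \<le> 1 \<Longrightarrow> n b' x s > 0"
  shows "integral (cbox (0, 0) (1, T)) (\<lambda>(x, s). x * (1-x) * P b s / (n b x s)\<^sup>2)
       = integral (cbox (0, 0) (1, T)) (\<lambda>(x, s). x * (1-x) * P 0 s / (n 0 x s)\<^sup>2)"
proof -
  have dX [derivative_intros]: "(X has_real_derivative -(w1 * Y s)) (at s)"
    and dY [derivative_intros]: "(Y has_real_derivative w1 * X s) (at s)"
    and dC [derivative_intros]: "(C has_real_derivative -(w2 * S s)) (at s)"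
    and dS [derivative_intros]: "(S has_real_derivative w2 * C s) (at s)" for s
    unfolding X_def Y_def C_def S_def by (auto intro!: derivative_eq_intros)
  have per: "X T = X 0" "Y T = Y 0" "C T = C 0" "S T = S 0"
    using sin_int_2pin[of k] cos_int_2pin[of k] sin_int_2pin[of l] cos_int_2pin[of l]
    unfolding X_def Y_def C_def S_def by (simp_all add: assms sin_add cos_add)
  have [continuous_intros]: "continuous_on A X" "continuous_on A Y" "continuous_on A C" "continuous_on A S" for A
    unfolding X_def Y_def C_def S_def by (intro continuous_intros)+
  note [continuous_intros] = continuous_on_compose2[where g = X and t = UNIV]
    continuous_on_compose2[where g = Y and t = UNIV] 
    continuous_on_compose2[where g = C and t = UNIV] continuous_on_compose2[where g = S and t = UNIV]
  \<comment> \<open>\<open>nb\<close>, \<open>nt\<close> and \<open>nx\<close> are the derivatives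
    of \<open>n\<close> in b, s and x. In the same way \<open>Pb\<close>, \<open>Qt\<close> and
    \<open>Rx\<close> below are derivatives in b, s and x.\<close>
  define nb where "nb b x s = 2*(1-x)*(((1-x)*(b * C s) - x*q3) * C s + ((1-x)*(b * S s) - x*q4) * S s)" for b x s
  define nt where "nt b x s = 2*(1-x)*(-((1-x) * X s - x*q1)*w1*Y s+((1-x) * Y s - x*q2)*w1*X s
     -((1-x)*(b * C s) - x*q3)*w2*b*S s+((1-x)*(b * S s) - x*q4)*w2*b*C s)" for b x s
  define nx where "nx b x s = -2*(((1-x) * X s - x*q1)*(X s+q1)+((1-x) * Y s - x*q2)*(Y s+q2)
     +((1-x)*(b * C s) - x*q3)*(b*C s+q3)+((1-x)*(b * S s) - x*q4)*(b*S s+q4))" for b x s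
  define v where "v b s = (X s, Y s, b * C s, b * S s)" for b s
  define v' where "v' b s = (-(w1 * Y s), w1 * X s, -(w2 * b * S s), w2 * b * C s)" for b s
  define v'' where "v'' b s = (-(w1^2 * X s), -(w1^2 * Y s), -(w2^2 * b * C s), -(w2^2 * b * S s))" for b s
  define e where "e s = (0::real, 0::real, C s, S s)" for s
  define e' where "e' s = (0::real, 0::real, -(w2 * S s), w2 * C s)" for s
  define q where "q = (q1, q2, q3, q4)"
  define q' where "q' = (-(w1 * q2), w1 * q1, -(w2 * q4), w2 * q3)"
  define G where "G b x s = ((1-x) * X s - x*q1, (1-x) * Y s - x*q2, (1-x) * (b * C s) - x*q3, (1-x) * (b * S s) - x*q4)" for b x s
  define G' where "G' b s = (-X s-q1, -Y s-q2, -b*C s-q3, -b*S s-q4)" for b s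
  define Pb where "Pb b s = det4 (e s) (v' b s) q q' + det4 (v b s) (e' s) q q'" for b s
  \<comment> \<open>For the pulled-back form, \<open>Q / n^2\<close> is its (b, x, t) component
    minus its (b, s, x) component, and \<open>R / n^2\<close> is minus its (b, s, t) component. In
    \<open>P\<close> and \<open>Q\<close> the rows \<open>G\<close> and \<open>v + q\<close> have
    been reduced to \<open>v\<close> and \<open>q\<close> by row operations.\<close>
  define Q where "Q b x s = -x*(1-x)*det4 (e s) (v b s) q q' + (1-x)^2*det4 (v b s) (e s) (v' b s) q" for b x s
  define Qt where "Qt b x s = -x*(1-x)*(det4 (e' s) (v b s) q q' + det4 (e s) (v' b s) q q')
    + (1-x)^2*(det4 (v b s) (e' s) (v' b s) q + det4 (v b s) (e s) (v'' b s) q)" for b x s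
  define R where "R b x s = x*(1-x)^2*det4 (G b x s) (e s) (v' b s) q'" for b x s
  define Rx where "Rx b x s = (1-4*x+3*x^2)*det4 (G b x s) (e s) (v' b s) q' + x*(1-x)^2*det4 (G' b s) (e s) (v' b s) q'" for b x s
  note defs = v_def v'_def v''_def e_def e'_def q_def q'_def G_def G'_def det4_def prod.case
  have dnb: "((\<lambda>b. n b x s) has_real_derivative nb b x s) (at b)" for b x s
    unfolding n_def nb_def by (rule derivative_eq_intros refl)+ (simp add: algebra_simps power2_eq_square)
  have dnt: "((\<lambda>s. n b x s) has_real_derivative nt b x s) (at s)" for b x s
    unfolding n_def nt_def by (rule derivative_eq_intros refl)+ (simp add: algebra_simps power2_eq_square)
  have dnx: "((\<lambda>x. n b x s) has_real_derivative nx b x s) (at x)" for b x s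
    unfolding n_def nx_def by (rule derivative_eq_intros refl)+ (simp add: algebra_simps power2_eq_square)
  have dP: "((\<lambda>b. x * (1-x) * P b s) has_real_derivative x * (1-x) * Pb b s) (at b)" for b x s
    unfolding P_def Pb_def defs by (rule derivative_eq_intros refl)+ algebra
  have dQ: "((\<lambda>s. Q b x s) has_real_derivative Qt b x s) (at s)" for b x s
    unfolding Q_def Qt_def defs by (rule derivative_eq_intros refl)+ algebra
  have dR: "((\<lambda>x. R b x s) has_real_derivative Rx b x s) (at x)" for b x s
    unfolding R_def Rx_def defs by (rule derivative_eq_intros refl)+ (simp add: algebra_simps power2_eq_square)
  \<comment> \<open>Closedness of the form with the denominators cleared: a polynomial identity in
    the values of \<open>X\<close>, \<open>Y\<close>, \<open>C\<close> and \<open>S\<close>.\<close>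
  have id: "x*(1-x)*(Pb b s * n b x s - 2 * P b s * nb b x s)
    = (Qt b x s * n b x s - 2 * Q b x s * nt b x s) + (Rx b x s * n b x s - 2 * R b x s * nx b x s)" for b x s
    unfolding P_def Pb_def n_def nb_def nt_def nx_def Q_def Qt_def R_def Rx_def defs
    by algebra
  have c3 [continuous_intros]: "continuous_on A (\<lambda>z. n (f z) (g z) (h z))" 
    if "continuous_on A f" "continuous_on A g" "continuous_on A h" for A and f g h :: "'z::topological_space \<Rightarrow> real"
    unfolding n_def by (intro continuous_intros that subset_UNIV)
  have cP [continuous_intros]: "continuous_on A (\<lambda>z. P (f z) (h z))" "continuous_on A (\<lambda>z. Pb (f z) (h z))" 
    if "continuous_on A f" "continuous_on A h" for A and f h :: "'z::topological_space \<Rightarrow> real"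
    unfolding P_def Pb_def defs by (intro continuous_intros that subset_UNIV)+
  have c3' [continuous_intros]: "continuous_on A (\<lambda>z. nb (f z) (g z) (h z))" "continuous_on A (\<lambda>z. nt (f z) (g z) (h z))" 
    "continuous_on A (\<lambda>z. nx (f z) (g z) (h z))" "continuous_on A (\<lambda>z. Q (f z) (g z) (h z))" 
    "continuous_on A (\<lambda>z. Qt (f z) (g z) (h z))" "continuous_on A (\<lambda>z. R (f z) (g z) (h z))" "continuous_on A (\<lambda>z. Rx (f z) (g z) (h z))" 
    if "continuous_on A f" "continuous_on A g" "continuous_on A h" for A and f g h :: "'z::topological_space \<Rightarrow> real"
    unfolding nb_def nt_def nx_def Q_def Qt_def R_def Rx_def defs by (intro continuous_intros that subset_UNIV)+
  show ?thesis
  proof (rule integral_constant_along_homotopy[where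
      fb = "\<lambda>b x s. (x * (1-x) * Pb b s * n b x s - 2 * (x * (1-x) * P b s) * nb b x s) / n b x s ^ 3" and
      g = "\<lambda>b x s. Q b x s / (n b x s)\<^sup>2" and gs = "\<lambda>b x s. (Qt b x s * n b x s - 2 * Q b x s * nt b x s) / n b x s ^ 3" and
      h = "\<lambda>b x s. R b x s / (n b x s)\<^sup>2" and hx = "\<lambda>b x s. (Rx b x s * n b x s - 2 * R b x s * nx b x s) / n b x s ^ 3" and
      f = "\<lambda>b x s. x * (1-x) * P b s / (n b x s)\<^sup>2"])
    fix b' x s assume H: "b' \<in> {0..b}" "x \<in> {0..1::real}"
    have n0: "n b' x s \<noteq> 0" for s using pos[of b' x s] H by simp
    show "((\<lambda>b. x * (1-x) * P b s / (n b x s)\<^sup>2) has_real_derivative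
      (x * (1-x) * Pb b' s * n b' x s - 2 * (x * (1-x) * P b' s) * nb b' x s) / n b' x s ^ 3) (at b')"
      by (rule DERIV_div_power2[OF dP dnb n0])
    show "((\<lambda>s. Q b' x s / (n b' x s)\<^sup>2) has_real_derivative (Qt b' x s * n b' x s - 2 * Q b' x s * nt b' x s) / n b' x s ^ 3) (at s)"
      by (rule DERIV_div_power2[OF dQ dnt n0])
    show "((\<lambda>x. R b' x s / (n b' x s)\<^sup>2) has_real_derivative (Rx b' x s * n b' x s - 2 * R b' x s * nx b' x s) / n b' x s ^ 3) (at x)"
      by (rule DERIV_div_power2[OF dR dnx n0])
    show "(x * (1-x) * Pb b' s * n b' x s - 2 * (x * (1-x) * P b' s) * nb b' x s) / n b' x s ^ 3 =
      (Qt b' x s * n b' x s - 2 * Q b' x s * nt b' x s) / n b' x s ^ 3 + (Rx b' x s * n b' x s - 2 * R b' x s * nx b' x s) / n b' x s ^ 3"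
      unfolding add_divide_distrib[symmetric] id[symmetric] by (simp add: algebra_simps)
    show "Q b' x T / (n b' x T)\<^sup>2 = Q b' x 0 / (n b' x 0)\<^sup>2"
      by (simp add: Q_def n_def defs per)
  next
    fix b' s
    show "R b' 1 s / (n b' 1 s)\<^sup>2 = R b' 0 s / (n b' 0 s)\<^sup>2"
      by (simp add: R_def)
  qed (use assms(7,8) pos in \<open>auto intro!: continuous_intros simp: split_beta' less_imp_neq[THEN not_sym] mem_Times_iff dest: less_imp_neq\<close>)
qed

text \<open>The end point of the homotopy, where one curve lies on the circle
  \<open>r_2 = 0\<close>, can be integrated explicitly: in \<open>s\<close> the function
  \<open>n\<close> has the form \<open>A - B cos\<close>, so the Poisson kernel gives the inner
  integral, and an algebraic function of \<open>x\<close> remains.\<close>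

lemma circle_gauss_integral:
  fixes a w p T K q1 q2 q3 q4 :: real
  defines "n \<equiv> \<lambda>x s. ((1-x) * (a * cos (w * s + p)) - x*q1)\<^sup>2 + ((1-x) * (a * sin (w * s + p)) - x*q2)\<^sup>2
      + (x*q3)\<^sup>2 + (x*q4)\<^sup>2"
  assumes "a \<noteq> 0" "q3\<^sup>2 + q4\<^sup>2 > 0" "w \<noteq> 0" "0 \<le> T" "w * T = 2 * pi * of_int k"
  shows "integral (cbox (0, 0) (1, T)) (\<lambda>(x, s). x * (1-x) * K / (n x s)\<^sup>2)
       = K * T / (2 * a\<^sup>2 * (q3\<^sup>2 + q4\<^sup>2))"
proof -
  obtain c \<psi> where q: "q1 = c * cos \<psi>" "q2 = c * sin \<psi>" using polar_Ex by blast
  define d where "d = q3\<^sup>2 + q4\<^sup>2"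
  \<comment> \<open>Law of cosines, with \<open>(q1, q2)\<close> in polar form \<open>c\<close>,
    \<open>\<psi>\<close>: expanding the squares in \<open>n\<close> leaves one cosine term, with
    coefficient \<open>B\<close>.\<close>
  define A where "A x = (1-x)\<^sup>2 * a\<^sup>2 + x\<^sup>2 * (c\<^sup>2 + d)" for x
  define B where "B x = 2 * x * (1-x) * a * c" for x
  define S where "S x = (A x)\<^sup>2 - (B x)\<^sup>2" for x
  have d: "d > 0" using assms by (simp add: d_def)
  have n_eq: "n x s = A x - B x * cos (w * s + (p - \<psi>))" for x s
  proof -
    have "cos (w * s + (p - \<psi>)) = cos (w * s + p) * cos \<psi> + sin (w * s + p) * sin \<psi>"
      using cos_diff[of "w * s + p" \<psi>] by (simp add: algebra_simps)
    then show ?thesis unfolding n_def A_def B_def q d_def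
      using sin_cos_squared_add[of "w * s + p"] sin_cos_squared_add[of \<psi>] by algebra
  qed
  have AB: "\<bar>B x\<bar> < A x" for x
  proof -
    have "((1-x) * a - x * c)\<^sup>2 + x\<^sup>2 * d > 0" "((1-x) * a + x * c)\<^sup>2 + x\<^sup>2 * d > 0"
      using d \<open>a \<noteq> 0\<close> by (cases "x = 0"; simp add: add_nonneg_pos)+
    moreover have "((1-x) * a - x * c)\<^sup>2 + x\<^sup>2 * d = A x - B x" "((1-x) * a + x * c)\<^sup>2 + x\<^sup>2 * d = A x + B x"
      unfolding A_def B_def by algebra+
    ultimately show ?thesis by linarith
  qed
  have S: "S x > 0" for x
    using AB[of x] unfolding S_def
    by (metis abs_le_square_iff abs_of_pos abs_ge_zero diff_gt_0_iff_gt le_less_trans linorder_not_le)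
  have n0: "n x s > 0" for x s
  proof -
    have "\<bar>B x * cos (w * s + (p - \<psi>))\<bar> \<le> \<bar>B x\<bar>" by (simp add: abs_mult mult_left_le)
    then show ?thesis unfolding n_eq using AB[of x] by linarith
  qed
  have "continuous_on (cbox (0, 0) (1, T)) (\<lambda>z. n (fst z) (snd z))"
    unfolding n_def by (intro continuous_intros)
  then have cont: "continuous_on (cbox (0, 0) (1, T)) (\<lambda>(x, s). x * (1-x) * K / (n x s)\<^sup>2)"
    unfolding split_beta' using n0 by (intro continuous_intros ballI) (simp_all add: less_imp_neq[THEN not_sym])
  have "integral (cbox (0, 0) (1, T)) (\<lambda>(x, s). x * (1-x) * K / (n x s)\<^sup>2)
     = integral {0..1} (\<lambda>x. integral {0..T} (\<lambda>s. x * (1-x) * K / (n x s)\<^sup>2))"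
    using integral_prod_continuous[OF cont] by simp
  also have "\<dots> = integral {0..1} (\<lambda>x. K * T * (x * (1-x) * A x / sqrt (S x) ^ 3))"
  proof (rule Henstock_Kurzweil_Integration.integral_cong)
    fix x :: real
    have "((\<lambda>s. x * (1-x) * K * (1 / (n x s)\<^sup>2)) has_integral x * (1-x) * K * (T * A x / sqrt (S x) ^ 3)) {0..T}"
      unfolding n_eq S_def
      by (intro has_integral_mult_right poisson_kernel_integral[OF AB \<open>w \<noteq> 0\<close> \<open>0 \<le> T\<close> assms(6)])
    from integral_unique[OF this]
    show "integral {0..T} (\<lambda>s. x * (1-x) * K / (n x s)\<^sup>2) = K * T * (x * (1-x) * A x / sqrt (S x) ^ 3)"
      by (simp add: algebra_simps)
  qed
  also have "\<dots> = K * T * (1 / (2 * a\<^sup>2 * d))"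
  proof -
    \<comment> \<open>\<open>m\<close> is chosen so that \<open>m' S - m S' / 2\<close> is a
      constant multiple of \<open>x (1 - x) A\<close>; hence \<open>m / sqrt S\<close> is an
      antiderivative up to a constant. It runs from -1 at 0 to 1 at 1.\<close>
    define m where "m x = (c\<^sup>2 + d) * x\<^sup>2 - a\<^sup>2 * (1-x)\<^sup>2" for x
    have "((\<lambda>x. x * (1-x) * A x / sqrt (S x) ^ 3) has_integral
        m 1 / (4 * a\<^sup>2 * d * sqrt (S 1)) - m 0 / (4 * a\<^sup>2 * d * sqrt (S 0))) {0..1}"
    proof (rule fundamental_theorem_of_calculus)
      fix x :: real
      define m' where "m' = 2 * (c\<^sup>2 + d) * x + 2 * a\<^sup>2 * (1-x)"
      define S' where "S' = 2 * A x * (2 * (c\<^sup>2 + d) * x - 2 * a\<^sup>2 * (1-x)) - 2 * B x * (2 * a * c * (1 - 2 * x))"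
      have dm: "(m has_real_derivative m') (at x)"
        unfolding m_def m'_def by (auto intro!: derivative_eq_intros simp: algebra_simps)
      have dS: "(S has_real_derivative S') (at x)"
        unfolding S_def S'_def A_def B_def
        by (rule derivative_eq_intros refl)+ (simp add: algebra_simps power2_eq_square)
      have id: "m' * S x - m x * S' / 2 = 4 * a\<^sup>2 * d * (x * (1-x) * A x)"
        unfolding m'_def m_def S_def S'_def A_def B_def
        by (simp add: field_simps power2_eq_square)
      have r: "sqrt (S x) > 0" "sqrt (S x) * sqrt (S x) = S x" using S[of x] by auto
      have "((\<lambda>x. m x / (4 * a\<^sup>2 * d * sqrt (S x))) has_real_derivative
         (m' * (4 * a\<^sup>2 * d * sqrt (S x)) - m x * (4 * a\<^sup>2 * d * (S' * (inverse (sqrt (S x)) / 2))))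
          / ((4 * a\<^sup>2 * d * sqrt (S x)) * (4 * a\<^sup>2 * d * sqrt (S x)))) (at x)"
        using r \<open>a \<noteq> 0\<close> d
        by (intro DERIV_divide dm DERIV_cmult) (auto intro!: derivative_eq_intros dS simp: S less_imp_neq[OF S, THEN not_sym])
      also have "(m' * (4 * a\<^sup>2 * d * sqrt (S x)) - m x * (4 * a\<^sup>2 * d * (S' * (inverse (sqrt (S x)) / 2))))
          / ((4 * a\<^sup>2 * d * sqrt (S x)) * (4 * a\<^sup>2 * d * sqrt (S x)))
          = (m' * (sqrt (S x) * sqrt (S x)) - m x * S' / 2) / (4 * a\<^sup>2 * d * sqrt (S x) ^ 3)"
        using r(1) S[of x] \<open>a \<noteq> 0\<close> d by (simp add: field_simps power2_eq_square power3_eq_cube)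
      also have "\<dots> = x * (1-x) * A x / sqrt (S x) ^ 3"
        unfolding r(2) id using \<open>a \<noteq> 0\<close> d by simp
      finally show "((\<lambda>x. m x / (4 * a\<^sup>2 * d * sqrt (S x))) has_vector_derivative x * (1-x) * A x / sqrt (S x) ^ 3) (at x within {0..1})"
        by (simp add: has_real_derivative_iff_has_vector_derivative has_vector_derivative_at_within)
    qed simp
    moreover have "sqrt (S 1) = c\<^sup>2 + d" "sqrt (S 0) = a\<^sup>2"
      using d by (auto intro!: real_sqrt_unique simp: S_def A_def B_def)
    then have "m 1 / (4 * a\<^sup>2 * d * sqrt (S 1)) - m 0 / (4 * a\<^sup>2 * d * sqrt (S 0)) = 1 / (2 * a\<^sup>2 * d)"
    proof -
      have "c\<^sup>2 + d \<noteq> 0" using d by (metis add_nonneg_pos less_irrefl zero_le_power2)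
      then have "m 1 / (4 * a\<^sup>2 * d * sqrt (S 1)) = 1 / (4 * a\<^sup>2 * d)" "m 0 / (4 * a\<^sup>2 * d * sqrt (S 0)) = - (1 / (4 * a\<^sup>2 * d))"
        unfolding \<open>sqrt (S 1) = c\<^sup>2 + d\<close> \<open>sqrt (S 0) = a\<^sup>2\<close> using \<open>a \<noteq> 0\<close> by (simp_all add: m_def)
      then show ?thesis by simp
    qed
    ultimately have "((\<lambda>x. x * (1-x) * A x / sqrt (S x) ^ 3) has_integral 1 / (2 * a\<^sup>2 * d)) {0..1}"
      by simp
    then show ?thesis by (intro integral_unique has_integral_mult_right)
  qed
  finally show ?thesis by (simp add: d_def)
qed

section \<open>Reduction of the linking integral to a compact domain\<close>

lemma integrable_lborel_mult_prod:
  fixes f :: "'a::euclidean_space \<Rightarrow> real" and g :: "'b::euclidean_space \<Rightarrow> real"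
  assumes [measurable]: "integrable lborel f" "integrable lborel g"
  shows "integrable lborel (\<lambda>(x, y). f x * g y)"
  unfolding lborel_prod[symmetric]
proof (rule lborel_pair.Fubini_integrable)
  show "integrable lborel (\<lambda>x. \<integral>y. norm (case (x, y) of (x, y) \<Rightarrow> f x * g y) \<partial>lborel)"
    by (simp add: abs_mult assms)
qed (simp_all add: assms)

text \<open>Fubini with the second variable outermost. Applied twice, it integrates over s first,
  then over u, then over t.\<close>

lemma lborel_integral_snd:
  fixes f :: "'a::euclidean_space \<Rightarrow> 'b::euclidean_space \<Rightarrow> real"
  assumes "integrable lborel (\<lambda>(x, y). f x y)"
  shows "(\<integral>z. (case z of (x, y) \<Rightarrow> f x y) \<partial>lborel) = (\<integral>y. (\<integral>x. f x y \<partial>lborel) \<partial>lborel)"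
    and "integrable lborel (\<lambda>y. \<integral>x. f x y \<partial>lborel)"
  using lborel_pair.integral_snd[of f] lborel_pair.integrable_snd[of f] assms
  by (simp_all add: lborel_prod)

text \<open>The integrable majorant in the unbounded variable \<open>u\<close> of the linking
  integral; it is also the Jacobian of the substitution \<open>u / (1 + u)\<close>.\<close>

lemma integrable_inverse_square:
  "integrable lborel (\<lambda>u::real. indicator {0..} u * (1 / (1 + u)\<^sup>2))"
proof -
  have "(\<integral>\<^sup>+u. ennreal (1 / (1 + u :: real)\<^sup>2) * indicator {0..} u \<partial>lborel) = ennreal (0 - (- 1 / (1 + 0)))"
  proof (rule nn_integral_FTC_atLeast)
    show "((\<lambda>u. - 1 / (1 + u)) has_real_derivative 1 / (1 + u)\<^sup>2) (at u)" if "0 \<le> u" for u :: real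
      using that by (auto intro!: derivative_eq_intros simp: power2_eq_square)
    show "((\<lambda>u::real. - 1 / (1 + u)) \<longlongrightarrow> 0) at_top"
      by (intro tendsto_divide_0[OF tendsto_const] filterlim_at_top_imp_at_infinity
          filterlim_tendsto_add_at_top[OF tendsto_const filterlim_ident])
  qed auto
  moreover have "(\<integral>\<^sup>+u. ennreal (norm (indicator {0..} u * (1 / (1 + u :: real)\<^sup>2))) \<partial>lborel)
     = (\<integral>\<^sup>+u. ennreal (1 / (1 + u :: real)\<^sup>2) * indicator {0..} u \<partial>lborel)"
    by (intro nn_integral_cong) (auto simp: indicator_def)
  ultimately show ?thesis
    by (intro integrableI_bounded) auto
qed

text \<open>
  The substitution \<open>x = u / (1 + u)\<close> turns the integrand \<open>u det(\<dots>) / |\<gamma>\<^sub>1 - u \<gamma>\<^sub>2|\<^sup>4\<close> into one that is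
  continuous up to \<open>x = 0\<close> and \<open>x = 1\<close>.
\<close>

lemma linking_number_eq:
  fixes g1 g1' g2 g2' :: "real \<Rightarrow> real ^ 4"
  assumes d1: "\<And>s. (g1 has_vector_derivative g1' s) (at s)"
    and d2: "\<And>t. (g2 has_vector_derivative g2' t) (at t)"
    and c1: "continuous_on UNIV g1'" and c2: "continuous_on UNIV g2'"
    and T: "0 \<le> T1" "0 \<le> T2"
    and disjoint: "\<And>s t x. s \<in> {0..T1} \<Longrightarrow> t \<in> {0..T2} \<Longrightarrow> x \<in> {0..1} \<Longrightarrow> (1 - x) *\<^sub>R g1 s \<noteq> x *\<^sub>R g2 t"
    and K: "\<And>t. t \<in> {0..T2} \<Longrightarrow> integral (cbox (0, 0) (1, T1)) (\<lambda>(x, s).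
       x * (1 - x) * det (vector [g1 s, g1' s, g2 t, g2' t] :: real ^ 4 ^ 4) / norm ((1 - x) *\<^sub>R g1 s - x *\<^sub>R g2 t) ^ 4) = K"
  shows "linking_number (g1, T1) (g2, T2) = T2 * K / (2 * pi\<^sup>2)"
proof -
  define D where "D s t = det (vector [g1 s, g1' s, g2 t, g2' t] :: real ^ 4 ^ 4)" for s t
  define k where "k s x t = x * (1 - x) * D s t / norm ((1 - x) *\<^sub>R g1 s - x *\<^sub>R g2 t) ^ 4" for s x t
  define f where "f s u t = solid_angle_form (g1 s - u *\<^sub>R g2 t) (g1' s) (- g2 t) (- (u *\<^sub>R g2' t))" for s u t
  have cg: "continuous_on UNIV g1" "continuous_on UNIV g2"
    using d1 d2 by (meson continuous_at_imp_continuous_on has_vector_derivative_continuous)+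
  note [continuous_intros] = continuous_on_compose2[OF cg(1) _ subset_UNIV] continuous_on_compose2[OF cg(2) _ subset_UNIV]
    continuous_on_compose2[OF c1 _ subset_UNIV] continuous_on_compose2[OF c2 _ subset_UNIV]
  have cD [continuous_intros]: "continuous_on S (\<lambda>z. D (a z) (b z))" if "continuous_on S a" "continuous_on S b"
    for S and a b :: "'z::topological_space \<Rightarrow> real"
    unfolding D_def det_4 vector_4 by (intro continuous_intros that)
  \<comment> \<open>Multilinearity: the two minus signs cancel, and the multiple of
    \<open>g2 t\<close> in the first row drops out against the third row.\<close>
  have f_eq: "f s u t = u * D s t / norm (g1 s - u *\<^sub>R g2 t) ^ 4" for s u t
  proof -
    have "det (vector [g1 s - u *\<^sub>R g2 t, g1' s, - g2 t, - (u *\<^sub>R g2' t)] :: real ^ 4 ^ 4) = u * D s t"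
      unfolding D_def det_4 vector_4 vector_minus_component vector_uminus_component vector_scaleR_component real_scaleR_def
      by algebra
    then show ?thesis by (simp add: f_def solid_angle_form_def)
  qed
  \<comment> \<open>The factor \<open>1 + u\<close> pulled out of the norm contributes its fourth
    power, of which \<open>x (1 - x) = u / (1 + u)^2\<close> absorbs two factors; the other two form
    the Jacobian.\<close>
  have f_k: "f s u t = k s (u / (1 + u)) t / (1 + u)\<^sup>2" if "u > 0" for s u t
  proof -
    have x: "1 - u / (1 + u) = 1 / (1 + u)" using that by (simp add: field_simps)
    have "g1 s - u *\<^sub>R g2 t = (1 + u) *\<^sub>R ((1 - u / (1 + u)) *\<^sub>R g1 s - (u / (1 + u)) *\<^sub>R g2 t)"
      unfolding x using that by (simp add: scaleR_diff_right)
    then have n: "norm (g1 s - u *\<^sub>R g2 t) = (1 + u) * norm ((1 - u / (1 + u)) *\<^sub>R g1 s - (u / (1 + u)) *\<^sub>R g2 t)"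
      using that by simp
    show ?thesis unfolding f_eq k_def n x using that
      by (simp add: power_mult_distrib power2_eq_square power4_eq_xxxx)
  qed
  let ?Q = "{0..T1} \<times> {0..1::real} \<times> {0..T2}"
  have ck: "continuous_on ?Q (\<lambda>z. k (fst z) (fst (snd z)) (snd (snd z)))"
    unfolding k_def by (intro continuous_intros ballI) (use disjoint in \<open>auto\<close>)
  \<comment> \<open>In the variable \<open>x\<close> the integrand is continuous on a compact box,
    hence bounded by some \<open>c\<close>. In the variable \<open>u\<close> this gives the bound
    \<open>c / (1 + u)^2\<close>, which makes Fubini applicable.\<close>
  have "compact ?Q" by (intro compact_Times compact_Icc)
  from compact_imp_bounded[OF compact_continuous_image[OF ck this]]
  obtain c where c: "\<And>s x t. s \<in> {0..T1} \<Longrightarrow> x \<in> {0..1} \<Longrightarrow> t \<in> {0..T2} \<Longrightarrow> \<bar>k s x t\<bar> \<le> c"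
    unfolding bounded_iff by fastforce
  define \<phi> where "\<phi> s u t = indicator {0..T1} s * (indicator {0<..} u * (indicator {0..T2} t * f s u t))" for s u t
  have \<phi>_meas: "(\<lambda>z. \<phi> (fst z) (fst (snd z)) (snd (snd z))) \<in> borel_measurable lborel"
  proof -
    have "(\<lambda>z::real \<times> real \<times> real. fst (snd z) * D (fst z) (snd (snd z))) \<in> borel_measurable borel"
      "(\<lambda>z::real \<times> real \<times> real. norm (g1 (fst z) - fst (snd z) *\<^sub>R g2 (snd (snd z))) ^ 4) \<in> borel_measurable borel"
      by (intro borel_measurable_continuous_onI continuous_intros)+
    moreover have "{0..T1} \<times> {0::real<..} \<times> {0..T2} \<in> sets borel"
      by (intro borel_Times) simp_all
    moreover have "(\<lambda>z. \<phi> (fst z) (fst (snd z)) (snd (snd z))) = (\<lambda>z. indicator ({0..T1} \<times> {0<..} \<times> {0..T2}) z *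
        (fst (snd z) * D (fst z) (snd (snd z)) / norm (g1 (fst z) - fst (snd z) *\<^sub>R g2 (snd (snd z))) ^ 4))"
      by (auto simp: \<phi>_def f_eq indicator_times fun_eq_iff)
    ultimately show ?thesis by simp
  qed
  have \<phi>_int: "integrable lborel (\<lambda>(s, p). case p of (u, t) \<Rightarrow> \<phi> s u t)"
  proof (rule Bochner_Integration.integrable_bound)
    show "integrable lborel (\<lambda>(s::real, p). indicator {0..T1} s * (case p of (u::real, t::real) \<Rightarrow>
       (indicator {0..} u * (1 / (1 + u)\<^sup>2)) * (c * indicator {0..T2} t)))"
      by (intro integrable_lborel_mult_prod integrable_inverse_square integrable_mult_right integrable_real_indicator)
        (simp_all add: T)
    show "(\<lambda>(s, p). case p of (u, t) \<Rightarrow> \<phi> s u t) \<in> borel_measurable lborel"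
      using \<phi>_meas by (simp add: split_beta')
    have "\<bar>\<phi> s u t\<bar> \<le> \<bar>indicator {0..T1} s * ((indicator {0..} u * (1 / (1 + u)\<^sup>2)) * (c * indicator {0..T2} t))\<bar>" for s u t
    proof (cases "s \<in> {0..T1} \<and> u > 0 \<and> t \<in> {0..T2}")
      case True
      then have "u / (1 + u) \<in> {0..1}" by (auto simp: field_simps)
      then have "\<bar>k s (u / (1 + u)) t\<bar> \<le> \<bar>c\<bar>" using c[of s "u / (1 + u)" t] True by auto
      then show ?thesis using True
        by (auto simp: \<phi>_def f_k abs_mult intro!: divide_right_mono)
    qed (auto simp: \<phi>_def)
    then show "AE z in lborel. norm (case z of (s, p) \<Rightarrow> case p of (u, t) \<Rightarrow> \<phi> s u t) \<le>
        norm (case z of (s::real, p) \<Rightarrow> indicator {0..T1} s * (case p of (u::real, t::real) \<Rightarrow>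
       (indicator {0..} u * (1 / (1 + u)\<^sup>2)) * (c * indicator {0..T2} t)))"
      by (auto simp: split_beta')
  qed
  \<comment> \<open>For fixed \<open>t\<close>, the substitution turns the integral over
    \<open>s\<close> and \<open>u\<close> into the integral over a rectangle that is
    \<open>K\<close> by assumption.\<close>
  have inner: "(\<integral>u. (\<integral>s. \<phi> s u t \<partial>lborel) \<partial>lborel) = indicator {0..T2} t * K" for t
  proof (cases "t \<in> {0..T2}")
    case t: True
    define \<kappa> where "\<kappa> x = integral {0..T1} (\<lambda>s. k s x t)" for x
    have "continuous_on ({0..1} \<times> cbox 0 T1) (\<lambda>(x, s). k s x t)"
      unfolding split_beta' by (rule continuous_on_compose2[OF ck, of _ "\<lambda>z. (snd z, fst z, t)", simplified])
        (use t in \<open>auto intro!: continuous_intros\<close>)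
    then have c\<kappa>: "continuous_on {0..1} \<kappa>"
      unfolding \<kappa>_def using integral_continuous_on_param[of "{0..1}" 0 T1 "\<lambda>x s. k s x t"] by simp
    have s_int: "(\<integral>s. \<phi> s u t \<partial>lborel) = indicator {0<..} u *\<^sub>R (\<kappa> (u / (1 + u)) * (1 / (1 + u)\<^sup>2))" for u
    proof (cases "u > 0")
      case u: True
      then have x: "u / (1 + u) \<in> {0..1}" by (auto simp: field_simps)
      have ck': "continuous_on {0..T1} (\<lambda>s. k s (u / (1 + u)) t)"
        by (rule continuous_on_compose2[OF ck, of _ "\<lambda>s. (s, u / (1 + u), t)", simplified])
          (use t x in \<open>auto intro!: continuous_intros\<close>)
      have "(\<integral>s. \<phi> s u t \<partial>lborel) = (LINT s:{0..T1}|lborel. k s (u / (1 + u)) t) * (1 / (1 + u)\<^sup>2)"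
        unfolding set_lebesgue_integral_def integral_mult_left_zero[symmetric]
        by (rule Bochner_Integration.integral_cong) (use t u in \<open>auto simp: \<phi>_def f_k\<close>)
      also have "(LINT s:{0..T1}|lborel. k s (u / (1 + u)) t) = \<kappa> (u / (1 + u))"
        unfolding \<kappa>_def by (intro set_borel_integral_eq_integral borel_integrable_atLeastAtMost' ck')
      finally show ?thesis using u by simp
    qed (simp add: \<phi>_def)
    have "integral {0<..} (\<lambda>u. \<bar>1 / (1 + u)\<^sup>2\<bar> * \<kappa> (u / (1 + u))) = integral {0<..<1} \<kappa> \<and>
       (\<lambda>u. \<bar>1 / (1 + u)\<^sup>2\<bar> * \<kappa> (u / (1 + u))) absolutely_integrable_on {0<..}"
    proof -
      have img: "(\<lambda>u::real. u / (1 + u)) ` {0<..} = {0<..<1}"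
      proof safe
        fix y :: real assume y: "y \<in> {0<..<1}"
        then have "y = (y / (1 - y)) / (1 + y / (1 - y))" "y / (1 - y) \<in> {0<..}" by (auto simp: field_simps)
        then show "y \<in> (\<lambda>u. u / (1 + u)) ` {0<..}" by (rule image_eqI)
      qed (auto simp: field_simps)
      have "\<kappa> absolutely_integrable_on {0..1}"
        using absolutely_integrable_continuous_real[OF c\<kappa>] .
      then have "\<kappa> absolutely_integrable_on {0<..<1}"
        by (rule set_integrable_subset) auto
      then have "\<kappa> absolutely_integrable_on (\<lambda>u. u / (1 + u)) ` {0<..} \<and>
         integral ((\<lambda>u. u / (1 + u)) ` {0<..}) \<kappa> = integral {0<..<1} \<kappa>"
        by (simp add: img)
      moreover have "((\<lambda>u. u / (1 + u)) has_field_derivative 1 / (1 + u)\<^sup>2) (at u within {0<..})" if "u \<in> {0<..}" for u :: real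
        using that by (auto intro!: derivative_eq_intros simp: power2_eq_square field_simps)
      moreover have "inj_on (\<lambda>u::real. u / (1 + u)) {0<..}"
        by (auto simp: inj_on_def field_simps)
      ultimately show ?thesis
        using has_absolute_integral_change_of_variables_1'[of "{0<..}" "\<lambda>u. u / (1 + u)" "\<lambda>u. 1 / (1 + u)\<^sup>2" \<kappa>] by auto
    qed
    moreover have "(\<lambda>u. \<bar>1 / (1 + u)\<^sup>2\<bar> * \<kappa> (u / (1 + u))) = (\<lambda>u. \<kappa> (u / (1 + u)) * (1 / (1 + u)\<^sup>2))"
      by (simp add: mult.commute)
    ultimately have cov: "integral {0<..} (\<lambda>u. \<kappa> (u / (1 + u)) * (1 / (1 + u)\<^sup>2)) = integral {0<..<1} \<kappa>"
       "(\<lambda>u. \<kappa> (u / (1 + u)) * (1 / (1 + u)\<^sup>2)) absolutely_integrable_on {0<..}" by auto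
    \<comment> \<open>Change of variables gives integrability for the completed measure; Borel
      measurability, from continuity, carries it over to \<open>lborel\<close>.\<close>
    have "integrable lborel (\<lambda>u. indicator {0<..} u *\<^sub>R (\<kappa> (u / (1 + u)) * (1 / (1 + u)\<^sup>2)))"
    proof -
      have "continuous_on {0<..} (\<lambda>u::real. \<kappa> (u / (1 + u)) * (1 / (1 + u)\<^sup>2))"
        by (intro continuous_intros continuous_on_compose2[OF c\<kappa>]) (auto simp: field_simps)
      then have "(\<lambda>u. indicator {0<..} u *\<^sub>R (\<kappa> (u / (1 + u)) * (1 / (1 + u)\<^sup>2))) \<in> borel_measurable borel"
        by (intro borel_measurable_continuous_on_indicator) simp_all
      then have "(\<lambda>u. indicator {0<..} u *\<^sub>R (\<kappa> (u / (1 + u)) * (1 / (1 + u)\<^sup>2))) \<in> borel_measurable lborel"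
        by (simp only: measurable_lborel2)
      from integrable_completion[OF this] show ?thesis using cov(2) unfolding set_integrable_def by blast
    qed
    then have "(LINT u:{0<..}|lborel. \<kappa> (u / (1 + u)) * (1 / (1 + u)\<^sup>2)) = integral {0<..<1} \<kappa>"
      using set_borel_integral_eq_integral(2)[of "{0<..}" "\<lambda>u. \<kappa> (u / (1 + u)) * (1 / (1 + u)\<^sup>2)"] cov(1)
      by (simp add: set_integrable_def)
    also have "\<dots> = integral {0..1} \<kappa>" by (rule integral_open_interval_real[symmetric])
    also have "\<dots> = integral (cbox (0, 0) (1, T1)) (\<lambda>(x, s). k s x t)"
    proof -
      have "continuous_on (cbox (0, 0) (1, T1)) (\<lambda>(x, s). k s x t)"
        unfolding split_beta' cbox_Pair_eq by (rule continuous_on_compose2[OF ck, of _ "\<lambda>z. (snd z, fst z, t)", simplified])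
        (use t in \<open>auto intro!: continuous_intros\<close>)
      from integral_prod_continuous[OF this] show ?thesis by (simp add: \<kappa>_def[abs_def])
    qed
    also have "\<dots> = K" unfolding k_def D_def by (rule K[OF t])
    finally show ?thesis using t by (simp add: s_int set_lebesgue_integral_def)
  qed (simp add: \<phi>_def)
  have "(\<lambda>z. indicator ({0..T1} \<times> {0<..} \<times> {0..T2}) z *\<^sub>R (case z of (s, u, t) \<Rightarrow>
      solid_angle_form (g1 s - u *\<^sub>R g2 t) (vector_derivative g1 (at s)) (- g2 t) (- (u *\<^sub>R vector_derivative g2 (at t)))))
    = (\<lambda>(s, p). case p of (u, t) \<Rightarrow> \<phi> s u t)"
    by (auto simp: \<phi>_def f_def fun_eq_iff indicator_def vector_derivative_at[OF d1] vector_derivative_at[OF d2])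
  then have "linking_number (g1, T1) (g2, T2) * (2 * pi\<^sup>2) = (\<integral>z. (case z of (s, p) \<Rightarrow> case p of (u, t) \<Rightarrow> \<phi> s u t) \<partial>lborel)"
    by (simp add: linking_number_def set_lebesgue_integral_def)
  also have "\<dots> = (\<integral>p. (\<integral>s. (case p of (u, t) \<Rightarrow> \<phi> s u t) \<partial>lborel) \<partial>lborel)"
    by (rule lborel_integral_snd(1)[OF \<phi>_int])
  also have "\<dots> = (\<integral>p. (case p of (u, t) \<Rightarrow> \<integral>s. \<phi> s u t \<partial>lborel) \<partial>lborel)"
    by (rule Bochner_Integration.integral_cong) auto
  also have "\<dots> = (\<integral>t. (\<integral>u. (\<integral>s. \<phi> s u t \<partial>lborel) \<partial>lborel) \<partial>lborel)"
  proof (rule lborel_integral_snd(1))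
    show "integrable lborel (\<lambda>(u, t). \<integral>s. \<phi> s u t \<partial>lborel)"
      using lborel_integral_snd(2)[OF \<phi>_int] by (simp add: split_beta')
  qed
  also have "\<dots> = T2 * K" unfolding inner using T by (simp add: measure_def)
  finally show ?thesis by (simp add: field_simps)
qed

section \<open>Linking numbers of curves on tori\<close>

text \<open>Radius, phase and angular speed in each of the two coordinate planes. A zero radius is
  allowed and gives the coordinate circles.\<close>

definition torus_curve :: "real \<Rightarrow> real \<Rightarrow> real \<Rightarrow> real \<Rightarrow> real \<Rightarrow> real \<Rightarrow> real \<Rightarrow> real ^ 4" where
  "torus_curve a p w b q v t =
     vector [a * cos (w * t + p), a * sin (w * t + p), b * cos (v * t + q), b * sin (v * t + q)]"

lemma vector_4_eq_iff:
  fixes u v :: "real ^ 4"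
  shows "u = v \<longleftrightarrow> u$1 = v$1 \<and> u$2 = v$2 \<and> u$3 = v$3 \<and> u$4 = v$4"
  by (simp add: vec_eq_iff forall_4)

lemma norm_4_squared: "(norm (v :: real ^ 4))\<^sup>2 = (v$1)\<^sup>2 + (v$2)\<^sup>2 + (v$3)\<^sup>2 + (v$4)\<^sup>2"
  unfolding power2_norm_eq_inner inner_vec_def sum_4 by (simp add: power2_eq_square)

lemma vector_4_expand:
  "(vector [a, b, c, d] :: real ^ 4) = a *\<^sub>R axis 1 1 + b *\<^sub>R axis 2 1 + c *\<^sub>R axis 3 1 + d *\<^sub>R axis 4 1"
  by (simp add: vector_4_eq_iff axis_def)

lemma has_vector_derivative_vector_4 [derivative_intros]:
  assumes "(a has_real_derivative a') (at t)" "(b has_real_derivative b') (at t)"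
    "(c has_real_derivative c') (at t)" "(d has_real_derivative d') (at t)"
  shows "((\<lambda>t. vector [a t, b t, c t, d t] :: real ^ 4) has_vector_derivative vector [a', b', c', d']) (at t)"
  unfolding vector_4_expand
  by (intro has_vector_derivative_add)
     (auto intro!: derivative_eq_intros assms[unfolded has_real_derivative_iff_has_vector_derivative] assms)

lemma has_vector_derivative_torus_curve:
  "(torus_curve a p w b q v has_vector_derivative
     vector [- w * torus_curve a p w b q v t $ 2, w * torus_curve a p w b q v t $ 1,
             - v * torus_curve a p w b q v t $ 4, v * torus_curve a p w b q v t $ 3]) (at t)"
  unfolding torus_curve_def vector_4
  by (rule has_vector_derivative_vector_4) (auto intro!: derivative_eq_intros)

lemma continuous_on_vector_4 [continuous_intros]:
  assumes "continuous_on S a" "continuous_on S b" "continuous_on S c" "continuous_on S d"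
  shows "continuous_on S (\<lambda>t. vector [a t, b t, c t, d t] :: real ^ 4)"
  unfolding vector_4_expand by (intro continuous_intros assms)

text \<open>\<open>linking_number_eq\<close> written out in coordinates, with the integrand in the
  shape of \<open>torus_homotopy\<close> and \<open>circle_gauss_integral\<close>.\<close>

lemma linking_number_torus_curves:
  assumes T: "0 \<le> T1" "0 \<le> T2"
    and disjoint: "\<And>s t x. x \<in> {0..1} \<Longrightarrow> (1 - x) *\<^sub>R torus_curve a p1 w1 b p2 w2 s \<noteq> x *\<^sub>R torus_curve c q1 v1 d q2 v2 t"
    and K: "\<And>t. t \<in> {0..T2} \<Longrightarrow> integral (cbox (0, 0) (1, T1)) (\<lambda>(x, s).
       x * (1 - x) * det4 (a * cos (w1 * s + p1), a * sin (w1 * s + p1), b * cos (w2 * s + p2), b * sin (w2 * s + p2))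
         (-(w1 * (a * sin (w1 * s + p1))), w1 * (a * cos (w1 * s + p1)), -(w2 * b * sin (w2 * s + p2)), w2 * b * cos (w2 * s + p2))
         (c * cos (v1 * t + q1), c * sin (v1 * t + q1), d * cos (v2 * t + q2), d * sin (v2 * t + q2))
         (-(v1 * (c * sin (v1 * t + q1))), v1 * (c * cos (v1 * t + q1)), -(v2 * (d * sin (v2 * t + q2))), v2 * (d * cos (v2 * t + q2)))
      / (((1-x) * (a * cos (w1 * s + p1)) - x * (c * cos (v1 * t + q1)))\<^sup>2
       + ((1-x) * (a * sin (w1 * s + p1)) - x * (c * sin (v1 * t + q1)))\<^sup>2
       + ((1-x) * (b * cos (w2 * s + p2)) - x * (d * cos (v2 * t + q2)))\<^sup>2
       + ((1-x) * (b * sin (w2 * s + p2)) - x * (d * sin (v2 * t + q2)))\<^sup>2)\<^sup>2) = K"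
  shows "linking_number (torus_curve a p1 w1 b p2 w2, T1) (torus_curve c q1 v1 d q2 v2, T2) = T2 * K / (2 * pi\<^sup>2)"
proof (rule linking_number_eq[OF has_vector_derivative_torus_curve has_vector_derivative_torus_curve _ _ T disjoint])
  fix t assume t: "t \<in> {0..T2}"
  have n: "norm v ^ 4 = ((v$1)\<^sup>2 + (v$2)\<^sup>2 + (v$3)\<^sup>2 + (v$4)\<^sup>2)\<^sup>2" for v :: "real ^ 4"
    unfolding norm_4_squared[symmetric] by (simp add: power_mult[symmetric])
  show "integral (cbox (0, 0) (1, T1)) (\<lambda>(x, s).
       x * (1 - x) * det (vector [torus_curve a p1 w1 b p2 w2 s,
         vector [- w1 * torus_curve a p1 w1 b p2 w2 s $ 2, w1 * torus_curve a p1 w1 b p2 w2 s $ 1,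
             - w2 * torus_curve a p1 w1 b p2 w2 s $ 4, w2 * torus_curve a p1 w1 b p2 w2 s $ 3],
         torus_curve c q1 v1 d q2 v2 t,
         vector [- v1 * torus_curve c q1 v1 d q2 v2 t $ 2, v1 * torus_curve c q1 v1 d q2 v2 t $ 1,
             - v2 * torus_curve c q1 v1 d q2 v2 t $ 4, v2 * torus_curve c q1 v1 d q2 v2 t $ 3]] :: real ^ 4 ^ 4)
       / norm ((1 - x) *\<^sub>R torus_curve a p1 w1 b p2 w2 s - x *\<^sub>R torus_curve c q1 v1 d q2 v2 t) ^ 4) = K"
    unfolding n det_4 torus_curve_def vector_4 vector_minus_component vector_scaleR_component real_scaleR_def
    using K[OF t] unfolding det4_def prod.case by (simp add: mult.assoc)
qed (auto simp: torus_curve_def intro!: continuous_intros)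

lemma sum_four_squares_gt_zero_iff:
  fixes a b c d :: real
  shows "a\<^sup>2 + b\<^sup>2 + c\<^sup>2 + d\<^sup>2 > 0 \<longleftrightarrow> a \<noteq> 0 \<or> b \<noteq> 0 \<or> c \<noteq> 0 \<or> d \<noteq> 0"
  by (auto simp: less_le add_nonneg_eq_0_iff)

lemma cos_or_sin_nonzero: "cos x \<noteq> 0 \<or> sin x \<noteq> (0::real)"
  using sin_zero_abs_cos_one by force

text \<open>The first curve and its velocity span the first plane, so the determinant only sees the
  second plane of the other curve and is the constant \<open>w1 v2 a^2 d^2\<close>. For closed
  curves the result is the number of turns of the circle times the number of turns of the other
  curve in the second plane.\<close>

lemma linking_number_circle_torus:
  assumes "0 \<le> T1" "0 \<le> T2" "a \<noteq> 0" "d \<noteq> 0" "w1 \<noteq> 0" and k: "w1 * T1 = 2 * pi * of_int k"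
  shows "linking_number (torus_curve a p1 w1 0 p2 w2, T1) (torus_curve c q1 v1 d q2 v2, T2)
     = (w1 * T1) * (v2 * T2) / (4 * pi\<^sup>2)"
proof -
  have "linking_number (torus_curve a p1 w1 0 p2 w2, T1) (torus_curve c q1 v1 d q2 v2, T2)
     = T2 * (w1 * v2 * T1 / 2) / (2 * pi\<^sup>2)"
  proof (rule linking_number_torus_curves)
    fix s t x :: real assume x: "x \<in> {0..1}"
    show "(1 - x) *\<^sub>R torus_curve a p1 w1 0 p2 w2 s \<noteq> x *\<^sub>R torus_curve c q1 v1 d q2 v2 t"
    proof
      assume H: "(1 - x) *\<^sub>R torus_curve a p1 w1 0 p2 w2 s = x *\<^sub>R torus_curve c q1 v1 d q2 v2 t"
      then have "x = 0" using \<open>d \<noteq> 0\<close> cos_or_sin_nonzero[of "v2 * t + q2"]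
        by (auto simp: vector_4_eq_iff torus_curve_def)
      then show False using H \<open>a \<noteq> 0\<close> cos_or_sin_nonzero[of "w1 * s + p1"]
        by (auto simp: vector_4_eq_iff torus_curve_def)
    qed
  next
    fix t
    define q3 q4 where "q3 = d * cos (v2 * t + q2)" and "q4 = d * sin (v2 * t + q2)"
    have d: "q3\<^sup>2 + q4\<^sup>2 = d\<^sup>2" unfolding q3_def q4_def using sin_cos_squared_add[of "v2 * t + q2"] by algebra
    then have d0: "q3\<^sup>2 + q4\<^sup>2 > 0" using \<open>d \<noteq> 0\<close> by simp
    have D: "det4 (a * cos \<alpha>, a * sin \<alpha>, 0 * B, 0 * C) (-(w1 * (a * sin \<alpha>)), w1 * (a * cos \<alpha>), -(w2 * 0 * E), w2 * 0 * F)
       (G, H, q3, q4) (I, J, -(v2 * q4), v2 * q3) = w1 * v2 * a\<^sup>2 * d\<^sup>2" for \<alpha> B C E F G H I J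
      unfolding det4_def prod.case d[symmetric] using sin_cos_squared_add[of \<alpha>] by algebra
    have K: "w1 * v2 * a\<^sup>2 * d\<^sup>2 * T1 / (2 * a\<^sup>2 * (q3\<^sup>2 + q4\<^sup>2)) = w1 * v2 * T1 / 2"
      unfolding d using \<open>a \<noteq> 0\<close> \<open>d \<noteq> 0\<close> by (simp add: field_simps)
    show "integral (cbox (0, 0) (1, T1)) (\<lambda>(x, s).
       x * (1 - x) * det4 (a * cos (w1 * s + p1), a * sin (w1 * s + p1), 0 * cos (w2 * s + p2), 0 * sin (w2 * s + p2))
         (-(w1 * (a * sin (w1 * s + p1))), w1 * (a * cos (w1 * s + p1)), -(w2 * 0 * sin (w2 * s + p2)), w2 * 0 * cos (w2 * s + p2))
         (c * cos (v1 * t + q1), c * sin (v1 * t + q1), d * cos (v2 * t + q2), d * sin (v2 * t + q2))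
         (-(v1 * (c * sin (v1 * t + q1))), v1 * (c * cos (v1 * t + q1)), -(v2 * (d * sin (v2 * t + q2))), v2 * (d * cos (v2 * t + q2)))
      / (((1-x) * (a * cos (w1 * s + p1)) - x * (c * cos (v1 * t + q1)))\<^sup>2
       + ((1-x) * (a * sin (w1 * s + p1)) - x * (c * sin (v1 * t + q1)))\<^sup>2
       + ((1-x) * (0 * cos (w2 * s + p2)) - x * (d * cos (v2 * t + q2)))\<^sup>2
       + ((1-x) * (0 * sin (w2 * s + p2)) - x * (d * sin (v2 * t + q2)))\<^sup>2)\<^sup>2) = w1 * v2 * T1 / 2"
      unfolding q3_def[symmetric] q4_def[symmetric] D
      using circle_gauss_integral[OF \<open>a \<noteq> 0\<close> d0 \<open>w1 \<noteq> 0\<close> \<open>0 \<le> T1\<close> k,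
          where p = p1 and ?q1.0 = "c * cos (v1 * t + q1)" and ?q2.0 = "c * sin (v1 * t + q1)" and K = "w1 * v2 * a\<^sup>2 * d\<^sup>2"]
      unfolding K by simp
  qed (use assms in auto)
  then show ?thesis by (simp add: field_simps)
qed

text \<open>Shrinking \<open>b\<close> to 0 reduces to the circle. During the deformation the curves
  can meet a common ray only if \<open>a d = b' c\<close>, which \<open>b' \<le> b\<close> and
  \<open>b c \<le> a d\<close> force to happen at \<open>b' = b\<close>, where disjointness excludes
  it.\<close>

lemma linking_number_same_frequencies_if_le:
  assumes T: "0 \<le> T1" "0 \<le> T2" and "a > 0" "d > 0" "b \<ge> 0" "c \<ge> 0" "b * c \<le> a * d" "w1 \<noteq> 0"
    and k: "w1 * T1 = 2 * pi * of_int k" and l: "b > 0 \<Longrightarrow> \<exists>l. w2 * T1 = 2 * pi * of_int l"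
    and disjoint: "\<And>s t x. x \<in> {0..1} \<Longrightarrow> (1 - x) *\<^sub>R torus_curve a p1 w1 b p2 w2 s \<noteq> x *\<^sub>R torus_curve c q1 w1 d q2 w2 t"
  shows "linking_number (torus_curve a p1 w1 b p2 w2, T1) (torus_curve c q1 w1 d q2 w2, T2)
     = (w1 * T1) * (w2 * T2) / (4 * pi\<^sup>2)"
proof (cases "b = 0")
  case True
  then show ?thesis using linking_number_circle_torus[OF T, of a d w1 k] assms by simp
next
  case False
  then have b: "b > 0" using assms by simp
  then obtain l where l: "w2 * T1 = 2 * pi * of_int l" using assms by blast
  have "linking_number (torus_curve a p1 w1 b p2 w2, T1) (torus_curve c q1 w1 d q2 w2, T2)
     = T2 * (w1 * w2 * T1 / 2) / (2 * pi\<^sup>2)"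
  proof (rule linking_number_torus_curves[OF T disjoint])
    fix t
    define r1 r2 r3 r4 where "r1 = c * cos (w1 * t + q1)" and "r2 = c * sin (w1 * t + q1)"
      and "r3 = d * cos (w2 * t + q2)" and "r4 = d * sin (w2 * t + q2)"
    note r = r1_def[symmetric] r2_def[symmetric] r3_def[symmetric] r4_def[symmetric]
    have rd: "r3\<^sup>2 + r4\<^sup>2 = d\<^sup>2" and rc: "r1\<^sup>2 + r2\<^sup>2 = c\<^sup>2"
      unfolding r1_def r2_def r3_def r4_def
      using sin_cos_squared_add[of "w2 * t + q2"] sin_cos_squared_add[of "w1 * t + q1"] by algebra+
    then have d0: "r3\<^sup>2 + r4\<^sup>2 > 0" using \<open>d > 0\<close> by simp
    have pos: "((1-x) * (a * cos (w1 * s + p1)) - x * r1)\<^sup>2 + ((1-x) * (a * sin (w1 * s + p1)) - x * r2)\<^sup>2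
       + ((1-x) * (b' * cos (w2 * s + p2)) - x * r3)\<^sup>2 + ((1-x) * (b' * sin (w2 * s + p2)) - x * r4)\<^sup>2 > 0"
      if "0 \<le> b'" "b' \<le> b" "0 \<le> x" "x \<le> 1" for b' x s
    proof (rule ccontr)
      assume "\<not> ?thesis"
      then have e: "(1-x) * (a * cos (w1 * s + p1)) = x * r1" "(1-x) * (a * sin (w1 * s + p1)) = x * r2"
         "(1-x) * (b' * cos (w2 * s + p2)) = x * r3" "(1-x) * (b' * sin (w2 * s + p2)) = x * r4"
        unfolding sum_four_squares_gt_zero_iff by simp_all
      have "((1-x) * a)\<^sup>2 = ((1-x) * (a * cos (w1 * s + p1)))\<^sup>2 + ((1-x) * (a * sin (w1 * s + p1)))\<^sup>2"
        using sin_cos_squared_add[of "w1 * s + p1"] by algebra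
      also have "\<dots> = (x * c)\<^sup>2"
        unfolding e power_mult_distrib rc[symmetric] by (simp add: algebra_simps)
      finally have sq: "((1-x) * a)\<^sup>2 = (x * c)\<^sup>2" .
      have ac: "(1-x) * a = x * c"
        by (rule power2_eq_imp_eq[OF sq]) (use that \<open>a > 0\<close> \<open>c \<ge> 0\<close> in auto)
      have "((1-x) * b')\<^sup>2 = ((1-x) * (b' * cos (w2 * s + p2)))\<^sup>2 + ((1-x) * (b' * sin (w2 * s + p2)))\<^sup>2"
        using sin_cos_squared_add[of "w2 * s + p2"] by algebra
      also have "\<dots> = (x * d)\<^sup>2"
        unfolding e power_mult_distrib rd[symmetric] by (simp add: algebra_simps)
      finally have sq: "((1-x) * b')\<^sup>2 = (x * d)\<^sup>2" .
      have bd: "(1-x) * b' = x * d"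
        by (rule power2_eq_imp_eq[OF sq]) (use that \<open>d > 0\<close> in auto)
      have "x \<noteq> 0" using ac \<open>a > 0\<close> by auto
      moreover have "x \<noteq> 1" using bd \<open>d > 0\<close> by auto
      ultimately have x01: "0 < x" "x < 1" using that by auto
      have "((1-x) * a) * (x * d) = (x * c) * ((1-x) * b')" unfolding ac bd ..
      then have "(x * (1-x)) * (a * d) = (x * (1-x)) * (b' * c)" by (simp only: mult.assoc mult.commute mult.left_commute)
      then have ad: "a * d = b' * c" using x01 by simp
      have "c > 0" using ad \<open>a > 0\<close> \<open>d > 0\<close> \<open>c \<ge> 0\<close> by (cases "c = 0") auto
      then have "b * c \<le> b' * c" using ad assms by simp
      then have "b' = b" using \<open>c > 0\<close> that by simp
      then have "(1 - x) *\<^sub>R torus_curve a p1 w1 b p2 w2 s = x *\<^sub>R torus_curve c q1 w1 d q2 w2 t"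
        using e by (simp add: vector_4_eq_iff torus_curve_def r1_def r2_def r3_def r4_def)
      then show False using disjoint that by simp
    qed
    have D: "det4 (a * cos \<alpha>, a * sin \<alpha>, 0 * B, 0 * C) (-(w1 * (a * sin \<alpha>)), w1 * (a * cos \<alpha>), -(w2 * 0 * E), w2 * 0 * F)
       (G, H, r3, r4) (I, J, -(w2 * r4), w2 * r3) = w1 * w2 * a\<^sup>2 * d\<^sup>2" for \<alpha> B C E F G H I J
      unfolding det4_def prod.case rd[symmetric] using sin_cos_squared_add[of \<alpha>] by algebra
    have K: "w1 * w2 * a\<^sup>2 * d\<^sup>2 * T1 / (2 * a\<^sup>2 * (r3\<^sup>2 + r4\<^sup>2)) = w1 * w2 * T1 / 2"
      unfolding rd using \<open>a > 0\<close> \<open>d > 0\<close> by (simp add: field_simps)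
    show "integral (cbox (0, 0) (1, T1)) (\<lambda>(x, s).
       x * (1 - x) * det4 (a * cos (w1 * s + p1), a * sin (w1 * s + p1), b * cos (w2 * s + p2), b * sin (w2 * s + p2))
         (-(w1 * (a * sin (w1 * s + p1))), w1 * (a * cos (w1 * s + p1)), -(w2 * b * sin (w2 * s + p2)), w2 * b * cos (w2 * s + p2))
         (c * cos (w1 * t + q1), c * sin (w1 * t + q1), d * cos (w2 * t + q2), d * sin (w2 * t + q2))
         (-(w1 * (c * sin (w1 * t + q1))), w1 * (c * cos (w1 * t + q1)), -(w2 * (d * sin (w2 * t + q2))), w2 * (d * cos (w2 * t + q2)))
      / (((1-x) * (a * cos (w1 * s + p1)) - x * (c * cos (w1 * t + q1)))\<^sup>2
       + ((1-x) * (a * sin (w1 * s + p1)) - x * (c * sin (w1 * t + q1)))\<^sup>2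
       + ((1-x) * (b * cos (w2 * s + p2)) - x * (d * cos (w2 * t + q2)))\<^sup>2
       + ((1-x) * (b * sin (w2 * s + p2)) - x * (d * sin (w2 * t + q2)))\<^sup>2)\<^sup>2) = w1 * w2 * T1 / 2"
      unfolding r
      using torus_homotopy[OF less_imp_le[OF b] T(1) k l pos]
        circle_gauss_integral[OF _ d0 \<open>w1 \<noteq> 0\<close> T(1) k,
          where a = a and p = p1 and ?q1.0 = r1 and ?q2.0 = r2 and K = "w1 * w2 * a\<^sup>2 * d\<^sup>2"] \<open>a > 0\<close>
      unfolding K D by simp
  qed
  then show ?thesis by (simp add: field_simps)
qed

text \<open>Exchanging the two coordinate planes is an even permutation of the coordinates and an
  isometry, so it preserves the solid angle form.\<close>

lemma linking_number_swap_coordinates: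
  "linking_number (torus_curve b p2 w2 a p1 w1, T1) (torus_curve d q2 v2 c q1 v1, T2)
   = linking_number (torus_curve a p1 w1 b p2 w2, T1) (torus_curve c q1 v1 d q2 v2, T2)"
proof -
  have "solid_angle_form (torus_curve b p2 w2 a p1 w1 s - u *\<^sub>R torus_curve d q2 v2 c q1 v1 t)
     (vector_derivative (torus_curve b p2 w2 a p1 w1) (at s)) (- torus_curve d q2 v2 c q1 v1 t)
     (- (u *\<^sub>R vector_derivative (torus_curve d q2 v2 c q1 v1) (at t)))
   = solid_angle_form (torus_curve a p1 w1 b p2 w2 s - u *\<^sub>R torus_curve c q1 v1 d q2 v2 t)
     (vector_derivative (torus_curve a p1 w1 b p2 w2) (at s)) (- torus_curve c q1 v1 d q2 v2 t)
     (- (u *\<^sub>R vector_derivative (torus_curve c q1 v1 d q2 v2) (at t)))" for s u t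
  proof -
    have n: "norm v ^ 4 = ((v$1)\<^sup>2 + (v$2)\<^sup>2 + (v$3)\<^sup>2 + (v$4)\<^sup>2)\<^sup>2" for v :: "real ^ 4"
      unfolding norm_4_squared[symmetric] by (simp add: power_mult[symmetric])
    show ?thesis
      unfolding solid_angle_form_def vector_derivative_at[OF has_vector_derivative_torus_curve] n det_4
        torus_curve_def vector_4 vector_minus_component vector_uminus_component vector_scaleR_component real_scaleR_def
      by (rule arg_cong2[where f = "(/)"]) algebra+
  qed
  then show ?thesis by (simp add: linking_number_def)
qed

text \<open>Compare \<open>b c\<close> with \<open>a d\<close>: either the second component of the
  first curve can be shrunk, or, after exchanging the planes, the first one. If both products
  vanish, the curves lie on the same coordinate circle and cannot be disjoint.\<close>

lemma linking_number_same_frequencies: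
  assumes T: "0 \<le> T1" "0 \<le> T2" and nonneg: "a \<ge> 0" "b \<ge> 0" "c \<ge> 0" "d \<ge> 0"
    and ne: "a \<noteq> 0 \<or> b \<noteq> 0" "c \<noteq> 0 \<or> d \<noteq> 0" and w: "w1 \<noteq> 0" "w2 \<noteq> 0"
    and k: "a \<noteq> 0 \<Longrightarrow> \<exists>k. w1 * T1 = 2 * pi * of_int k" and l: "b \<noteq> 0 \<Longrightarrow> \<exists>l. w2 * T1 = 2 * pi * of_int l"
    and disjoint: "\<And>s t x. x \<in> {0..1} \<Longrightarrow> (1 - x) *\<^sub>R torus_curve a p1 w1 b p2 w2 s \<noteq> x *\<^sub>R torus_curve c q1 w1 d q2 w2 t"
  shows "linking_number (torus_curve a p1 w1 b p2 w2, T1) (torus_curve c q1 w1 d q2 w2, T2)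
     = (w1 * T1) * (w2 * T2) / (4 * pi\<^sup>2)"
proof -
  consider "b * c \<le> a * d" "a > 0" "d > 0" | "a * d \<le> b * c" "b > 0" "c > 0"
  proof (cases "a * d = b * c \<and> a * d = 0")
    case True
    then have "a = 0 \<and> c = 0 \<or> b = 0 \<and> d = 0" using ne by auto
    then show thesis
    proof
      assume ac: "a = 0 \<and> c = 0"
      then have bd: "b > 0" "d > 0" using ne nonneg by auto
      \<comment> \<open>With this value of \<open>x\<close> the two circles get equal radius, and
        the time \<open>(q2 - p2) / w2\<close> aligns the phases.\<close>
      have "(1 - b / (b + d)) * b = b / (b + d) * d" using bd by (simp add: field_simps)
      then have "(1 - b / (b + d)) *\<^sub>R torus_curve a p1 w1 b p2 w2 ((q2 - p2) / w2)
          = (b / (b + d)) *\<^sub>R torus_curve c q1 w1 d q2 w2 0"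
        using ac w by (simp add: torus_curve_def vector_4_eq_iff mult.assoc[symmetric])
      then show thesis using disjoint[of "b / (b + d)"] bd by (auto simp: field_simps)
    next
      assume bd: "b = 0 \<and> d = 0"
      then have ac: "a > 0" "c > 0" using ne nonneg by auto
      have "(1 - a / (a + c)) * a = a / (a + c) * c" using ac by (simp add: field_simps)
      then have "(1 - a / (a + c)) *\<^sub>R torus_curve a p1 w1 b p2 w2 ((q1 - p1) / w1)
          = (a / (a + c)) *\<^sub>R torus_curve c q1 w1 d q2 w2 0"
        using bd w by (simp add: torus_curve_def vector_4_eq_iff mult.assoc[symmetric])
      then show thesis using disjoint[of "a / (a + c)"] ac by (auto simp: field_simps)
    qed
  next
    case False
    show thesis
    proof (cases "b * c \<le> a * d")
      case True
      have "0 \<le> b * c" using nonneg by simp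
      then have "0 < a * d" using True False by linarith
      then show thesis using that(1) True nonneg by (auto simp: zero_less_mult_iff)
    next
      case F: False
      have "0 \<le> a * d" using nonneg by simp
      then have "0 < b * c" using F by linarith
      then show thesis using that(2) F nonneg by (auto simp: zero_less_mult_iff)
    qed
  qed
  then show ?thesis
  proof cases
    case 1
    then obtain k where "w1 * T1 = 2 * pi * of_int k" using k by auto
    then show ?thesis
      using 1 nonneg w l disjoint by (intro linking_number_same_frequencies_if_le[OF T]) auto
  next
    case 2
    then obtain l where l: "w2 * T1 = 2 * pi * of_int l" using l by auto
    have "linking_number (torus_curve b p2 w2 a p1 w1, T1) (torus_curve d q2 w2 c q1 w1, T2)
     = (w2 * T1) * (w1 * T2) / (4 * pi\<^sup>2)"
    proof (rule linking_number_same_frequencies_if_le[OF T _ _ _ _ _ _ l])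
      fix s t x :: real assume "x \<in> {0..1}"
      then show "(1 - x) *\<^sub>R torus_curve b p2 w2 a p1 w1 s \<noteq> x *\<^sub>R torus_curve d q2 w2 c q1 w1 t"
        using disjoint[of x s t] by (auto simp: vector_4_eq_iff torus_curve_def)
    qed (use 2 nonneg w k in \<open>auto simp: mult.commute\<close>)
    then show ?thesis
      by (simp add: linking_number_swap_coordinates field_simps)
  qed
qed

section \<open>Reeb dynamics on the boundary of a Reinhardt domain\<close>

text \<open>The squares of the radii, that is, the argument at which \<open>F\<close> is
  evaluated.\<close>

definition radii :: "real ^ 4 \<Rightarrow> real \<times> real" where
  "radii p = ((p$1)\<^sup>2 + (p$2)\<^sup>2, (p$3)\<^sup>2 + (p$4)\<^sup>2)"

lemma radii_eq_0_iff: "radii p = 0 \<longleftrightarrow> p = 0"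
  by (simp add: radii_def zero_prod_def vector_4_eq_iff sum_power2_eq_zero_iff)

lemma radii_scaleR: "radii (s *\<^sub>R p) = s\<^sup>2 *\<^sub>R radii p"
  by (simp add: radii_def power_mult_distrib algebra_simps)

lemma radii_torus_curve: "radii (torus_curve a p w b q v t) = (a\<^sup>2, b\<^sup>2)"
  by (simp add: radii_def torus_curve_def power_mult_distrib flip: distrib_left)

lemma continuous_on_radii: "continuous_on S radii"
  unfolding radii_def by (intro continuous_intros)

text \<open>\<open>lambda0\<close> is linear in the base point, hence its own derivative there. The
  result is the standard symplectic form.\<close>

lemma ext_deriv_lambda0:
  "ext_deriv lambda0 p u v = u$1 * v$2 - u$2 * v$1 + u$3 * v$4 - u$4 * v$3"
proof -
  have "linear (\<lambda>q. lambda0 q w)" for w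
    by (rule linearI) (simp_all add: lambda0_def field_simps)
  then have "((\<lambda>q. lambda0 q w) has_derivative (\<lambda>q. lambda0 q w)) (at p)" for w
    by (intro bounded_linear_imp_has_derivative) (simp add: linear_conv_bounded_linear)
  then have "frechet_derivative (\<lambda>q. lambda0 q w) (at p) = (\<lambda>q. lambda0 q w)" for w
    by (simp add: frechet_derivative_at[symmetric])
  then show ?thesis by (simp add: ext_deriv_def lambda0_def field_simps)
qed

section \<open>Calculus of positive homogeneous functions of two variables\<close>

locale reinhardt_gauge =
  fixes F :: "real \<times> real \<Rightarrow> real"
  assumes homogeneous: "\<And>s v. 0 \<le> s \<Longrightarrow> F (s *\<^sub>R v) = s * F v"
    and smooth: "smooth_on (- {0}) F"
    and pos: "\<And>v. v \<noteq> 0 \<Longrightarrow> 0 < F v"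
begin

definition F1 :: "real \<times> real \<Rightarrow> real" where "F1 v = frechet_derivative F (at v) (1, 0)"
definition F2 :: "real \<times> real \<Rightarrow> real" where "F2 v = frechet_derivative F (at v) (0, 1)"

lemma F_0: "F 0 = 0"
  using homogeneous[of 0 0] by simp

lemma F_has_derivative:
  assumes "v \<noteq> 0"
  shows "(F has_derivative (\<lambda>w. fst w * F1 v + snd w * F2 v)) (at v)"
proof -
  have "Ck_on (Suc 0) (- {0}) F" using smooth unfolding smooth_on_def by blast
  then have d: "(F has_derivative frechet_derivative F (at v)) (at v)"
    using assms frechet_derivative_works[of F "at v"] by simp
  then have lin: "linear (frechet_derivative F (at v))" by (rule has_derivative_linear)
  have "frechet_derivative F (at v) w = fst w * F1 v + snd w * F2 v" for w
  proof -
    have "w = fst w *\<^sub>R (1, 0) + snd w *\<^sub>R (0, 1)" by (cases w) simp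
    then have "frechet_derivative F (at v) w = frechet_derivative F (at v) (fst w *\<^sub>R (1, 0) + snd w *\<^sub>R (0, 1))"
      by simp
    also have "\<dots> = fst w * F1 v + snd w * F2 v"
      unfolding F1_def F2_def linear_add[OF lin] linear_scale[OF lin] by simp
    finally show ?thesis .
  qed
  then have "frechet_derivative F (at v) = (\<lambda>w. fst w * F1 v + snd w * F2 v)" by auto
  then show ?thesis using d by simp
qed

lemma continuous_on_F1: "continuous_on (- {0}) F1"
  and continuous_on_F2: "continuous_on (- {0}) F2"
proof -
  have "Ck_on (Suc 0) (- {0}) F" using smooth unfolding smooth_on_def by blast
  then have "continuous_on (- {0}) (\<lambda>x. frechet_derivative F (at x) v)" for v by (cases v) simp
  then show "continuous_on (- {0}) F1" "continuous_on (- {0}) F2"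
    unfolding F1_def[abs_def] F2_def[abs_def] by blast+
qed

text \<open>Only the origin needs an argument: by homogeneity \<open>F v\<close> is at most
  \<open>norm v\<close> times a bound on the unit circle.\<close>

lemma continuous_on_F: "continuous_on UNIV F"
proof -
  have 1: "continuous (at v) F" if "v \<noteq> 0" for v
    using F_has_derivative[OF that] by (rule has_derivative_continuous)
  have "compact (sphere (0 :: real \<times> real) 1)" by simp
  moreover have "continuous_on (sphere (0 :: real \<times> real) 1) F"
    by (intro continuous_at_imp_continuous_on ballI 1) auto
  ultimately have "bounded (F ` sphere 0 1)" by (intro compact_imp_bounded compact_continuous_image)
  then obtain c where c: "\<And>v. norm v = 1 \<Longrightarrow> \<bar>F v\<bar> \<le> c"
    unfolding bounded_iff by (metis imageI mem_sphere_0 real_norm_def)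
  have "\<bar>F v\<bar> \<le> norm v * c" for v
  proof (cases "v = 0")
    case False
    have "F v = norm v * F (v /\<^sub>R norm v)"
      using homogeneous[of "norm v" "v /\<^sub>R norm v"] False by simp
    then show ?thesis using c[of "v /\<^sub>R norm v"] False by (simp add: abs_mult)
  qed (simp add: F_0)
  then have "\<forall>\<^sub>F v in at 0. norm (F v) \<le> norm v * c" by simp
  moreover have "((\<lambda>v::real \<times> real. norm v * c) \<longlongrightarrow> 0) (at 0)"
    by (intro tendsto_mult_left_zero tendsto_norm_zero tendsto_ident_at)
  ultimately have "(F \<longlongrightarrow> 0) (at 0)" by (rule Lim_null_comparison)
  then have "continuous (at 0) F" by (simp add: continuous_at F_0)
  with 1 show ?thesis by (metis continuous_at_imp_continuous_on)
qed

text \<open>Differentiate \<open>F (s v) = s F v\<close> in \<open>s\<close> at 1.\<close>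

lemma euler:
  assumes "v \<noteq> 0"
  shows "fst v * F1 v + snd v * F2 v = F v"
proof -
  have "((\<lambda>s. F (s *\<^sub>R v)) has_derivative (\<lambda>s. fst (s *\<^sub>R v) * F1 v + snd (s *\<^sub>R v) * F2 v)) (at 1)"
    by (rule has_derivative_compose[OF has_derivative_scaleR_left[OF has_derivative_ident]])
      (use F_has_derivative[OF assms] in simp)
  moreover have "((\<lambda>s. F (s *\<^sub>R v)) has_derivative (\<lambda>s. s * F v)) (at 1)"
  proof (rule has_derivative_transform_eventually)
    show "((\<lambda>s. s * F v) has_derivative (\<lambda>s. s * F v)) (at 1)" by (auto intro!: derivative_eq_intros)
    have "\<forall>\<^sub>F s in at (1::real). 0 < s"
      by (rule order_tendstoD(1)[OF tendsto_ident_at]) simp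
    then show "\<forall>\<^sub>F s in at 1. s * F v = F (s *\<^sub>R v)" by eventually_elim (simp add: homogeneous)
  qed (simp_all add: homogeneous)
  ultimately have "(\<lambda>s. fst (s *\<^sub>R v) * F1 v + snd (s *\<^sub>R v) * F2 v) = (\<lambda>s. s * F v)"
    by (rule has_derivative_unique)
  from fun_cong[OF this, of 1] show ?thesis by simp
qed

text \<open>Differentiating \<open>F (s w) = s F w\<close> in \<open>w\<close> and cancelling
  \<open>s\<close> shows that the partial derivatives are constant along rays. Hence they can be
  evaluated on the segment from \<open>(1, 0)\<close> to \<open>(0, 1)\<close>.\<close>

lemma F1_scaleR: "s > 0 \<Longrightarrow> v \<noteq> 0 \<Longrightarrow> F1 (s *\<^sub>R v) = F1 v"
  and F2_scaleR: "s > 0 \<Longrightarrow> v \<noteq> 0 \<Longrightarrow> F2 (s *\<^sub>R v) = F2 v"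
proof -
  assume s: "s > 0" and v: "v \<noteq> 0"
  then have sv: "s *\<^sub>R v \<noteq> 0" by simp
  have d1: "((\<lambda>w. F (s *\<^sub>R w)) has_derivative (\<lambda>w. fst (s *\<^sub>R w) * F1 (s *\<^sub>R v) + snd (s *\<^sub>R w) * F2 (s *\<^sub>R v))) (at v)"
    by (rule has_derivative_compose[OF has_derivative_scaleR_right[OF has_derivative_ident] F_has_derivative[OF sv]])
  have e: "(\<lambda>w. F (s *\<^sub>R w)) = (\<lambda>w. s * F w)" using s homogeneous by auto
  have d2: "((\<lambda>w. s * F w) has_derivative (\<lambda>w. s * (fst w * F1 v + snd w * F2 v))) (at v)"
    by (intro has_derivative_mult_right F_has_derivative v)
  have u: "(\<lambda>w. fst (s *\<^sub>R w) * F1 (s *\<^sub>R v) + snd (s *\<^sub>R w) * F2 (s *\<^sub>R v)) = (\<lambda>w. s * (fst w * F1 v + snd w * F2 v))"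
    by (rule has_derivative_unique[OF d1[unfolded e] d2])
  from fun_cong[OF u, of "(1, 0)"] fun_cong[OF u, of "(0, 1)"] s
  show "F1 (s *\<^sub>R v) = F1 v" "F2 (s *\<^sub>R v) = F2 v" by simp_all
qed

section \<open>The hypersurface and its Reeb orbits\<close>

definition M :: "(real ^ 4) set" where "M = {p. F (radii p) = 1}"

text \<open>Scaling a point by \<open>s\<close> multiplies \<open>F (radii p)\<close> by
  \<open>s^2\<close>, so points at level 1 are pushed out of the domain by \<open>s > 1\<close> and
  are not interior.\<close>

lemma frontier_reinhardt: "frontier (reinhardt F) = M"
proof -
  have W: "reinhardt F = {p. F (radii p) \<le> 1}" by (simp add: reinhardt_def radii_def)
  have cH: "continuous_on UNIV (\<lambda>p. F (radii p))"
    by (rule continuous_on_compose2[OF continuous_on_F continuous_on_radii]) simp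
  have "closed (reinhardt F)"
    unfolding W by (intro closed_Collect_le cH continuous_intros)
  moreover have "interior (reinhardt F) = {p. F (radii p) < 1}"
  proof (rule interior_unique)
    show "open {p. F (radii p) < 1}" by (intro open_Collect_less cH continuous_intros)
    fix T assume T: "T \<subseteq> reinhardt F" "open T"
    show "T \<subseteq> {p. F (radii p) < 1}"
    proof
      fix p assume p: "p \<in> T"
      have "\<forall>\<^sub>F s in at_right (1::real). s *\<^sub>R p \<in> T"
      proof (rule topological_tendstoD[OF _ T(2)])
        show "((\<lambda>s. s *\<^sub>R p) \<longlongrightarrow> 1 *\<^sub>R p) (at_right 1)" by (intro tendsto_intros)
      qed (use p in simp)
      moreover have "\<forall>\<^sub>F s in at_right (1::real). s > 1" by (simp add: eventually_at_right_less)
      ultimately have "\<forall>\<^sub>F s in at_right (1::real). s *\<^sub>R p \<in> T \<and> s > 1" by (rule eventually_conj)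
      then obtain s :: real where s: "s *\<^sub>R p \<in> T" "s > 1"
        using eventually_happens[of _ "at_right (1::real)"] by auto
      have le: "s\<^sup>2 * F (radii p) \<le> 1" using s T(1) by (auto simp: W radii_scaleR homogeneous)
      have "s\<^sup>2 > 1" using s(2) by (simp add: one_less_power)
      have "F (radii p) < 1"
      proof (rule ccontr)
        assume "\<not> F (radii p) < 1"
        then have "s\<^sup>2 * 1 \<le> s\<^sup>2 * F (radii p)" by (intro mult_left_mono) auto
        then show False using le \<open>s\<^sup>2 > 1\<close> by linarith
      qed
      then show "p \<in> {p. F (radii p) < 1}" by simp
    qed
  qed (auto simp: W)
  ultimately show ?thesis unfolding frontier_def by (auto simp: W M_def)
qed

lemma radii_nonzero: "p \<in> M \<Longrightarrow> radii p \<noteq> 0"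
  using F_0 by (auto simp: M_def)

text \<open>Along a curve in \<open>M\<close> the function \<open>F (radii p)\<close> is constantly
  1; its derivative gives the equation. This inclusion is what is needed to verify that a given
  vector is a Reeb vector.\<close>

lemma tangent_vector_M:
  assumes "v \<in> tangent_vectors M p"
  shows "F1 (radii p) * (p$1 * v$1 + p$2 * v$2) + F2 (radii p) * (p$3 * v$3 + p$4 * v$4) = 0"
proof -
  obtain c e where c: "e > 0" "\<And>t. \<bar>t\<bar> < e \<Longrightarrow> c t \<in> M" "c 0 = p" "(c has_vector_derivative v) (at (0::real))"
    using assms unfolding tangent_vectors_def by blast
  have "p \<in> M" using c(1,2,3) by (metis abs_zero)
  have ci: "((\<lambda>t. c t $ i) has_real_derivative v $ i) (at 0)" for i
    using bounded_linear.has_vector_derivative[OF bounded_linear_vec_nth c(4)]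
    by (simp add: has_real_derivative_iff_has_vector_derivative)
  have d1: "((\<lambda>t. (c t $ 1)\<^sup>2 + (c t $ 2)\<^sup>2) has_real_derivative 2 * (p$1 * v$1 + p$2 * v$2)) (at 0)"
    and d2: "((\<lambda>t. (c t $ 3)\<^sup>2 + (c t $ 4)\<^sup>2) has_real_derivative 2 * (p$3 * v$3 + p$4 * v$4)) (at 0)"
    by (auto intro!: derivative_eq_intros ci simp: c(3) algebra_simps)
  have dr: "((\<lambda>t. radii (c t)) has_derivative (\<lambda>h. (h * (2 * (p$1 * v$1 + p$2 * v$2)), h * (2 * (p$3 * v$3 + p$4 * v$4))))) (at 0)"
    unfolding radii_def using d1 d2
    by (intro has_derivative_Pair) (simp_all add: has_field_derivative_def mult.commute[of _ "_ * _"] mult_commute_abs)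
  have "(F has_derivative (\<lambda>w. fst w * F1 (radii p) + snd w * F2 (radii p))) (at (radii (c 0)))"
    using F_has_derivative[OF radii_nonzero[OF \<open>p \<in> M\<close>]] c(3) by simp
  from has_derivative_compose[OF dr this]
  have "((\<lambda>t. F (radii (c t))) has_derivative
      (\<lambda>h. (h * (2 * (p$1 * v$1 + p$2 * v$2))) * F1 (radii p) + (h * (2 * (p$3 * v$3 + p$4 * v$4))) * F2 (radii p))) (at 0)"
    by (simp only: fst_conv snd_conv)
  moreover have "((\<lambda>t. F (radii (c t))) has_derivative (\<lambda>h. 0)) (at 0)"
  proof (rule has_derivative_transform_eventually)
    have "\<forall>\<^sub>F t in at (0::real). \<bar>t\<bar> < e"
      using c(1) by (auto simp: eventually_at dist_real_def)
    then show "\<forall>\<^sub>F t in at 0. 1 = F (radii (c t))"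
      by eventually_elim (use c(2) in \<open>auto simp: M_def\<close>)
    show "1 = F (radii (c 0))" using \<open>p \<in> M\<close> c(3) by (simp add: M_def)
  qed simp_all
  ultimately have "(\<lambda>h. (h * (2 * (p$1 * v$1 + p$2 * v$2))) * F1 (radii p) + (h * (2 * (p$3 * v$3 + p$4 * v$4))) * F2 (radii p)) = (\<lambda>h. 0)"
    by (rule has_derivative_unique)
  from fun_cong[OF this, of 1] show ?thesis by (simp add: algebra_simps)
qed

text \<open>Contracting the symplectic form with the velocity gives -2 times the left side of
  \<open>tangent_vector_M\<close>, and \<open>lambda0\<close> takes the value 1 on it by Euler's
  identity. The closing condition concerns only planes in which the radius is nonzero.\<close>

lemma torus_curve_reeb_orbit:
  assumes F: "F (a\<^sup>2, b\<^sup>2) = 1" and T: "T > 0"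
    and w: "w = 2 * F1 (a\<^sup>2, b\<^sup>2)" "v = 2 * F2 (a\<^sup>2, b\<^sup>2)"
    and k: "a \<noteq> 0 \<Longrightarrow> \<exists>k::int. w * T = 2 * pi * k" and l: "b \<noteq> 0 \<Longrightarrow> \<exists>l::int. v * T = 2 * pi * l"
  shows "periodic_reeb_orbit M lambda0 (torus_curve a p w b q v, T)"
proof -
  let ?g = "torus_curve a p w b q v"
  have M: "?g t \<in> M" for t by (simp add: M_def radii_torus_curve F)
  have per: "?g (t + T) = ?g t" for t
  proof -
    have "a * cos (w * (t + T) + p) = a * cos (w * t + p) \<and> a * sin (w * (t + T) + p) = a * sin (w * t + p)"
    proof (cases "a = 0")
      case False
      then obtain k :: int where "w * T = 2 * pi * k" using k by auto
      then have e: "w * (t + T) + p = w * t + p + 2 * pi * k" by (simp add: algebra_simps)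
      show ?thesis
        unfolding e sin_add[of "w * t + p"] cos_add[of "w * t + p"] sin_int_2pin cos_int_2pin by simp
    qed simp
    moreover have "b * cos (v * (t + T) + q) = b * cos (v * t + q) \<and> b * sin (v * (t + T) + q) = b * sin (v * t + q)"
    proof (cases "b = 0")
      case False
      then obtain k :: int where "v * T = 2 * pi * k" using l by auto
      then have e: "v * (t + T) + q = v * t + q + 2 * pi * k" by (simp add: algebra_simps)
      show ?thesis
        unfolding e sin_add[of "v * t + q"] cos_add[of "v * t + q"] sin_int_2pin cos_int_2pin by simp
    qed simp
    ultimately show ?thesis by (auto simp: torus_curve_def vector_4_eq_iff)
  qed
  have reeb: "is_reeb_vector M lambda0 (?g t) (vector [- w * ?g t $ 2, w * ?g t $ 1, - v * ?g t $ 4, v * ?g t $ 3])" for t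
    unfolding is_reeb_vector_def
  proof (intro conjI ballI)
    \<comment> \<open>The same trajectory with time shifted, so that it passes through the given
      point at parameter 0.\<close>
    let ?c = "torus_curve a (w * t + p) w b (v * t + q) v"
    have c0: "?c 0 = ?g t" by (simp add: torus_curve_def)
    have "?c s \<in> M" for s by (simp add: M_def radii_torus_curve F)
    then show "vector [- w * ?g t $ 2, w * ?g t $ 1, - v * ?g t $ 4, v * ?g t $ 3] \<in> tangent_vectors M (?g t)"
      using has_vector_derivative_torus_curve[of a "w * t + p" w b "v * t + q" v 0, unfolded c0] c0
      unfolding tangent_vectors_def by (intro CollectI exI[of _ ?c] exI[of _ 1]) auto
  next
    fix u assume "u \<in> tangent_vectors M (?g t)"
    from tangent_vector_M[OF this] show "ext_deriv lambda0 (?g t) (vector [- w * ?g t $ 2, w * ?g t $ 1, - v * ?g t $ 4, v * ?g t $ 3]) u = 0"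
      unfolding radii_torus_curve ext_deriv_lambda0 vector_4 w by algebra
  next
    have "a\<^sup>2 * F1 (a\<^sup>2, b\<^sup>2) + b\<^sup>2 * F2 (a\<^sup>2, b\<^sup>2) = 1"
      using euler[of "(a\<^sup>2, b\<^sup>2)"] F F_0 by (cases "(a\<^sup>2, b\<^sup>2) = 0") auto
    then show "lambda0 (?g t) (vector [- w * ?g t $ 2, w * ?g t $ 1, - v * ?g t $ 4, v * ?g t $ 3]) = 1"
      unfolding lambda0_def vector_4 torus_curve_def w
      using sin_cos_squared_add[of "2 * F1 (a\<^sup>2, b\<^sup>2) * t + p"] sin_cos_squared_add[of "2 * F2 (a\<^sup>2, b\<^sup>2) * t + q"] by algebra
  qed
  show ?thesis
    unfolding periodic_reeb_orbit_def using T per M reeb has_vector_derivative_torus_curve by blast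
qed

end

section \<open>The contact volume\<close>

lemma radii_sphere_param: "radii (sphere_param (\<eta>, \<theta>1, \<theta>2)) = ((cos \<eta>)\<^sup>2, (sin \<eta>)\<^sup>2)"
  by (simp add: radii_def sphere_param_def power_mult_distrib flip: distrib_left)

lemma cos_sin_squared_nonzero: "((cos \<eta>)\<^sup>2, (sin \<eta>)\<^sup>2) \<noteq> (0 :: real \<times> real)"
  using cos_or_sin_nonzero[of \<eta>] by (auto simp: zero_prod_def)

text \<open>Here \<open>u\<close>, \<open>v\<close>, \<open>w\<close> are the coordinate vectors of
  the parametrization by \<eta>, \<theta>, \<psi>. Since \<open>lambda0\<close> vanishes on
  \<open>u\<close>, two of the three terms remain.\<close>

lemma wedge_lambda0_torus_coordinates:
  assumes "p = vector [A * cos \<theta>, A * sin \<theta>, B * cos \<psi>, B * sin \<psi>]"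
    and "u = vector [A' * cos \<theta>, A' * sin \<theta>, B' * cos \<psi>, B' * sin \<psi>]"
    and "v = vector [- A * sin \<theta>, A * cos \<theta>, 0, 0]"
    and "w = vector [0, 0, - B * sin \<psi>, B * cos \<psi>]"
  shows "wedge12 lambda0 (ext_deriv lambda0) p u v w = A * B * (B * A' - A * B') / 2"
proof -
  note defs = assms lambda0_def ext_deriv_lambda0 vector_4
  note sc = sin_cos_squared_add[of \<theta>] sin_cos_squared_add[of \<psi>]
  have 1: "lambda0 p u = 0" unfolding defs by (simp add: algebra_simps)
  have 2: "lambda0 p v = A\<^sup>2 / 2" "lambda0 p w = B\<^sup>2 / 2"
    unfolding defs by (rule arg_cong[where f = "\<lambda>z. z / 2"], use sc in algebra)+
  have 3: "ext_deriv lambda0 p w u = - (B * B')" "ext_deriv lambda0 p u v = A * A'"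
    unfolding defs using sc by algebra+
  show ?thesis unfolding wedge12_def 1 2 3 by (simp add: field_simps power2_eq_square)
qed

lemma frechet_derivative_torus_coordinates:
  fixes A B :: "real \<Rightarrow> real"
  assumes A: "(A has_real_derivative A') (at \<eta>)" and B: "(B has_real_derivative B') (at \<eta>)"
  defines "\<Phi> \<equiv> \<lambda>(\<eta>, \<theta>, \<psi>). vector [A \<eta> * cos \<theta>, A \<eta> * sin \<theta>, B \<eta> * cos \<psi>, B \<eta> * sin \<psi>] :: real ^ 4"
  shows "frechet_derivative \<Phi> (at (\<eta>, \<theta>, \<psi>)) (1, 0, 0) = vector [A' * cos \<theta>, A' * sin \<theta>, B' * cos \<psi>, B' * sin \<psi>]"
    and "frechet_derivative \<Phi> (at (\<eta>, \<theta>, \<psi>)) (0, 1, 0) = vector [- A \<eta> * sin \<theta>, A \<eta> * cos \<theta>, 0, 0]"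
    and "frechet_derivative \<Phi> (at (\<eta>, \<theta>, \<psi>)) (0, 0, 1) = vector [0, 0, - B \<eta> * sin \<psi>, B \<eta> * cos \<psi>]"
proof -
  let ?q = "(\<eta>, \<theta>, \<psi>)"
  have f: "((\<lambda>q. f (fst q)) has_derivative (\<lambda>h. fst h * f')) (at ?q)" if "(f has_real_derivative f') (at \<eta>)" for f :: "real \<Rightarrow> real" and f'
    using has_derivative_compose[OF has_derivative_fst[OF has_derivative_ident], of f "\<lambda>h. h * f'" ?q UNIV] that
    by (simp add: has_field_derivative_def mult_commute_abs)
  have g: "((\<lambda>q. f (fst (snd q))) has_derivative (\<lambda>h. fst (snd h) * f')) (at ?q)" if "(f has_real_derivative f') (at \<theta>)" for f :: "real \<Rightarrow> real" and f'
    using has_derivative_compose[OF has_derivative_fst[OF has_derivative_snd[OF has_derivative_ident]], of f "\<lambda>h. h * f'" ?q UNIV] that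
    by (simp add: has_field_derivative_def mult_commute_abs)
  have h: "((\<lambda>q. f (snd (snd q))) has_derivative (\<lambda>h. snd (snd h) * f')) (at ?q)" if "(f has_real_derivative f') (at \<psi>)" for f :: "real \<Rightarrow> real" and f'
    using has_derivative_compose[OF has_derivative_snd[OF has_derivative_snd[OF has_derivative_ident]], of f "\<lambda>h. h * f'" ?q UNIV] that
    by (simp add: has_field_derivative_def mult_commute_abs)
  note g = g[OF DERIV_cos] g[OF DERIV_sin] and h = h[OF DERIV_cos] h[OF DERIV_sin] and f = f[OF A] f[OF B]
  define D where "D h = (A \<eta> * (fst (snd h) * - sin \<theta>) + fst h * A' * cos \<theta>) *\<^sub>R axis 1 1
     + (A \<eta> * (fst (snd h) * cos \<theta>) + fst h * A' * sin \<theta>) *\<^sub>R axis 2 1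
     + (B \<eta> * (snd (snd h) * - sin \<psi>) + fst h * B' * cos \<psi>) *\<^sub>R axis 3 1
     + (B \<eta> * (snd (snd h) * cos \<psi>) + fst h * B' * sin \<psi>) *\<^sub>R (axis 4 1 :: real ^ 4)" for h :: "real \<times> real \<times> real"
  have "(\<Phi> has_derivative D) (at ?q)"
    unfolding \<Phi>_def split_beta' vector_4_expand D_def
    using has_derivative_mult[OF f(1) g(1)] has_derivative_mult[OF f(1) g(2)]
      has_derivative_mult[OF f(2) h(1)] has_derivative_mult[OF f(2) h(2)]
    by (intro has_derivative_add has_derivative_scaleR_left) simp_all
  then have "frechet_derivative \<Phi> (at ?q) = D" by (simp add: frechet_derivative_at[symmetric])
  then show "frechet_derivative \<Phi> (at (\<eta>, \<theta>, \<psi>)) (1, 0, 0) = vector [A' * cos \<theta>, A' * sin \<theta>, B' * cos \<psi>, B' * sin \<psi>]"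
    "frechet_derivative \<Phi> (at (\<eta>, \<theta>, \<psi>)) (0, 1, 0) = vector [- A \<eta> * sin \<theta>, A \<eta> * cos \<theta>, 0, 0]"
    "frechet_derivative \<Phi> (at (\<eta>, \<theta>, \<psi>)) (0, 0, 1) = vector [0, 0, - B \<eta> * sin \<psi>, B \<eta> * cos \<psi>]"
    by (simp_all add: D_def vector_4_expand)
qed

context reinhardt_gauge
begin

lemma radial_point_M:
  assumes "u \<noteq> 0"
  shows "radial_point M u = (1 / sqrt (F (radii u))) *\<^sub>R u"
proof -
  have g: "F (radii u) > 0" using assms pos radii_eq_0_iff by blast
  have "(THE s::real. s > 0 \<and> s *\<^sub>R u \<in> M) = 1 / sqrt (F (radii u))"
  proof (rule the_equality)
    show "1 / sqrt (F (radii u)) > 0 \<and> (1 / sqrt (F (radii u))) *\<^sub>R u \<in> M"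
      using g by (simp add: M_def radii_scaleR homogeneous power_divide)
    fix s :: real assume s: "s > 0 \<and> s *\<^sub>R u \<in> M"
    then have "s\<^sup>2 * F (radii u) = 1" by (simp add: M_def radii_scaleR homogeneous)
    then have "sqrt (s\<^sup>2 * F (radii u)) = 1" by simp
    then have "s * sqrt (F (radii u)) = 1" using s by (simp add: real_sqrt_mult)
    then show "s = 1 / sqrt (F (radii u))" using g by (simp add: field_simps)
  qed
  then show ?thesis by (simp add: radial_point_def)
qed

lemma DERIV_F:
  assumes "(x has_real_derivative x') (at t)" "(y has_real_derivative y') (at t)" "(x t, y t) \<noteq> 0"
  shows "((\<lambda>t. F (x t, y t)) has_real_derivative x' * F1 (x t, y t) + y' * F2 (x t, y t)) (at t)"
proof -
  have "((\<lambda>t. (x t, y t)) has_derivative (\<lambda>h. (h * x', h * y'))) (at t)"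
    using assms(1,2) by (intro has_derivative_Pair) (simp_all add: has_field_derivative_def mult_commute_abs)
  from has_derivative_compose[OF this F_has_derivative[OF assms(3)]]
  show ?thesis unfolding has_field_derivative_def
    by (rule has_derivative_eq_rhs) (simp add: fun_eq_iff algebra_simps)
qed

definition L :: real where "L = integral {0..1} (\<lambda>t. 1 / (F (1 - t, t))\<^sup>2)"

lemma segment_nonzero: "(1 - t, t) \<noteq> (0 :: real \<times> real)"
  by (auto simp: zero_prod_def)

lemma F_segment_pos: "F (1 - t, t) > 0"
  using pos segment_nonzero by blast

lemma continuous_on_F_compose [continuous_intros]:
  "continuous_on S f \<Longrightarrow> continuous_on S g \<Longrightarrow> continuous_on S (\<lambda>t. F (f t, g t))"
  by (rule continuous_on_compose2[OF continuous_on_F]) (auto intro!: continuous_intros)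

text \<open>The integrand reduces to \<open>sin \<eta> cos \<eta> / (2 F^2)\<close> on the parameter
  range. The two angles contribute \<open>4 pi^2\<close>, and the substitution
  \<open>t = sin^2 \<eta>\<close> gives \<open>L / 4\<close>.\<close>

lemma contact_volume_M: "contact_volume M lambda0 = pi\<^sup>2 * L"
proof -
  define g where "g \<eta> = F ((cos \<eta>)\<^sup>2, (sin \<eta>)\<^sup>2)" for \<eta>
  have g: "g \<eta> > 0" for \<eta> unfolding g_def using pos cos_sin_squared_nonzero by blast
  define A B where "A \<eta> = cos \<eta> / sqrt (g \<eta>)" and "B \<eta> = sin \<eta> / sqrt (g \<eta>)" for \<eta>
  have sp: "sphere_param q \<noteq> 0" for q
    using radii_sphere_param cos_sin_squared_nonzero radii_eq_0_iff by (cases q) metis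
  have \<Phi>: "radial_point M \<circ> sphere_param = (\<lambda>(\<eta>, \<theta>, \<psi>). vector [A \<eta> * cos \<theta>, A \<eta> * sin \<theta>, B \<eta> * cos \<psi>, B \<eta> * sin \<psi>])"
  proof (rule ext, clarify)
    fix \<eta> \<theta> \<psi>
    show "(radial_point M \<circ> sphere_param) (\<eta>, \<theta>, \<psi>) = vector [A \<eta> * cos \<theta>, A \<eta> * sin \<theta>, B \<eta> * cos \<psi>, B \<eta> * sin \<psi>]"
      unfolding o_def radial_point_M[OF sp] radii_sphere_param g_def[symmetric]
      by (simp add: sphere_param_def A_def B_def vector_4_eq_iff)
  qed
  let ?\<Phi> = "radial_point M \<circ> sphere_param"
  have integrand: "(let D = frechet_derivative ?\<Phi> (at q) in
      \<bar>wedge12 lambda0 (ext_deriv lambda0) (?\<Phi> q) (D (1, 0, 0)) (D (0, 1, 0)) (D (0, 0, 1))\<bar>)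
      = \<bar>sin (fst q) * cos (fst q)\<bar> / (2 * (g (fst q))\<^sup>2)" for q
  proof -
    obtain \<eta> \<theta> \<psi> where q: "q = (\<eta>, \<theta>, \<psi>)" by (cases q)
    define g' where "g' = 2 * cos \<eta> * (- sin \<eta>) * F1 ((cos \<eta>)\<^sup>2, (sin \<eta>)\<^sup>2) + 2 * sin \<eta> * cos \<eta> * F2 ((cos \<eta>)\<^sup>2, (sin \<eta>)\<^sup>2)"
    have dg: "(g has_real_derivative g') (at \<eta>)"
      unfolding g_def g'_def by (rule DERIV_F[where x = "\<lambda>\<eta>. (cos \<eta>)\<^sup>2" and y = "\<lambda>\<eta>. (sin \<eta>)\<^sup>2", OF _ _ cos_sin_squared_nonzero]) (auto intro!: derivative_eq_intros)
    define r where "r \<eta> = 1 / sqrt (g \<eta>)" for \<eta>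
    \<comment> \<open>The existence of \<open>r'\<close> is enough: its value cancels in
      \<open>B A' - A B' = - r^2\<close>.\<close>
    have "\<exists>r'. (r has_real_derivative r') (at \<eta>)"
      unfolding r_def using g[of \<eta>] by (intro exI) (rule derivative_eq_intros dg refl | simp)+
    then obtain r' where dr: "(r has_real_derivative r') (at \<eta>)" by blast
    have dA: "(A has_real_derivative (r' * cos \<eta> - r \<eta> * sin \<eta>)) (at \<eta>)"
      and dB: "(B has_real_derivative (r' * sin \<eta> + r \<eta> * cos \<eta>)) (at \<eta>)"
    proof -
      have "A = (\<lambda>\<eta>. r \<eta> * cos \<eta>)" "B = (\<lambda>\<eta>. r \<eta> * sin \<eta>)" by (auto simp: A_def B_def r_def)
      then show "(A has_real_derivative (r' * cos \<eta> - r \<eta> * sin \<eta>)) (at \<eta>)"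
        "(B has_real_derivative (r' * sin \<eta> + r \<eta> * cos \<eta>)) (at \<eta>)"
        by (auto intro!: derivative_eq_intros dr)
    qed
    have AB: "A \<eta> = r \<eta> * cos \<eta>" "B \<eta> = r \<eta> * sin \<eta>" by (auto simp: A_def B_def r_def)
    have "wedge12 lambda0 (ext_deriv lambda0) (?\<Phi> q) (frechet_derivative ?\<Phi> (at q) (1, 0, 0))
        (frechet_derivative ?\<Phi> (at q) (0, 1, 0)) (frechet_derivative ?\<Phi> (at q) (0, 0, 1))
      = A \<eta> * B \<eta> * (B \<eta> * (r' * cos \<eta> - r \<eta> * sin \<eta>) - A \<eta> * (r' * sin \<eta> + r \<eta> * cos \<eta>)) / 2"
      unfolding \<Phi> q by (rule wedge_lambda0_torus_coordinates) (simp_all add: frechet_derivative_torus_coordinates[OF dA dB])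
    also have "\<dots> = - ((r \<eta>)\<^sup>2)\<^sup>2 * (sin \<eta> * cos \<eta>) / 2"
      unfolding AB using sin_cos_squared_add[of \<eta>] by algebra
    also have "(r \<eta>)\<^sup>2 = 1 / g \<eta>" using g[of \<eta>] by (simp add: r_def power_divide)
    finally have X: "wedge12 lambda0 (ext_deriv lambda0) (?\<Phi> q) (frechet_derivative ?\<Phi> (at q) (1, 0, 0))
        (frechet_derivative ?\<Phi> (at q) (0, 1, 0)) (frechet_derivative ?\<Phi> (at q) (0, 0, 1))
      = - (1 / g \<eta>)\<^sup>2 * (sin \<eta> * cos \<eta>) / 2" .
    show ?thesis unfolding Let_def X by (simp add: q abs_mult power_divide)
  qed
  define f where "f \<eta> = \<bar>sin \<eta> * cos \<eta>\<bar> / (2 * (g \<eta>)\<^sup>2)" for \<eta>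
  have cf: "continuous_on S f" for S
    unfolding f_def g_def using g[unfolded g_def] by (intro continuous_intros) (simp_all add: less_imp_neq[THEN not_sym])
  have cff: "continuous_on S (\<lambda>q. f (fst q))" for S :: "(real \<times> real \<times> real) set"
    by (rule continuous_on_compose2[OF cf[of UNIV]]) (auto intro!: continuous_intros)
  have box: "({0..pi/2} \<times> {0..2*pi} \<times> {0..2*pi}) = cbox (0, 0, 0) (pi/2, 2*pi, 2*pi)"
    by (simp add: cbox_Pair_eq)
  have "contact_volume M lambda0 = (LINT q:cbox (0, 0, 0) (pi/2, 2*pi, 2*pi)|lborel. f (fst q))"
    unfolding contact_volume_def Let_def[of "radial_point M \<circ> sphere_param"] integrand f_def box ..
  also have "\<dots> = integral (cbox (0, 0, 0) (pi/2, 2*pi, 2*pi)) (\<lambda>q. f (fst q))"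
    by (intro set_borel_integral_eq_integral) (unfold set_integrable_def, intro borel_integrable_compact cff compact_cbox)
  also have "\<dots> = integral {0..pi/2} (\<lambda>\<eta>. 4 * pi\<^sup>2 * f \<eta>)"
    unfolding integral_prod_continuous[OF cff] by (simp add: content_Pair power2_eq_square)
  also have "\<dots> = 4 * pi\<^sup>2 * integral {0..pi/2} f"
    by simp
  also have "integral {0..pi/2} f = L / 4"
  proof -
    have "((\<lambda>\<eta>. (2 * sin \<eta> * cos \<eta>) *\<^sub>R (1 / (F (1 - (sin \<eta>)\<^sup>2, (sin \<eta>)\<^sup>2))\<^sup>2)) has_integral
       integral {(sin 0)\<^sup>2..(sin (pi/2))\<^sup>2} (\<lambda>t. 1 / (F (1 - t, t))\<^sup>2)) {0..pi/2}"
    proof (rule has_integral_substitution)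
      show "continuous_on {0..1} (\<lambda>t. 1 / (F (1 - t, t))\<^sup>2)"
        using F_segment_pos by (intro continuous_intros) (simp_all add: less_imp_neq[THEN not_sym])
      show "(\<lambda>\<eta>. (sin \<eta>)\<^sup>2) ` {0..pi/2} \<subseteq> {0..1}" by (auto simp: abs_square_le_1)
      show "((\<lambda>\<eta>. (sin \<eta>)\<^sup>2) has_real_derivative 2 * sin \<eta> * cos \<eta>) (at \<eta> within {0..pi/2})" for \<eta>
        by (auto intro!: derivative_eq_intros)
    qed simp_all
    then have I: "((\<lambda>\<eta>. (2 * sin \<eta> * cos \<eta>) * (1 / (F (1 - (sin \<eta>)\<^sup>2, (sin \<eta>)\<^sup>2))\<^sup>2) / 4) has_integral L / 4) {0..pi/2}"
      by (intro has_integral_divide) (simp add: L_def)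
    have E: "(2 * sin \<eta> * cos \<eta>) * (1 / (F (1 - (sin \<eta>)\<^sup>2, (sin \<eta>)\<^sup>2))\<^sup>2) / 4 = f \<eta>" if "\<eta> \<in> {0..pi/2}" for \<eta>
    proof -
      have "sin \<eta> \<ge> 0" "cos \<eta> \<ge> 0" using that by (auto intro!: sin_ge_zero cos_ge_zero)
      then show ?thesis unfolding f_def g_def by (simp add: cos_squared_eq abs_mult)
    qed
    show ?thesis by (rule integral_unique[OF has_integral_eq[OF E I]])
  qed
  finally show ?thesis by simp
qed

text \<open>With \<open>f t = F (1 - t, t)\<close>, Euler's identity gives
  \<open>f + (1 - t) f' = F2\<close>. So the integrand is the derivative of
  \<open>- (1 - t) / f\<close>, which rises from \<open>- 1 / F (1, 0)\<close> to 0.\<close>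

lemma mean_F2: "((\<lambda>t. F2 (1 - t, t) / (F (1 - t, t))\<^sup>2) has_integral 1 / F (1, 0)) {0..1}"
proof -
  have "((\<lambda>t. F2 (1 - t, t) / (F (1 - t, t))\<^sup>2) has_integral - ((1 - 1) / F (1 - 1, 1)) - - ((1 - 0) / F (1 - 0, 0))) {0..1}"
  proof (rule fundamental_theorem_of_calculus)
    fix t :: real
    let ?f = "F (1 - t, t)" and ?k = "F1 (1 - t, t)" and ?h = "F2 (1 - t, t)"
    have e: "(1 - t) * ?k + t * ?h = ?f" using euler[OF segment_nonzero[of t]] by simp
    have "((\<lambda>t. F (1 - t, t)) has_real_derivative - 1 * ?k + 1 * ?h) (at t)"
      by (rule DERIV_F[where x = "\<lambda>t. 1 - t" and y = "\<lambda>t. t", OF _ _ segment_nonzero]) (auto intro!: derivative_eq_intros)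
    then have D: "((\<lambda>t. - ((1 - t) / F (1 - t, t))) has_real_derivative - ((- 1 * ?f - (1 - t) * (- 1 * ?k + 1 * ?h)) / (?f * ?f))) (at t)"
      using F_segment_pos[of t] by (intro DERIV_minus DERIV_divide) (auto intro!: derivative_eq_intros)
    have N: "- (- 1 * ?f - (1 - t) * (- 1 * ?k + 1 * ?h)) = ?h"
      unfolding e[symmetric] by (simp add: algebra_simps)
    have "- ((- 1 * ?f - (1 - t) * (- 1 * ?k + 1 * ?h)) / (?f * ?f)) = ?h / ?f\<^sup>2"
      unfolding minus_divide_left N power2_eq_square ..
    with D show "((\<lambda>t. - ((1 - t) / F (1 - t, t))) has_vector_derivative ?h / ?f\<^sup>2) (at t within {0..1})"
      by (simp only: has_real_derivative_iff_has_vector_derivative has_vector_derivative_at_within)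
  qed simp
  then show ?thesis by simp
qed

end

section \<open>Tori of rational slope\<close>

context reinhardt_gauge
begin

lemma L_pos: "L > 0"
proof -
  have c: "continuous_on {0..1} (\<lambda>t. 1 / (F (1 - t, t))\<^sup>2)"
    using F_segment_pos by (intro continuous_intros) (simp_all add: less_imp_neq[THEN not_sym])
  have "L \<ge> 0" unfolding L_def by (intro Henstock_Kurzweil_Integration.integral_nonneg integrable_continuous_real c) simp
  moreover have "L \<noteq> 0"
    unfolding L_def using integral_eq_0_iff[OF c] F_segment_pos[of 0] by (force dest: bspec[of _ _ 0])
  ultimately show ?thesis by simp
qed

lemma F_1_0_pos: "F (1, 0) > 0" and F_0_1_pos: "F (0, 1) > 0"
  using F_segment_pos[of 0] F_segment_pos[of 1] by simp_all

lemma F1_1_0: "F1 (1, 0) = F (1, 0)" and F2_0_1: "F2 (0, 1) = F (0, 1)"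
  using euler[of "(1, 0)"] euler[of "(0, 1)"] by (simp_all add: zero_prod_def)

text \<open>
  For \<open>t = 1\<close> the torus over \<open>t\<close> degenerates to the circle \<open>r\<^sub>1 = 0\<close>, where \<open>F\<^sub>1\<close> is irrelevant.
\<close>

definition rational_slope :: "real \<Rightarrow> real \<Rightarrow> bool" where
  "rational_slope t T \<longleftrightarrow> T > 0 \<and> (t < 1 \<longrightarrow> (\<exists>k::int. F1 (1 - t, t) * T = pi * k)) \<and> (\<exists>l::int. F2 (1 - t, t) * T = pi * l)"

text \<open>The circle \<open>r_2 = 0\<close> has period \<open>pi / F (1, 0)\<close> and makes one
  turn, so its linking number with the orbit over \<open>t\<close> is \<open>F2 T / pi\<close>.
  Multiplied by the volume \<open>pi^2 L\<close> and divided by both periods, \<open>T\<close>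
  cancels.\<close>

lemma rho_circle_torus:
  assumes t: "0 < t" "t \<le> 1" and T: "rational_slope t T"
  shows "ereal (L * F (1, 0) * F2 (1 - t, t)) \<in> (\<lambda>(g1, g2). ereal (rho M lambda0 g1 g2)) ` distinct_orbit_pairs M lambda0"
proof -
  let ?f = "F (1 - t, t)"
  have f: "?f > 0" by (rule F_segment_pos)
  define R where "R = 1 / sqrt (F (1, 0))"
  \<comment> \<open>The point \<open>(1 - t, t)\<close> is scaled to level 1 of \<open>F\<close>;
    the square roots pass from squared radii to radii.\<close>
  define c d where "c = sqrt ((1 - t) / ?f)" and "d = sqrt (t / ?f)"
  have cd: "(c\<^sup>2, d\<^sup>2) = (1 / ?f) *\<^sub>R (1 - t, t)" using t f by (simp add: c_def d_def)
  have d: "d \<noteq> 0" using t f by (simp add: d_def)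
  have R2: "(R\<^sup>2, (0::real)\<^sup>2) = (1 / F (1, 0)) *\<^sub>R (1, 0)" using F_1_0_pos by (simp add: R_def power_divide)
  have inv: "1 / F (1, 0) > 0" "1 / ?f > 0" using F_1_0_pos f by simp_all
  have R: "R \<noteq> 0" using F_1_0_pos by (simp add: R_def)
  have nz: "(1, 0) \<noteq> (0 :: real \<times> real)" by (simp add: zero_prod_def)
  define w1 w2 where "w1 = 2 * F (1, 0)" and "w2 = 2 * F2 (1, 0)"
  define v1 v2 where "v1 = 2 * F1 (1 - t, t)" and "v2 = 2 * F2 (1 - t, t)"
  define T1 where "T1 = pi / F (1, 0)"
  have T1: "T1 > 0" "w1 * T1 = 2 * pi * of_int 1" "w1 \<noteq> 0" using F_1_0_pos by (simp_all add: T1_def w1_def)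
  let ?g1 = "(torus_curve R 0 w1 0 0 w2, T1)" and ?g2 = "(torus_curve c 0 v1 d 0 v2, T)"
  have "periodic_reeb_orbit M lambda0 ?g1"
  proof (rule torus_curve_reeb_orbit)
    show "F (R\<^sup>2, 0\<^sup>2) = 1" unfolding R2 using F_1_0_pos by (subst homogeneous) simp_all
    show "w1 = 2 * F1 (R\<^sup>2, 0\<^sup>2)" "w2 = 2 * F2 (R\<^sup>2, 0\<^sup>2)"
      unfolding R2 w1_def w2_def F1_scaleR[OF inv(1) nz] F2_scaleR[OF inv(1) nz] F1_1_0 by simp_all
    show "\<exists>k::int. w1 * T1 = 2 * pi * k" using T1 by blast
  qed (use T1 in auto)
  moreover have "periodic_reeb_orbit M lambda0 ?g2"
  proof (rule torus_curve_reeb_orbit)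
    show "F (c\<^sup>2, d\<^sup>2) = 1" unfolding cd using f by (subst homogeneous) simp_all
    show "v1 = 2 * F1 (c\<^sup>2, d\<^sup>2)" "v2 = 2 * F2 (c\<^sup>2, d\<^sup>2)"
      unfolding cd v1_def v2_def F1_scaleR[OF inv(2) segment_nonzero] F2_scaleR[OF inv(2) segment_nonzero] by simp_all
    show "\<exists>k::int. v1 * T = 2 * pi * k" if "c \<noteq> 0"
    proof -
      have "t < 1" using that t by (cases "t = 1") (auto simp: c_def)
      then obtain k :: int where "F1 (1 - t, t) * T = pi * k" using T by (auto simp: rational_slope_def)
      then show ?thesis by (intro exI[of _ k]) (simp add: v1_def)
    qed
    obtain l :: int where "F2 (1 - t, t) * T = pi * l" using T by (auto simp: rational_slope_def)
    then show "\<exists>k::int. v2 * T = 2 * pi * k" by (intro exI[of _ l]) (simp add: v2_def)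
  qed (use T in \<open>auto simp: rational_slope_def\<close>)
  moreover have "geom_distinct ?g1 ?g2"
  proof -
    have False if "torus_curve R 0 w1 0 0 w2 s = torus_curve c 0 v1 d 0 v2 s'" for s s'
      using arg_cong[OF that, of radii] d by (simp add: radii_torus_curve)
    then show ?thesis by (auto simp: geom_distinct_def)
  qed
  ultimately have "(?g1, ?g2) \<in> distinct_orbit_pairs M lambda0" by (simp add: distinct_orbit_pairs_def)
  moreover have "rho M lambda0 ?g1 ?g2 = L * F (1, 0) * F2 (1 - t, t)"
  proof -
    have "linking_number ?g1 ?g2 = (w1 * T1) * (v2 * T) / (4 * pi\<^sup>2)"
      using T1 T R d by (intro linking_number_circle_torus) (auto simp: rational_slope_def)
    moreover have "T > 0" using T by (simp add: rational_slope_def)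
    ultimately show ?thesis using F_1_0_pos T1
      by (simp add: rho_def contact_volume_M v2_def T1_def w1_def power2_eq_square)
  qed
  ultimately show ?thesis by force
qed

lemma F_segment_deriv: "((\<lambda>t. F (1 - t, t)) has_real_derivative F2 (1 - t, t) - F1 (1 - t, t)) (at t)"
  by (rule DERIV_cong[OF DERIV_F[where x = "\<lambda>t. 1 - t" and y = "\<lambda>t. t", OF _ _ segment_nonzero]])
    (auto intro!: derivative_eq_intros)

lemma continuous_on_segment_F1: "continuous_on S (\<lambda>t. F1 (1 - t, t))"
  and continuous_on_segment_F2: "continuous_on S (\<lambda>t. F2 (1 - t, t))"
  by (rule continuous_on_compose2[OF continuous_on_F1] continuous_on_compose2[OF continuous_on_F2],
      intro continuous_intros, use segment_nonzero in auto)+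

text \<open>Without rational slopes \<open>F1 / F2\<close> is continuous with irrational values
  only, hence constant on the interval. Euler's identity then makes \<open>F2\<close> itself
  constant, up to the end points by continuity.\<close>

lemma F2_constant_of_irrational_slopes:
  assumes "a < b" and irr: "\<And>t T. t \<in> {a<..<b} \<Longrightarrow> \<not> rational_slope t T"
  shows "F2 (1 - a, a) = F2 (1 - b, b)"
proof -
  let ?k = "\<lambda>t. F1 (1 - t, t)" and ?h = "\<lambda>t. F2 (1 - t, t)" and ?f = "\<lambda>t. F (1 - t, t)"
  have e: "(1 - t) * ?k t + t * ?h t = ?f t" for t using euler[OF segment_nonzero[of t]] by simp
  \<comment> \<open>A zero of \<open>F2\<close> would be a rational slope with period
    \<open>pi / |F1|\<close>: the flow then turns in the first plane only.\<close>
  have h0: "?h t \<noteq> 0" if "t \<in> {a<..<b}" for t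
  proof
    assume h: "?h t = 0"
    then have k: "?k t \<noteq> 0" using e[of t] F_segment_pos[of t] by auto
    have kk: "?k t * (pi / \<bar>?k t\<bar>) = pi * of_int (if ?k t > 0 then 1 else -1)" using k by (auto simp: abs_if)
    have "\<exists>l::int. ?h t * (pi / \<bar>?k t\<bar>) = pi * l" using h by (intro exI[of _ 0]) simp
    then have "rational_slope t (pi / \<bar>?k t\<bar>)"
      unfolding rational_slope_def using k exI[where P = "\<lambda>l::int. ?k t * (pi / \<bar>?k t\<bar>) = pi * l", OF kk] by simp
    then show False using irr[OF that] by blast
  qed
  have irrational: "?k t / ?h t \<notin> \<rat>" if "t \<in> {a<..<b}" for t
  proof
    assume "?k t / ?h t \<in> \<rat>"
    then obtain p q :: int where q: "q > 0" "?k t / ?h t = of_int p / of_int q" by (rule Rats_cases') (auto)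
    have h: "?h t \<noteq> 0" by (rule h0[OF that])
    \<comment> \<open>\<open>s\<close> moves the sign of \<open>F2\<close> into the turn counts, so
      that the period \<open>pi q / |F2|\<close> is positive.\<close>
    define s :: int where "s = (if ?h t > 0 then 1 else -1)"
    have s: "?h t = of_int s * \<bar>?h t\<bar>" by (auto simp: s_def)
    have "?k t = ?h t * (of_int p / of_int q)" using q h by (simp add: field_simps)
    then have "?k t * (pi * of_int q / \<bar>?h t\<bar>) = pi * of_int (s * p)"
      using q(1) h s by (simp add: field_simps)
    moreover have "?h t * (pi * of_int q / \<bar>?h t\<bar>) = pi * of_int (s * q)"
      using h s by (simp add: field_simps)
    ultimately have "rational_slope t (pi * of_int q / \<bar>?h t\<bar>)"
      unfolding rational_slope_def using q(1) h by (intro conjI impI) (simp, blast, blast)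
    then show False using irr[OF that] by blast
  qed
  have cont: "continuous_on {a<..<b} (\<lambda>t. ?k t / ?h t)"
    using h0 by (intro continuous_intros continuous_on_segment_F1 continuous_on_segment_F2) auto
  have ratio: "?k s / ?h s = ?k t / ?h t" if st: "s \<in> {a<..<b}" "t \<in> {a<..<b}" for s t
  proof (rule ccontr)
    assume ne: "?k s / ?h s \<noteq> ?k t / ?h t"
    have con: "connected ((\<lambda>t. ?k t / ?h t) ` {a<..<b})" by (intro connected_continuous_image cont) simp
    obtain u v where uv: "u \<in> {a<..<b}" "v \<in> {a<..<b}" "?k u / ?h u < ?k v / ?h v"
      using ne st by (cases "?k s / ?h s < ?k t / ?h t") force+
    then obtain r where r: "r \<in> \<rat>" "?k u / ?h u < r" "r < ?k v / ?h v"
      using Rats_dense_in_real by blast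
    have "r \<in> (\<lambda>t. ?k t / ?h t) ` {a<..<b}"
      by (rule connectedD_interval[OF con imageI[OF uv(1)] imageI[OF uv(2)]]) (use r in auto)
    then show False using irrational r(1) by auto
  qed
  define m where "m = ?k ((a + b) / 2) / ?h ((a + b) / 2)"
  have km: "?k t = m * ?h t" if "t \<in> {a<..<b}" for t
    using ratio[OF that, of "(a + b) / 2"] h0[OF that] \<open>a < b\<close> by (simp add: m_def field_simps)
  \<comment> \<open>With \<open>F1 = m F2\<close>, Euler's identity reads \<open>F = F2 D\<close>.
    So \<open>F2 = F / D\<close>, and this quotient has derivative zero.\<close>
  define D where "D t = (1 - t) * m + t" for t
  have fD: "?f t = ?h t * D t" if "t \<in> {a<..<b}" for t
    using e[of t] km[OF that] by (simp add: D_def algebra_simps)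
  have D0: "D t \<noteq> 0" if "t \<in> {a<..<b}" for t
    using fD[OF that] F_segment_pos[of t] by auto
  have dz: "((\<lambda>t. ?f t / D t) has_real_derivative 0) (at t)" if "t \<in> {a<..<b}" for t
  proof -
    have dD: "(D has_real_derivative 1 - m) (at t)" unfolding D_def by (auto intro!: derivative_eq_intros)
    have "((\<lambda>t. ?f t / D t) has_real_derivative ((?h t - ?k t) * D t - ?f t * (1 - m)) / (D t * D t)) (at t)"
      by (intro DERIV_divide F_segment_deriv dD D0 that)
    moreover have "(?h t - ?k t) * D t - ?f t * (1 - m) = 0"
      unfolding fD[OF that] km[OF that] by (simp add: algebra_simps)
    ultimately show ?thesis by simp
  qed
  have "\<exists>h1. \<forall>t\<in>{a<..<b}. ?f t / D t = h1"
    by (rule has_field_derivative_zero_constant) (simp, rule has_field_derivative_at_within[OF dz])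
  then obtain h1 where h1: "\<And>t. t \<in> {a<..<b} \<Longrightarrow> ?f t / D t = h1" by blast
  have hc: "?h t = h1" if "t \<in> {a<..<b}" for t
    using h1[OF that] fD[OF that] D0[OF that] by simp
  have cl: "closure {a<..<b} = {a..b}" using \<open>a < b\<close> by simp
  have "?h t = h1" if "t \<in> {a..b}" for t
    by (rule continuous_constant_on_closure[where S = "{a<..<b}" and f = ?h]) (use hc cl that continuous_on_segment_F2 in auto)
  then show ?thesis using \<open>a < b\<close> by simp
qed

text \<open>\<open>\<sigma>\<close> treats both signs at once. If the inequality holds at
  \<open>t = 1\<close>, the circle \<open>r_1 = 0\<close> serves. Otherwise let \<open>t1\<close> be
  the first zero of \<open>G\<close> after \<open>t0\<close>: \<open>F2\<close> is not constant
  between them, so some slope there is rational, and \<open>G\<close> is still positive.\<close>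

lemma rational_slope_above:
  assumes \<sigma>: "\<sigma> \<noteq> 0" and t0: "0 < t0" "t0 < 1" "\<sigma> * (F2 (1 - t0, t0) - c) > 0"
  shows "\<exists>t T. 0 < t \<and> t \<le> 1 \<and> rational_slope t T \<and> \<sigma> * (F2 (1 - t, t) - c) > 0"
proof (cases "\<sigma> * (F2 (0, 1) - c) > 0")
  case True
  have "F2 (0, 1) * (pi / F (0, 1)) = pi * of_int 1" using F2_0_1 F_0_1_pos by simp
  then have "rational_slope 1 (pi / F (0, 1))"
    unfolding rational_slope_def using F_0_1_pos by (intro conjI impI) (simp, simp, auto)
  then have "0 < (1::real) \<and> (1::real) \<le> 1 \<and> rational_slope 1 (pi / F (0, 1)) \<and> \<sigma> * (F2 (1 - 1, 1) - c) > 0"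
    using True by simp
  then show ?thesis by blast
next
  case False
  define G where "G t = \<sigma> * (F2 (1 - t, t) - c)" for t
  have cG: "continuous_on S G" for S unfolding G_def by (intro continuous_intros continuous_on_segment_F2)
  define Z where "Z = {t \<in> {t0..1}. G t = 0}"
  have "\<exists>t\<ge>t0. t \<le> 1 \<and> G t = 0"
    by (rule IVT2') (use t0 False in \<open>auto simp: G_def[of t0] G_def[of 1] cG\<close>)
  then have "Z \<noteq> {}" by (auto simp: Z_def)
  have "closed Z" unfolding Z_def by (intro continuous_closed_preimage_constant cG) simp
  moreover have "bounded Z" by (rule bounded_subset[of "{t0..1}"]) (auto simp: Z_def)
  ultimately have "compact Z" by (simp add: compact_eq_bounded_closed)
  from compact_attains_inf[OF this \<open>Z \<noteq> {}\<close>]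
  obtain t1 where t1: "t1 \<in> Z" "\<And>t. t \<in> Z \<Longrightarrow> t1 \<le> t" by blast
  have "t0 < t1" using t1(1) t0 by (cases "t1 = t0") (auto simp: Z_def G_def)
  have "t1 \<le> 1" using t1(1) by (simp add: Z_def)
  have pos: "G t > 0" if t: "t \<in> {t0..<t1}" for t
  proof (rule ccontr)
    assume "\<not> G t > 0"
    then have "\<exists>s\<ge>t0. s \<le> t \<and> G s = 0"
      by (intro IVT2') (use t0 t in \<open>auto simp: G_def[of t0] cG\<close>)
    then obtain s where "s \<in> Z" "s \<le> t" using t \<open>t1 \<le> 1\<close> by (auto simp: Z_def)
    then show False using t1(2) t by fastforce
  qed
  have "F2 (1 - t0, t0) \<noteq> F2 (1 - t1, t1)" using t1(1) t0 by (auto simp: Z_def G_def)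
  then obtain t T where "t \<in> {t0<..<t1}" "rational_slope t T"
    using F2_constant_of_irrational_slopes[OF \<open>t0 < t1\<close>] by blast
  moreover from this have "0 < t \<and> t \<le> 1 \<and> G t > 0" using pos[of t] t0 \<open>t1 \<le> 1\<close> by auto
  ultimately show ?thesis unfolding G_def by blast
qed

section \<open>The mean value argument and the equality case\<close>

text \<open>By \<open>mean_F2\<close>, \<open>c\<close> is the mean of \<open>F2\<close> for the
  weight \<open>1 / F^2\<close>. If \<open>F2\<close> stayed weakly on one side of \<open>c\<close>,
  the integral of a continuous function of one sign would vanish, and \<open>F2\<close> would equal
  \<open>c\<close> throughout.\<close>

lemma mean_value_crossing:
  defines "c \<equiv> 1 / (L * F (1, 0))"
  assumes \<sigma>: "\<sigma> \<noteq> 0" and t: "t \<in> {0..1}" "F2 (1 - t, t) \<noteq> c"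
  shows "\<exists>t. 0 < t \<and> t < 1 \<and> \<sigma> * (F2 (1 - t, t) - c) > 0"
proof (rule ccontr)
  assume "\<not> ?thesis"
  then have le: "\<sigma> * (F2 (1 - t, t) - c) \<le> 0" if "t \<in> {0<..<1}" for t
    using that by (meson greaterThanLessThan_iff not_le)
  have le: "\<sigma> * (F2 (1 - t, t) - c) \<le> 0" if "t \<in> {0..1}" for t
    by (rule continuous_le_on_closure[of "{0<..<1}" "\<lambda>t. \<sigma> * (F2 (1 - t, t) - c)"])
      (use le that in \<open>auto intro!: continuous_intros continuous_on_segment_F2\<close>)
  let ?g = "\<lambda>t. - (\<sigma> * (F2 (1 - t, t) - c)) / (F (1 - t, t))\<^sup>2"
  have cg: "continuous_on {0..1} ?g"
    using F_segment_pos by (intro continuous_intros continuous_on_segment_F2) (simp_all add: less_imp_neq[THEN not_sym])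
  have "((\<lambda>t. 1 / (F (1 - t, t))\<^sup>2) has_integral L) {0..1}"
    unfolding L_def using F_segment_pos
    by (intro integrable_integral integrable_continuous_real continuous_intros) (simp_all add: less_imp_neq[THEN not_sym])
  from has_integral_diff[OF mean_F2 has_integral_mult_right[OF this, of c], THEN has_integral_mult_right, of "- \<sigma>"]
  have "(?g has_integral (- \<sigma> * (1 / F (1, 0) - c * L))) {0..1}"
    by (simp add: algebra_simps diff_divide_distrib)
  moreover have "- \<sigma> * (1 / F (1, 0) - c * L) = 0" using L_pos F_1_0_pos by (simp add: c_def)
  ultimately have "integral {0..1} ?g = 0" by (simp only: integral_unique)
  moreover have "0 \<le> ?g s" if "s \<in> {0..1}" for s
    using le[OF that] by (intro divide_nonneg_nonneg) simp_all
  ultimately have "\<forall>s\<in>{0..1}. ?g s = 0" using integral_eq_0_iff[OF cg] by simp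
  then have "?g t = 0" using t(1) by blast
  then show False using t(2) \<sigma> F_segment_pos[of t] by simp
qed

text \<open>By homogeneity \<open>F2 = c\<close> on the quadrant away from the origin; for
  \<open>a > 0\<close>, integrating along the second variable from \<open>(a, 0)\<close> gives the
  linear formula.\<close>

lemma F_linear_of_constant_F2:
  assumes c: "\<And>t. t \<in> {0..1} \<Longrightarrow> F2 (1 - t, t) = c" and "0 \<le> a" "0 \<le> b"
  shows "F (a, b) = F (1, 0) * a + F (0, 1) * b"
proof (cases "a = 0")
  case True
  then show ?thesis using homogeneous[of b "(0, 1)"] assms by simp
next
  case False
  then have a: "a > 0" using assms by simp
  have c1: "F (0, 1) = c" using c[of 1] F2_0_1 by simp
  have F2c: "F2 (a, y) = c" if "y \<in> {0..b}" for y
  proof -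
    have "(a, y) = (a + y) *\<^sub>R (1 - y / (a + y), y / (a + y))" using a that by (simp add: field_simps)
    then have "F2 (a, y) = F2 (1 - y / (a + y), y / (a + y))"
      using F2_scaleR[OF _ segment_nonzero, of "a + y" "y / (a + y)"] a that by simp
    also have "\<dots> = c" using a that by (intro c) (auto simp: field_simps)
    finally show ?thesis .
  qed
  have "((\<lambda>y. F (a, y) - c * y) has_real_derivative 0) (at y within {0..b})" if "y \<in> {0..b}" for y
  proof -
    have "((\<lambda>y. F (a, y)) has_real_derivative 0 * F1 (a, y) + 1 * F2 (a, y)) (at y)"
      by (rule DERIV_F) (use a in \<open>auto simp: zero_prod_def\<close>)
    then have "((\<lambda>y. F (a, y) - c * y) has_real_derivative c - c) (at y)"
      using F2c[OF that] by (auto intro!: derivative_eq_intros)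
    then show ?thesis by (simp add: has_field_derivative_at_within)
  qed
  then obtain k where "\<And>y. y \<in> {0..b} \<Longrightarrow> F (a, y) - c * y = k"
    using has_field_derivative_zero_constant[of "{0..b}" "\<lambda>y. F (a, y) - c * y"] by auto
  from this[of 0] this[of b] have "F (a, b) = F (a, 0) + c * b" using assms by simp
  moreover have "F (a, 0) = a * F (1, 0)" using homogeneous[of a "(1, 0)"] assms by simp
  ultimately show ?thesis by (simp add: c1)
qed

text \<open>If \<open>F2\<close> were constantly \<open>c\<close>, then \<open>F\<close> would be
  linear on the quadrant. Otherwise \<open>F2\<close> crosses \<open>c\<close> in both directions,
  and \<open>rho\<close>, being \<open>F2 / c\<close> on the pairs of
  \<open>rho_circle_torus\<close>, crosses 1.\<close>

lemma rho_strict_if_not_ellipsoid: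
  assumes "\<not> is_ellipsoid (reinhardt F)"
  shows "rho_minus M lambda0 < 1" and "1 < rho_plus M lambda0"
proof -
  define c where "c = 1 / (L * F (1, 0))"
  have "\<exists>t\<in>{0..1}. F2 (1 - t, t) \<noteq> c"
  proof (rule ccontr)
    assume "\<not> ?thesis"
    then have lin: "F (a, b) = F (1, 0) * a + F (0, 1) * b" if "0 \<le> a" "0 \<le> b" for a b
      using that by (intro F_linear_of_constant_F2[of c]) auto
    have "reinhardt F = {p. F (1, 0) * ((p$1)\<^sup>2 + (p$2)\<^sup>2) + F (0, 1) * ((p$3)\<^sup>2 + (p$4)\<^sup>2) \<le> 1}"
      unfolding reinhardt_def by (rule Collect_cong, subst lin) simp_all
    then show False using assms F_1_0_pos F_0_1_pos unfolding is_ellipsoid_def by blast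
  qed
  then obtain t where t: "t \<in> {0..1}" "F2 (1 - t, t) \<noteq> c" by blast
  have c: "L * F (1, 0) * c = 1" "L * F (1, 0) > 0" using L_pos F_1_0_pos by (simp_all add: c_def)
  let ?R = "(\<lambda>(g1, g2). ereal (rho M lambda0 g1 g2)) ` distinct_orbit_pairs M lambda0"
  have ex: "\<exists>x. ereal x \<in> ?R \<and> \<sigma> * (x - 1) > 0"
    if \<sigma>: "\<sigma> \<noteq> 0" for \<sigma>
  proof -
    obtain t0 where "0 < t0" "t0 < 1" "\<sigma> * (F2 (1 - t0, t0) - c) > 0"
      using mean_value_crossing[OF \<sigma> t[unfolded c_def]] unfolding c_def by blast
    from rational_slope_above[OF \<sigma> this] obtain s T where
      s: "0 < s" "s \<le> 1" "rational_slope s T" "\<sigma> * (F2 (1 - s, s) - c) > 0" by blast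
    have "\<sigma> * (L * F (1, 0) * F2 (1 - s, s) - 1) = L * F (1, 0) * (\<sigma> * (F2 (1 - s, s) - c))"
      using c(1) by algebra
    also have "\<dots> > 0" using c(2) s(4) by (rule mult_pos_pos)
    finally show ?thesis using rho_circle_torus[OF s(1-3)] by blast
  qed
  obtain x where x: "ereal x \<in> ?R" "- 1 * (x - 1) > 0" using ex[of "- 1"] by (simp, blast)
  obtain y where y: "ereal y \<in> ?R" "1 * (y - 1) > 0" using ex[of 1] by (simp, blast)
  from x(2) y(2) have xy: "x < 1" "1 < y" by simp_all
  have "rho_minus M lambda0 \<le> ereal x" unfolding rho_minus_def by (rule Inf_lower[OF x(1)])
  also have "ereal x < 1" using xy(1) by (simp add: one_ereal_def)
  finally show "rho_minus M lambda0 < 1" .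
  have "1 < ereal y" using xy(2) by (simp add: one_ereal_def)
  also have "ereal y \<le> rho_plus M lambda0" unfolding rho_plus_def by (rule Sup_upper[OF y(1)])
  finally show "1 < rho_plus M lambda0" .
qed

end

section \<open>Ellipsoids\<close>

lemma polar_nonneg:
  obtains a p :: real where "a \<ge> 0" "x = a * cos p" "y = a * sin p"
proof -
  obtain r q where r: "x = r * cos q" "y = r * sin q" using polar_Ex by blast
  show thesis
  proof (cases "r \<ge> 0")
    case False
    then show thesis using that[of "- r" "q + pi"] r by simp
  qed (use that r in blast)
qed

text \<open>Rotating \<open>(x, y)\<close> back by the angle \<open>w t\<close> gives the vector
  \<open>(u, v)\<close>, which is constant; its polar form supplies amplitude and phase.\<close>

lemma harmonic_oscillator:
  fixes x y :: "real \<Rightarrow> real"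
  assumes dx: "\<And>t. (x has_real_derivative - w * y t) (at t)"
    and dy: "\<And>t. (y has_real_derivative w * x t) (at t)"
  obtains a p where "a \<ge> 0" "\<And>t. x t = a * cos (w * t + p)" "\<And>t. y t = a * sin (w * t + p)"
proof -
  define u where "u t = x t * cos (w * t) + y t * sin (w * t)" for t
  define v where "v t = y t * cos (w * t) - x t * sin (w * t)" for t
  have "(u has_real_derivative 0) (at t)" "(v has_real_derivative 0) (at t)" for t
    unfolding u_def v_def by (rule derivative_eq_intros dx dy refl | simp add: algebra_simps)+
  then have "u t = u 0" "v t = v 0" for t
    using DERIV_isconst_all[of u] DERIV_isconst_all[of v] by blast+
  then have uv: "x t * cos (w * t) + y t * sin (w * t) = x 0" "y t * cos (w * t) - x t * sin (w * t) = y 0" for t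
    by (simp_all add: u_def v_def)
  obtain a p where a: "a \<ge> 0" "x 0 = a * cos p" "y 0 = a * sin p" by (rule polar_nonneg)
  have "x t = a * cos (w * t + p)" "y t = a * sin (w * t + p)" for t
    unfolding cos_add sin_add using uv[of t] a sin_cos_squared_add[of "w * t"] by algebra+
  with a(1) show thesis by (rule that)
qed

context reinhardt_gauge
begin

text \<open>The domain determines \<open>F\<close> on the quadrant: two positive homogeneous
  functions with the same sublevel set at 1 agree, as scaling a point to level 1 of either function
  shows.\<close>

lemma ellipsoid_F:
  assumes E: "reinhardt F = {p. \<alpha> * ((p$1)\<^sup>2 + (p$2)\<^sup>2) + \<beta> * ((p$3)\<^sup>2 + (p$4)\<^sup>2) \<le> 1}"
    and \<alpha>: "\<alpha> > 0" "\<beta> > 0" and ab: "0 \<le> a" "0 \<le> b"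
  shows "F (a, b) = \<alpha> * a + \<beta> * b"
proof (cases "(a, b) = 0")
  case True
  then show ?thesis using F_0 by (simp add: zero_prod_def)
next
  case False
  have le: "F (x, y) \<le> 1 \<longleftrightarrow> \<alpha> * x + \<beta> * y \<le> 1" if "0 \<le> x" "0 \<le> y" for x y
  proof -
    have "(vector [sqrt x, 0, sqrt y, 0] :: real ^ 4) \<in> reinhardt F \<longleftrightarrow> F (x, y) \<le> 1"
      using that by (simp add: reinhardt_def)
    moreover have "(vector [sqrt x, 0, sqrt y, 0] :: real ^ 4) \<in> reinhardt F \<longleftrightarrow> \<alpha> * x + \<beta> * y \<le> 1"
      unfolding E using that by simp
    ultimately show ?thesis by simp
  qed
  have m: "F (a, b) > 0" using pos False by blast
  have n: "\<alpha> * a + \<beta> * b > 0"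
    using False ab \<alpha> by (cases "a = 0") (auto simp: zero_prod_def add_pos_nonneg)
  have sc: "F (s * a, s * b) = s * F (a, b)" if "s \<ge> 0" for s
    using homogeneous[OF that, of "(a, b)"] by simp
  have "F (1 / F (a, b) * a, 1 / F (a, b) * b) = 1 / F (a, b) * F (a, b)" using m by (intro sc) simp
  then have "\<alpha> * (1 / F (a, b) * a) + \<beta> * (1 / F (a, b) * b) \<le> 1"
    using m ab le[of "1 / F (a, b) * a" "1 / F (a, b) * b"] by simp
  then have 1: "\<alpha> * a + \<beta> * b \<le> F (a, b)" using m by (simp add: field_simps)
  define N where "N = \<alpha> * a + \<beta> * b"
  have "\<alpha> * (1 / N * a) + \<beta> * (1 / N * b) = N / N"
    by (simp add: N_def flip: add_divide_distrib)
  then have "F (1 / N * a, 1 / N * b) \<le> 1"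
    using n ab le[of "1 / N * a" "1 / N * b"] by (simp add: N_def)
  moreover have "F (1 / N * a, 1 / N * b) = 1 / N * F (a, b)" using n by (intro sc) (simp add: N_def)
  ultimately have "1 / N * F (a, b) \<le> 1" by (simp only:)
  moreover have "N > 0" using n by (simp add: N_def)
  ultimately have "F (a, b) \<le> N" by (simp add: field_simps)
  with 1 show ?thesis by (simp add: N_def)
qed

text \<open>The converse of \<open>tangent_vector_M\<close> on an ellipsoid. The line
  \<open>p + t v\<close> has value \<open>1 + t^2 N\<close> under the quadratic form, the cross term
  being zero, so dividing by its square root gives a curve in \<open>M\<close> with velocity
  \<open>v\<close>.\<close>

lemma ellipsoid_tangent_vector:
  assumes M: "M = {p. \<alpha> * ((p$1)\<^sup>2 + (p$2)\<^sup>2) + \<beta> * ((p$3)\<^sup>2 + (p$4)\<^sup>2) = 1}"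
    and \<alpha>: "\<alpha> > 0" "\<beta> > 0" and p: "p \<in> M"
    and v: "\<alpha> * (p$1 * v$1 + p$2 * v$2) + \<beta> * (p$3 * v$3 + p$4 * v$4) = 0"
  shows "v \<in> tangent_vectors M p"
proof -
  define N where "N = \<alpha> * ((v$1)\<^sup>2 + (v$2)\<^sup>2) + \<beta> * ((v$3)\<^sup>2 + (v$4)\<^sup>2)"
  have N: "N \<ge> 0" unfolding N_def using \<alpha> by simp
  define g where "g t = 1 / sqrt (1 + t\<^sup>2 * N)" for t
  have pos: "1 + t\<^sup>2 * N > 0" for t using N by (intro add_pos_nonneg) auto
  have "g t *\<^sub>R (p + t *\<^sub>R v) \<in> M" for t
  proof -
    have "(g t)\<^sup>2 * (1 + t\<^sup>2 * N) = 1" using pos[of t] by (simp add: g_def power_divide)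
    moreover have "\<alpha> * ((p$1)\<^sup>2 + (p$2)\<^sup>2) + \<beta> * ((p$3)\<^sup>2 + (p$4)\<^sup>2) = 1" using p by (simp add: M)
    ultimately have "\<alpha> * ((g t * (p$1 + t * v$1))\<^sup>2 + (g t * (p$2 + t * v$2))\<^sup>2)
       + \<beta> * ((g t * (p$3 + t * v$3))\<^sup>2 + (g t * (p$4 + t * v$4))\<^sup>2) = 1"
      using v unfolding N_def by algebra
    then show ?thesis by (simp add: M)
  qed
  moreover have "((\<lambda>t. g t *\<^sub>R (p + t *\<^sub>R v)) has_vector_derivative g 0 *\<^sub>R v + 0 *\<^sub>R (p + 0 *\<^sub>R v)) (at 0)"
  proof (rule has_vector_derivative_scaleR)
    have "((\<lambda>t. 1 + t\<^sup>2 * N) has_real_derivative 0) (at 0)" by (auto intro!: derivative_eq_intros)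
    then show "(g has_real_derivative 0) (at 0)"
      unfolding g_def by (auto intro!: derivative_eq_intros)
    show "((\<lambda>t. p + t *\<^sub>R v) has_vector_derivative v) (at 0)" by (auto intro!: derivative_eq_intros)
  qed
  ultimately show ?thesis
    unfolding tangent_vectors_def by (intro CollectI exI[of _ "\<lambda>t. g t *\<^sub>R (p + t *\<^sub>R v)"] exI[of _ 1]) (auto simp: g_def)
qed

text \<open>Uniqueness of the Reeb vector. Subtracting \<open>k p\<close> makes any \<open>w\<close>
  tangent, and the symplectic form of \<open>X\<close> and \<open>p\<close> is \<open>- 2\<close>;
  so its value on \<open>X\<close> and every \<open>w\<close> is known, and the coordinate vectors
  read off \<open>X\<close>.\<close>

lemma ellipsoid_reeb_vector:
  assumes M: "M = {p. \<alpha> * ((p$1)\<^sup>2 + (p$2)\<^sup>2) + \<beta> * ((p$3)\<^sup>2 + (p$4)\<^sup>2) = 1}"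
    and \<alpha>: "\<alpha> > 0" "\<beta> > 0" and p: "p \<in> M" and X: "is_reeb_vector M lambda0 p X"
  shows "X$1 = - (2 * \<alpha>) * p$2" "X$2 = 2 * \<alpha> * p$1" "X$3 = - (2 * \<beta>) * p$4" "X$4 = 2 * \<beta> * p$3"
proof -
  have H: "\<alpha> * ((p$1)\<^sup>2 + (p$2)\<^sup>2) + \<beta> * ((p$3)\<^sup>2 + (p$4)\<^sup>2) = 1" using p by (simp add: M)
  have l: "p$1 * X$2 - p$2 * X$1 + p$3 * X$4 - p$4 * X$3 = 2"
    using X by (simp add: is_reeb_vector_def lambda0_def)
  have key: "X$1 * w$2 - X$2 * w$1 + X$3 * w$4 - X$4 * w$3 = - 2 * (\<alpha> * (p$1 * w$1 + p$2 * w$2) + \<beta> * (p$3 * w$3 + p$4 * w$4))"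
    for w :: "real ^ 4"
  proof -
    define k where "k = \<alpha> * (p$1 * w$1 + p$2 * w$2) + \<beta> * (p$3 * w$3 + p$4 * w$4)"
    define v where "v = w - k *\<^sub>R p"
    have vi: "v $ i = w $ i - k * p $ i" for i by (simp add: v_def)
    have "\<alpha> * (p$1 * v$1 + p$2 * v$2) + \<beta> * (p$3 * v$3 + p$4 * v$4) = 0"
      unfolding vi using H k_def by algebra
    then have "v \<in> tangent_vectors M p" by (rule ellipsoid_tangent_vector[OF M \<alpha> p])
    then have "ext_deriv lambda0 p X v = 0" using X by (simp add: is_reeb_vector_def)
    then show ?thesis unfolding ext_deriv_lambda0 vi k_def[symmetric] using l by algebra
  qed
  show "X$1 = - (2 * \<alpha>) * p$2" using key[of "axis 2 1"] by (simp add: axis_def)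
  show "X$2 = 2 * \<alpha> * p$1" using key[of "axis 1 1"] by (simp add: axis_def)
  show "X$3 = - (2 * \<beta>) * p$4" using key[of "axis 4 1"] by (simp add: axis_def)
  show "X$4 = 2 * \<beta> * p$3" using key[of "axis 3 1"] by (simp add: axis_def)
qed

text \<open>The Reeb flow splits into a harmonic oscillator in each plane, so every orbit is a torus
  curve with speeds \<open>2 \<alpha>\<close> and \<open>2 \<beta>\<close>.\<close>

lemma ellipsoid_orbit:
  assumes M: "M = {p. \<alpha> * ((p$1)\<^sup>2 + (p$2)\<^sup>2) + \<beta> * ((p$3)\<^sup>2 + (p$4)\<^sup>2) = 1}"
    and \<alpha>: "\<alpha> > 0" "\<beta> > 0" and orbit: "periodic_reeb_orbit M lambda0 (\<gamma>, T)"
  obtains a p b q where "a \<ge> 0" "b \<ge> 0" "a \<noteq> 0 \<or> b \<noteq> 0" "\<gamma> = torus_curve a p (2 * \<alpha>) b q (2 * \<beta>)"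
    "a \<noteq> 0 \<Longrightarrow> \<exists>k. 2 * \<alpha> * T = 2 * pi * of_int k" "b \<noteq> 0 \<Longrightarrow> \<exists>k. 2 * \<beta> * T = 2 * pi * of_int k"
proof -
  have per: "\<gamma> (t + T) = \<gamma> t" and inM: "\<gamma> t \<in> M" and ode: "\<exists>X. is_reeb_vector M lambda0 (\<gamma> t) X \<and> (\<gamma> has_vector_derivative X) (at t)" for t
    using orbit by (auto simp: periodic_reeb_orbit_def)
  have d: "((\<lambda>t. \<gamma> t $ 1) has_real_derivative - (2 * \<alpha>) * \<gamma> t $ 2) (at t)"
    "((\<lambda>t. \<gamma> t $ 2) has_real_derivative 2 * \<alpha> * \<gamma> t $ 1) (at t)"
    "((\<lambda>t. \<gamma> t $ 3) has_real_derivative - (2 * \<beta>) * \<gamma> t $ 4) (at t)"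
    "((\<lambda>t. \<gamma> t $ 4) has_real_derivative 2 * \<beta> * \<gamma> t $ 3) (at t)" for t
  proof -
    obtain X where X: "is_reeb_vector M lambda0 (\<gamma> t) X" "(\<gamma> has_vector_derivative X) (at t)" using ode by blast
    have c: "((\<lambda>t. \<gamma> t $ i) has_real_derivative X $ i) (at t)" for i
      using bounded_linear.has_vector_derivative[OF bounded_linear_vec_nth X(2)]
      by (simp add: has_real_derivative_iff_has_vector_derivative)
    note r = ellipsoid_reeb_vector[OF M \<alpha> inM X(1)]
    show "((\<lambda>t. \<gamma> t $ 1) has_real_derivative - (2 * \<alpha>) * \<gamma> t $ 2) (at t)" using c[of 1] unfolding r .
    show "((\<lambda>t. \<gamma> t $ 2) has_real_derivative 2 * \<alpha> * \<gamma> t $ 1) (at t)" using c[of 2] unfolding r .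
    show "((\<lambda>t. \<gamma> t $ 3) has_real_derivative - (2 * \<beta>) * \<gamma> t $ 4) (at t)" using c[of 3] unfolding r .
    show "((\<lambda>t. \<gamma> t $ 4) has_real_derivative 2 * \<beta> * \<gamma> t $ 3) (at t)" using c[of 4] unfolding r .
  qed
  obtain a p where a: "a \<ge> 0" "\<And>t. \<gamma> t $ 1 = a * cos (2 * \<alpha> * t + p)" "\<And>t. \<gamma> t $ 2 = a * sin (2 * \<alpha> * t + p)"
    using harmonic_oscillator[OF d(1,2)] by blast
  obtain b q where b: "b \<ge> 0" "\<And>t. \<gamma> t $ 3 = b * cos (2 * \<beta> * t + q)" "\<And>t. \<gamma> t $ 4 = b * sin (2 * \<beta> * t + q)"
    using harmonic_oscillator[OF d(3,4)] by blast
  have \<gamma>: "\<gamma> = torus_curve a p (2 * \<alpha>) b q (2 * \<beta>)"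
    by (rule ext) (simp add: vector_4_eq_iff torus_curve_def a b)
  have period: "\<exists>k. w * T = 2 * pi * of_int k"
    if "c \<noteq> 0" "c * cos (w * (0 + T) + r) = c * cos (w * 0 + r)" "c * sin (w * (0 + T) + r) = c * sin (w * 0 + r)" for c w r :: real
  proof -
    have "sin (w * T + r) = sin r \<and> cos (w * T + r) = cos r" using that by simp
    then obtain n :: int where "w * T + r = r + 2 * pi * n" using sin_cos_eq_iff by blast
    then show ?thesis by auto
  qed
  have ab: "a \<noteq> 0 \<or> b \<noteq> 0" using inM[of 0] by (auto simp: M a b)
  have "\<exists>k. 2 * \<alpha> * T = 2 * pi * of_int k" if "a \<noteq> 0"
    by (rule period[where r = p, OF that]) (simp_all only: a(2,3)[symmetric] per)
  moreover have "\<exists>k. 2 * \<beta> * T = 2 * pi * of_int k" if "b \<noteq> 0"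
    by (rule period[where r = q, OF that]) (simp_all only: b(2,3)[symmetric] per)
  ultimately show thesis using that[OF a(1) b(1) ab \<gamma>] by blast
qed

text \<open>The volume is \<open>pi^2 / (\<alpha> \<beta>)\<close>, which cancels against the
  linking number \<open>\<alpha> \<beta> T1 T2 / pi^2\<close> and the periods.\<close>

lemma ellipsoid_rho:
  assumes E: "is_ellipsoid (reinhardt F)" and g: "(g1, g2) \<in> distinct_orbit_pairs M lambda0"
  shows "rho M lambda0 g1 g2 = 1"
proof -
  obtain \<alpha> \<beta> where \<alpha>: "\<alpha> > 0" "\<beta> > 0"
    and E: "reinhardt F = {p. \<alpha> * ((p$1)\<^sup>2 + (p$2)\<^sup>2) + \<beta> * ((p$3)\<^sup>2 + (p$4)\<^sup>2) \<le> 1}"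
    using E by (auto simp: is_ellipsoid_def)
  note lin = ellipsoid_F[OF E \<alpha>]
  have M: "M = {p. \<alpha> * ((p$1)\<^sup>2 + (p$2)\<^sup>2) + \<beta> * ((p$3)\<^sup>2 + (p$4)\<^sup>2) = 1}"
    unfolding M_def radii_def by (rule Collect_cong, subst lin) simp_all
  have L: "L = 1 / (\<alpha> * \<beta>)"
  proof -
    define D where "D t = \<alpha> * (1 - t) + \<beta> * t" for t
    have D: "D t > 0" if "t \<in> {0..1}" for t
      unfolding D_def using that \<alpha> by (cases "t = 0") (auto intro: add_nonneg_pos)
    have "((\<lambda>t. 1 / (D t)\<^sup>2) has_integral 1 / (\<alpha> * D 1) - 0 / (\<alpha> * D 0)) {0..1}"
    proof (rule fundamental_theorem_of_calculus)
      fix t :: real assume t: "t \<in> {0..1}"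
      have "((\<lambda>t. t / (\<alpha> * D t)) has_real_derivative (1 * (\<alpha> * D t) - t * (\<alpha> * (\<beta> - \<alpha>))) / (\<alpha> * D t * (\<alpha> * D t))) (at t)"
        using D[OF t] \<alpha> by (intro DERIV_divide DERIV_cmult DERIV_ident) (auto intro!: derivative_eq_intros simp: D_def)
      moreover have "1 * (\<alpha> * D t) - t * (\<alpha> * (\<beta> - \<alpha>)) = \<alpha> * \<alpha>" by (simp add: D_def algebra_simps)
      moreover have "\<alpha> * \<alpha> / (\<alpha> * D t * (\<alpha> * D t)) = 1 / (D t)\<^sup>2" using \<alpha> D[OF t] by (simp add: power2_eq_square)
      ultimately show "((\<lambda>t. t / (\<alpha> * D t)) has_vector_derivative 1 / (D t)\<^sup>2) (at t within {0..1})"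
        by (simp only: has_real_derivative_iff_has_vector_derivative has_vector_derivative_at_within)
    qed simp
    then have "integral {0..1} (\<lambda>t. 1 / (D t)\<^sup>2) = 1 / (\<alpha> * \<beta>)" by (simp add: integral_unique D_def)
    moreover have "L = integral {0..1} (\<lambda>t. 1 / (D t)\<^sup>2)"
      unfolding L_def D_def by (rule Henstock_Kurzweil_Integration.integral_cong) (simp add: lin)
    ultimately show ?thesis by simp
  qed
  obtain \<gamma>1 T1 \<gamma>2 T2 where g12: "g1 = (\<gamma>1, T1)" "g2 = (\<gamma>2, T2)" by (cases g1, cases g2)
  have o1: "periodic_reeb_orbit M lambda0 (\<gamma>1, T1)" and o2: "periodic_reeb_orbit M lambda0 (\<gamma>2, T2)"
    and dist: "range \<gamma>1 \<inter> range \<gamma>2 = {}"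
    using g by (simp_all add: g12 distinct_orbit_pairs_def geom_distinct_def)
  have T: "T1 > 0" "T2 > 0" and inM: "\<gamma>1 s \<in> M" "\<gamma>2 s \<in> M" for s
    using o1 o2 by (simp_all add: periodic_reeb_orbit_def)
  from o1 obtain a p b q where 1: "a \<ge> 0" "b \<ge> 0" "a \<noteq> 0 \<or> b \<noteq> 0" "\<gamma>1 = torus_curve a p (2 * \<alpha>) b q (2 * \<beta>)"
    "a \<noteq> 0 \<Longrightarrow> \<exists>k. 2 * \<alpha> * T1 = 2 * pi * of_int k" "b \<noteq> 0 \<Longrightarrow> \<exists>k. 2 * \<beta> * T1 = 2 * pi * of_int k"
    by (rule ellipsoid_orbit[OF M \<alpha>]) blast
  from o2 obtain a' p' b' q' where 2: "a' \<ge> 0" "b' \<ge> 0" "a' \<noteq> 0 \<or> b' \<noteq> 0" "\<gamma>2 = torus_curve a' p' (2 * \<alpha>) b' q' (2 * \<beta>)"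
    by (rule ellipsoid_orbit[OF M \<alpha>]) blast
  have "linking_number (\<gamma>1, T1) (\<gamma>2, T2) = (2 * \<alpha> * T1) * (2 * \<beta> * T2) / (4 * pi\<^sup>2)"
    unfolding 1(4) 2(4)
  proof (rule linking_number_same_frequencies)
    fix s t x :: real assume x: "x \<in> {0..1}"
    have "(1 - x) *\<^sub>R \<gamma>1 s \<noteq> x *\<^sub>R \<gamma>2 t"
    proof
      assume eq: "(1 - x) *\<^sub>R \<gamma>1 s = x *\<^sub>R \<gamma>2 t"
      \<comment> \<open>A ray meets \<open>M\<close> only once: comparing the values of
        \<open>F\<close> forces \<open>1 - x = x\<close>, so the two points would coincide.\<close>
      have "F (radii ((1 - x) *\<^sub>R \<gamma>1 s)) = (1 - x)\<^sup>2" "F (radii (x *\<^sub>R \<gamma>2 t)) = x\<^sup>2"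
        using inM by (simp_all add: radii_scaleR homogeneous M_def)
      then have "(1 - x)\<^sup>2 = x\<^sup>2" using eq by simp
      then have half: "1 - x = x" by (rule power2_eq_imp_eq) (use x in auto)
      then have "x \<noteq> 0" by auto
      then have "\<gamma>1 s = \<gamma>2 t" using eq unfolding half by simp
      then show False using dist by auto
    qed
    then show "(1 - x) *\<^sub>R torus_curve a p (2 * \<alpha>) b q (2 * \<beta>) s \<noteq> x *\<^sub>R torus_curve a' p' (2 * \<alpha>) b' q' (2 * \<beta>) t"
      unfolding 1(4) 2(4) .
  qed (use 1 2 T \<alpha> in auto)
  then show ?thesis using \<alpha> T
    by (simp add: g12 rho_def contact_volume_M L)
qed

text \<open>The two coordinate circles form a distinct pair, so infimum and supremum are taken over
  a nonempty set, all of whose values are 1.\<close>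

lemma rho_if_ellipsoid:
  assumes "is_ellipsoid (reinhardt F)"
  shows "rho_minus M lambda0 = 1" and "rho_plus M lambda0 = 1"
proof -
  have "F2 (0, 1) * (pi / F (0, 1)) = pi * of_int 1" using F2_0_1 F_0_1_pos by simp
  then have "\<exists>T. rational_slope 1 T"
    unfolding rational_slope_def using F_0_1_pos by (intro exI[of _ "pi / F (0, 1)"]) (auto intro: exI[of _ 1])
  then have "distinct_orbit_pairs M lambda0 \<noteq> {}" using rho_circle_torus[of 1] by auto
  moreover have "(\<lambda>(g1, g2). ereal (rho M lambda0 g1 g2)) ` distinct_orbit_pairs M lambda0
      = (\<lambda>_. 1) ` distinct_orbit_pairs M lambda0"
    by (rule image_cong) (auto simp: ellipsoid_rho[OF assms] one_ereal_def)
  ultimately have "(\<lambda>(g1, g2). ereal (rho M lambda0 g1 g2)) ` distinct_orbit_pairs M lambda0 = {1}"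
    by (simp add: image_constant_conv)
  then show "rho_minus M lambda0 = 1" "rho_plus M lambda0 = 1"
    unfolding rho_minus_def rho_plus_def by simp_all
qed

end

theorem proposition1p3:
  fixes F :: "real \<times> real \<Rightarrow> real"
    and W M :: "(real ^ 4) set"
  assumes F_nonneg: "\<And>v. 0 \<le> F v"
    and F_homogeneous: "\<And>s v. 0 \<le> s \<Longrightarrow> F (s *\<^sub>R v) = s * F v"
    and F_smooth: "smooth_on (- {0}) F"
    and F_pos: "\<And>v. v \<noteq> 0 \<Longrightarrow> 0 < F v"
  defines "W \<equiv> reinhardt F"
    and "M \<equiv> frontier W"
  shows "rho_minus M lambda0 \<le> 1 \<and> 1 \<le> rho_plus M lambda0 \<and>
         (sys_norm M lambda0 = 0 \<longleftrightarrow> is_ellipsoid W)"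
proof -
  interpret G: reinhardt_gauge F
    using F_homogeneous F_smooth F_pos by unfold_locales
  have M: "M = G.M" unfolding M_def W_def by (rule G.frontier_reinhardt)
  show ?thesis
  proof (cases "is_ellipsoid W")
    case True
    then show ?thesis
      using G.rho_if_ellipsoid unfolding W_def M by (simp add: sys_norm_def)
  next
    case False
    then have s: "rho_minus M lambda0 < 1" "1 < rho_plus M lambda0"
      using G.rho_strict_if_not_ellipsoid unfolding W_def M by auto
    \<comment> \<open>The bounds may be infinite, but lying strictly on opposite sides of 1 they
      exclude the form infinity minus infinity.\<close>
    have "sys_norm M lambda0 \<noteq> 0"
      unfolding sys_norm_def using s
      by (cases "rho_minus M lambda0"; cases "rho_plus M lambda0") (auto simp: one_ereal_def zero_ereal_def)
    then show ?thesis using s False by auto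
  qed
qed

end
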